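(* Let $q(i,j;n)$ be the number of $n$-step walks in the plane that start at $(0,0)$, end at $(i,j)$, take their steps in $\{(1,0),(1,1),(-1,0),(-1,-1)\}$, and never leave the quadrant $\mathbb{N}^2$. Let $$Q(x,y;t)=\sum_{i,j,n\ge 0} q(i,j;n)\,x^iy^jt^n .$$ Then: (1) $Q(x,y;t)$ is algebraic over $\mathbb{Q}(x,y,t)$, of degree $72$. (2) The specialization $Q(0,0;t)$ has degree $8$ (over $\mathbb{Q}(t)$), and can be written as $$Q(0,0;t)=\frac{32\,Z^3(3+3Z-3Z^2+Z^3)}{(1+Z)(Z^2+3)^3},$$ where $Z=\sqrt{T}$ and $T$ is the only power series in $t$ with constant term $1$ satisfying $$T=1+256\,t^2\frac{T^3}{(T+3)^3}.$$ (3) The series $Q(xt,0;t)$ is an even series in $t$ with coefficients in $\mathbb{Q}[x]$, and is cubic over $\mathbb{Q}(Z,x)$. It can be written as $$Q(xt,0;t)=\frac{16\,T(U+UT-2T)\,M(U,Z)}{(1-T)(T+3)^3(U+Z)(U^2-9T+8TU+T^2-TU^2)},$$ where $$M(U,Z)=(T-1)^2U^3+Z(T-1)(T-16Z-1)U^2-TU(T^2+16ZT-82T-16Z+17)-ZT(T^2-18T+128Z+81),$$ and $U$ is the only power series in $t$ with constant term $1$ (and coefficients in $\mathbb{Q}[x]$) satisfying $$16T^2(U^2-T)=x(U+UT-2T)(U^2-9T+8TU+T^2-TU^2).$$ (4) The series $Q(0,y;t)$ is cubic over $\mathbb{Q}(Z,y)$. It can be written as $$Q(0,y;t)=\frac{16\,VZ^3(3+V+T-VT)\,N(V,Z)}{(T-1)(T+3)^3(1+V)^2(1+Z+V-VZ)^2},$$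 where $$N(V,Z)=(Z-1)^2(T+3)V^3+(T-1)(T+2Z-7)V^2+(T-1)(T-2Z-7)V+(Z+1)^2(T+3),$$ and $V$ is the only series in $t$ with constant term $0$ satisfying $$1-T+3V+VT=yV^2(3+V+T-VT).$$
   Context: These are Gessel's walks in the quarter plane: steps East $(1,0)$, North-East $(1,1)$, West $(-1,0)$, South-West $(-1,-1)$; a walk stays in the quadrant if all its vertices have both coordinates non-negative. $Q(x,y;t)$ is a formal power series in $t$ with coefficients in $\mathbb{Q}[x,y]$. *)

theory Defs
  imports
    "HOL-Computational_Algebra.Computational_Algebra"
    "HOL-Library.Product_Plus"
begin

definition gessel_steps :: "(int \<times> int) set" where
  "gessel_steps = {(1, 0), (1, 1), (-1, 0), (-1, -1)}"

(* A walk is given by its list of steps, so the vertex reached after k steps is the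
   componentwise sum of the first k of them. *)
definition gessel_walks :: "nat \<Rightarrow> nat \<Rightarrow> nat \<Rightarrow> (int \<times> int) list set" where
  "gessel_walks i j n = {w. length w = n \<and> set w \<subseteq> gessel_steps \<and> sum_list w = (int i, int j) \<and>
     (\<forall>k\<le>n. 0 \<le> fst (sum_list (take k w)) \<and> 0 \<le> snd (sum_list (take k w)))}"

definition gessel_count :: "nat \<Rightarrow> nat \<Rightarrow> nat \<Rightarrow> nat" where
  "gessel_count i j n = card (gessel_walks i j n)"

(* Q(a, b; t) for arbitrary a, b in R[[t]].  Restricting to i, j \<le> n loses nothing, see
   gessel_count_eq_0.  The sum over n converges t-adically, see sums_gessel_series. *)
definition gessel_series :: "'a::comm_ring_1 fps \<Rightarrow> 'a fps \<Rightarrow> 'a fps" where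
  "gessel_series a b =
     (\<Sum>n. (\<Sum>i\<le>n. \<Sum>j\<le>n. of_nat (gessel_count i j n) * a ^ i * b ^ j) * fps_X ^ n)"

lemma gessel_steps_sum_list_le:
  "set w \<subseteq> gessel_steps \<Longrightarrow> fst (sum_list w) \<le> int (length w) \<and> snd (sum_list w) \<le> int (length w)"
  by (induction w) (auto simp: gessel_steps_def)

lemma gessel_count_eq_0:
  assumes "n < i \<or> n < j"
  shows "gessel_count i j n = 0"
proof -
  have "gessel_walks i j n = {}"
    using assms gessel_steps_sum_list_le by (fastforce simp: gessel_walks_def)
  then show ?thesis
    by (simp add: gessel_count_def)
qed

lemma sums_gessel_series:
  fixes a b :: "'a::comm_ring_1 fps"
  shows "(\<lambda>n. (\<Sum>i\<le>n. \<Sum>j\<le>n. of_nat (gessel_count i j n) * a ^ i * b ^ j) * fps_X ^ n)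
           sums gessel_series a b"
proof -
  define f where
    "f n = (\<Sum>i\<le>n. \<Sum>j\<le>n. of_nat (gessel_count i j n) * a ^ i * b ^ j) * fps_X ^ n" for n
  have 0: "fps_nth (f n) m = 0" if "m < n" for m n
    using that by (simp add: f_def fps_X_power_mult_right_nth)
  have "(\<lambda>N. sum f {..<N}) \<longlonglongrightarrow> Abs_fps (\<lambda>m. \<Sum>n\<le>m. fps_nth (f n) m)"
  proof (rule tendsto_fpsI)
    fix m
    have "fps_nth (sum f {..<N}) m = (\<Sum>n\<le>m. fps_nth (f n) m)" if "N > m" for N
      unfolding fps_sum_nth using that 0 by (intro sum.mono_neutral_right) auto
    then show "\<forall>\<^sub>F N in sequentially.
        fps_nth (sum f {..<N}) m = fps_nth (Abs_fps (\<lambda>m. \<Sum>n\<le>m. fps_nth (f n) m)) m"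
      by (auto intro: eventually_mono[OF eventually_gt_at_top[of m]])
  qed
  then have "summable f"
    by (auto simp: summable_def sums_def)
  then show ?thesis
    unfolding gessel_series_def f_def by (rule summable_sums)
qed

(* In characteristic 0 the generated subfield contains the rationals,
   so that, say, subfield_generated {u, v} is Q(u, v). *)
inductive_set subfield_generated :: "'a::field set \<Rightarrow> 'a set" for S where
  base: "s \<in> S \<Longrightarrow> s \<in> subfield_generated S"
| one: "1 \<in> subfield_generated S"
| diff: "u \<in> subfield_generated S \<Longrightarrow> v \<in> subfield_generated S \<Longrightarrow> u - v \<in> subfield_generated S"
| mult: "u \<in> subfield_generated S \<Longrightarrow> v \<in> subfield_generated S \<Longrightarrow> u * v \<in> subfield_generated S"
| inverse: "u \<in> subfield_generated S \<Longrightarrow> inverse u \<in> subfield_generated S"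

definition annihilates_over :: "'a::field set \<Rightarrow> 'a \<Rightarrow> 'a poly \<Rightarrow> bool" where
  "annihilates_over F a p \<longleftrightarrow> p \<noteq> 0 \<and> (\<forall>i. coeff p i \<in> F) \<and> poly p a = 0"

definition minimal_polynomial :: "'a::field set \<Rightarrow> 'a \<Rightarrow> 'a poly \<Rightarrow> bool" where
  "minimal_polynomial F a p \<longleftrightarrow> lead_coeff p = 1 \<and> annihilates_over F a p \<and>
     (\<forall>r. annihilates_over F a r \<longrightarrow> degree p \<le> degree r)"

definition algebraic_of_degree :: "'a::field set \<Rightarrow> 'a \<Rightarrow> nat \<Rightarrow> bool" where
  "algebraic_of_degree F a d \<longleftrightarrow> (\<exists>p. minimal_polynomial F a p \<and> degree p = d)"

(* The field Q(x,y) is realised as the fraction field of Q[x][y], and Q(x) (also used with the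
   variable called y) as that of Q[x]. *)
definition biv_x :: "rat poly poly fract" where
  "biv_x = to_fract [:[:0, 1:]:]"

definition biv_y :: "rat poly poly fract" where
  "biv_y = to_fract [:0, 1:]"

definition univ_var :: "rat poly fract" where
  "univ_var = to_fract [:0, 1:]"

(* The inclusion of Q[[t]] into Q(x)[[t]]. *)
definition lift_fps :: "rat fps \<Rightarrow> rat poly fract fps" where
  "lift_fps f = Abs_fps (\<lambda>n. to_fract [:fps_nth f n:])"

(* T = Z^2 is kept as a separate argument of M and N. *)
definition gessel_M :: "'a::comm_ring_1 \<Rightarrow> 'a \<Rightarrow> 'a \<Rightarrow> 'a" where
  "gessel_M T U Z =
     (T - 1)^2 * U^3 + Z * (T - 1) * (T - 16 * Z - 1) * U^2
     - T * U * (T^2 + 16 * Z * T - 82 * T - 16 * Z + 17)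
     - Z * T * (T^2 - 18 * T + 128 * Z + 81)"

definition gessel_N :: "'a::comm_ring_1 \<Rightarrow> 'a \<Rightarrow> 'a \<Rightarrow> 'a" where
  "gessel_N T V Z =
     (Z - 1)^2 * (T + 3) * V^3 + (T - 1) * (T + 2 * Z - 7) * V^2
     + (T - 1) * (T - 2 * Z - 7) * V + (Z + 1)^2 * (T + 3)"

end

theory Submission
  imports Defs
begin

text \<open>Along the root \<open>b\<close> of the kernel, a power series in \<open>t\<close> over \<open>\<rat>(x)\<close> with constant term
  \<open>1 / (x - 1)\<close>, the functional equation becomes
  \<open>Q(xt, 0) + (1 + b) Q(0, b) - Q(0, 0) = x b\<close>. This determines the three series, because a polynomial
  in \<open>x\<close> that is also a polynomial in \<open>1 / (x - 1)\<close> is constant. The closed forms satisfy it, because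
  one factor of the kernel, written in \<open>U\<close> and \<open>V\<close>, divides the difference of the two sides.

  The degrees are at most \<open>8\<close>, \<open>3\<close>, \<open>3\<close> and \<open>8 \<cdot> 3 \<cdot> 3\<close> by the equations for \<open>Z\<close>, \<open>U\<close>, \<open>V\<close>. That they are not
  smaller is seen modulo \<open>277\<close>: over \<open>(t\<^sup>2, x, y) = (171, 242, 271)\<close> there are \<open>72\<close> simple solutions \<open>(Z, U, V)\<close>
  in the prime field, and \<open>A = Q(xt, 0) - Q(0, 0) + (1 + y) Q(0, y)\<close> takes different values at them. A polynomial relation
  for \<open>A\<close> over \<open>\<rat>(t\<^sup>2, x, y)\<close> can be specialized, so that it has these \<open>72\<close> values as zeros.\<close>

section \<open>Walks and their generating series\<close>

text \<open>A relation specialized at a point of the prime field could become trivial. It is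
  therefore specialized at three series 171 + X, 242 + X, 271 + X in independent variables over that
  field: an integer polynomial vanishes there only if 277 divides it, so a relation freed of common
  powers of 277 stays nonzero. The 72 solutions are simple, hence lift to this generic point by
  Hensel's lemma, and the lifted values of A differ because their residues do. The prime and the
  point are such that the whole fibre is rational: eight values of Z, and over each of them three of
  U and three of V. The fibre lies over t^2 and not over t, because t^2, x and y are rational
  functions of Z, U, V while t is not. This is no loss: as t lies outside \<rat>(Z, U, V), the even
  and the odd part in t of a relation for an element of \<rat>(Z, U, V) vanish separately. The
  equation along the root of the kernel involves Q(xt, 0) and Q(0, 0) only through their difference.
  They are separated by setting y = 0 in Q(0, y).\<close>

lemma fps_X_power_dvd_iff:
  fixes f :: "'a::comm_ring_1 fps"
  shows "fps_X ^ n dvd f \<longleftrightarrow> (\<forall>i<n. fps_nth f i = 0)"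
proof
  assume "\<forall>i<n. fps_nth f i = 0"
  then have "f = fps_X ^ n * fps_shift n f"
    by (intro fps_ext) (simp add: fps_X_power_mult_nth)
  then show "fps_X ^ n dvd f"
    by (metis dvd_triv_left)
qed (auto simp: fps_X_power_mult_nth elim!: dvdE)

section \<open>Hensel's lemma for power series over a domain\<close>

lemma poly_diff_factor:
  fixes F :: "'a::idom fps poly"
  shows "\<exists>H. poly F a - poly F b = (a - b) * H
           \<and> (fps_nth a 0 = fps_nth b 0 \<longrightarrow> fps_nth H 0 = fps_nth (poly (pderiv F) a) 0)"
proof (induction F)
  case 0
  show ?case
    by (intro exI[of _ 0]) simp
next
  case (pCons c F)
  then obtain H where H: "poly F a - poly F b = (a - b) * H"
    "fps_nth a 0 = fps_nth b 0 \<longrightarrow> fps_nth H 0 = fps_nth (poly (pderiv F) a) 0"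
    by blast
  have "poly (pCons c F) a - poly (pCons c F) b = a * (poly F a - poly F b) + (a - b) * poly F b"
    by (simp add: algebra_simps)
  then have "poly (pCons c F) a - poly (pCons c F) b = (a - b) * (a * H + poly F b)"
    unfolding H by (simp add: algebra_simps)
  moreover have "fps_nth (poly F b) 0 = fps_nth (poly F a) 0" if "fps_nth a 0 = fps_nth b 0"
    using arg_cong[OF H(1), of "\<lambda>f. fps_nth f 0"] that by simp
  ultimately show ?case
    using H(2) by (intro exI[of _ "a * H + poly F b"]) (simp add: pderiv_pCons add.commute)
qed

lemma fps_hensel:
  fixes F :: "'a::idom fps poly"
  assumes "fps_nth (poly F S0) 0 = 0" "e * fps_nth (poly (pderiv F) S0) 0 = 1"
  shows "\<exists>!S. fps_nth S 0 = fps_nth S0 0 \<and> poly F S = 0"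
proof -
  \<comment> \<open>Newton's iteration with the fixed slope \<open>e\<close>, the inverse of the
    derivative modulo t. It is passed as a witness because the coefficients, later polynomials in x,
    need not form a field.\<close>
  define G where "G S = S - fps_const e * poly F S" for S
  define A where "A k = (G ^^ k) S0" for k
  have A_Suc: "A (Suc k) = A k - fps_const e * poly F (A k)" for k
    by (simp add: A_def G_def)
  have pd: "fps_nth (poly (pderiv F) S) 0 = fps_nth (poly (pderiv F) S0) 0"
    if "fps_nth S 0 = fps_nth S0 0" for S
  proof -
    obtain H where "poly (pderiv F) S - poly (pderiv F) S0 = (S - S0) * H"
      using poly_diff_factor by blast
    from arg_cong[OF this, of "\<lambda>f. fps_nth f 0"] that show ?thesis
      by simp
  qed
  have A: "fps_nth (A k) 0 = fps_nth S0 0 \<and> fps_X ^ Suc k dvd poly F (A k)" for k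
  proof (induction k)
    case 0
    then show ?case
      unfolding fps_X_power_dvd_iff using assms(1) by (auto simp: A_def)
  next
    case (Suc k)
    then have F0: "fps_nth (poly F (A k)) 0 = 0"
      unfolding fps_X_power_dvd_iff by blast
    then have 0: "fps_nth (A (Suc k)) 0 = fps_nth S0 0"
      using Suc by (simp add: A_Suc)
    \<comment> \<open>Modulo t the cofactor \<open>H\<close> is the derivative, so 1 - e H has
      constant term 0 and every step gains one order.\<close>
    obtain H where H: "poly F (A (Suc k)) - poly F (A k) = (A (Suc k) - A k) * H"
      "fps_nth H 0 = fps_nth (poly (pderiv F) (A (Suc k))) 0"
      using poly_diff_factor[of F "A (Suc k)" "A k"] Suc 0 by auto
    have "poly F (A (Suc k)) = poly F (A k) * (1 - fps_const e * H)"
      using H(1) unfolding A_Suc by (simp add: algebra_simps)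
    moreover have "fps_X ^ 1 dvd 1 - fps_const e * H"
      unfolding fps_X_power_dvd_iff using H(2) pd[OF 0] assms(2) by simp
    ultimately have "fps_X ^ Suc k * fps_X ^ 1 dvd poly F (A (Suc k))"
      using Suc mult_dvd_mono by metis
    with 0 show ?case
      by (simp add: mult.commute)
  qed
  have A_nth: "fps_nth (A (n + m)) i = fps_nth (A n) i" if "i \<le> n" for n m i
  proof (induction m)
    case (Suc m)
    have "fps_nth (fps_const e * poly F (A (n + m))) i = 0"
      using A[of "n + m"] that unfolding fps_X_power_dvd_iff by auto
    with Suc show ?case
      by (simp add: A_Suc)
  qed simp
  define S where "S = Abs_fps (\<lambda>n. fps_nth (A n) n)"
  have S_nth: "fps_nth S i = fps_nth (A n) i" if "i \<le> n" for n i
    using A_nth[of i i "n - i"] that by (simp add: S_def)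
  have "poly F S = 0"
  proof (rule fps_ext)
    fix n
    obtain H where "poly F S - poly F (A n) = (S - A n) * H"
      using poly_diff_factor by blast
    moreover have "fps_X ^ Suc n dvd S - A n"
      unfolding fps_X_power_dvd_iff by (auto simp: S_nth[of _ n])
    ultimately have "fps_X ^ Suc n dvd poly F S"
      using A[of n] by (metis diff_add_cancel dvd_add dvd_mult2)
    then show "fps_nth (poly F S) n = fps_nth 0 n"
      unfolding fps_X_power_dvd_iff by simp
  qed
  moreover have "fps_nth S 0 = fps_nth S0 0"
    using A[of 0] by (simp add: S_def)
  moreover have "S' = S''" if "fps_nth S' 0 = fps_nth S0 0" "poly F S' = 0"
    "fps_nth S'' 0 = fps_nth S0 0" "poly F S'' = 0" for S' S''
  proof -
    have "fps_nth S' 0 = fps_nth S'' 0"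
      using that by simp
    then obtain H where "poly F S' - poly F S'' = (S' - S'') * H"
      "fps_nth H 0 = fps_nth (poly (pderiv F) S') 0"
      using poly_diff_factor[of F S' S''] by metis
    \<comment> \<open>The constant term of the cofactor is a unit, so the cofactor can be cancelled
      in the domain.\<close>
    moreover have "H \<noteq> 0"
      using calculation(2) that pd[of S'] assms(2) by auto
    ultimately show ?thesis
      using that by simp
  qed
  ultimately show ?thesis
    by blast
qed

lemma fps_unit_inverse:
  fixes f :: "'a::idom fps"
  assumes "e * fps_nth f 0 = 1"
  shows "\<exists>g. f * g = 1"
proof -
  have "\<exists>!S. fps_nth S 0 = fps_nth (fps_const e) 0 \<and> poly [:- 1, f:] S = 0"
    using assms by (intro fps_hensel[where e = e]) (auto simp: pderiv_pCons mult.commute)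
  then show ?thesis
    by (auto simp: mult.commute)
qed

text \<open>The map R[[t]][[s]] to R[[t]] that puts s = t. Here s counts the steps of a walk, while
  t occurs in the arguments x = a(t) and y = b(t); identities are proved coefficientwise in s before
  the two are merged.\<close>

definition fps_collapse :: "'a::comm_ring_1 fps fps \<Rightarrow> 'a fps" where
  "fps_collapse A = Abs_fps (\<lambda>n. \<Sum>m\<le>n. fps_nth (fps_nth A m) (n - m))"

lemma fps_collapse_nth: "fps_nth (fps_collapse A) n = (\<Sum>m\<le>n. fps_nth (fps_nth A m) (n - m))"
  by (simp add: fps_collapse_def)

lemma fps_collapse_add: "fps_collapse (A + B) = fps_collapse A + fps_collapse B"
  by (rule fps_ext) (simp add: fps_collapse_nth sum.distrib)

lemma fps_collapse_diff: "fps_collapse (A - B) = fps_collapse A - fps_collapse B"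
  by (rule fps_ext) (simp add: fps_collapse_nth sum_subtractf)

lemma fps_collapse_const [simp]: "fps_collapse (fps_const c) = c"
proof (rule fps_ext)
  fix n
  have "(\<Sum>m\<le>n. fps_nth (if m = 0 then c else 0) (n - m)) = (\<Sum>m\<in>{0}. fps_nth (if m = 0 then c else 0) (n - m))"
    by (intro sum.mono_neutral_right) auto
  then show "fps_nth (fps_collapse (fps_const c)) n = fps_nth c n"
    by (simp add: fps_collapse_nth)
qed

lemma fps_collapse_X [simp]: "fps_collapse fps_X = fps_X"
proof (rule fps_ext)
  fix n
  show "fps_nth (fps_collapse fps_X) n = fps_nth (fps_X :: 'a fps) n"
  proof (cases n)
    case (Suc k)
    have "(\<Sum>m\<le>Suc k. fps_nth (if m = 1 then 1 else 0) (Suc k - m)) =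
          (\<Sum>m\<in>{1}. fps_nth (if m = 1 then 1 else 0 :: 'a fps) (Suc k - m))"
      by (intro sum.mono_neutral_right) auto
    with Suc show ?thesis
      by (simp add: fps_collapse_nth fps_X_def fps_one_nth)
  qed (simp add: fps_collapse_nth fps_X_def)
qed

lemma fps_collapse_mult: "fps_collapse (A * B) = fps_collapse A * fps_collapse B"
proof (rule fps_ext)
  fix n
  have "fps_nth (fps_collapse (A * B)) n = (\<Sum>m\<le>n. \<Sum>i\<le>m. \<Sum>j\<le>n - m.
      fps_nth (fps_nth A i) j * fps_nth (fps_nth B (m - i)) (n - m - j))"
    by (simp add: fps_collapse_nth fps_mult_nth fps_sum_nth atLeast0AtMost)
  also have "\<dots> = (\<Sum>(m, i, j)\<in>(SIGMA m:{..n}. SIGMA i:{..m}. {..n - m}).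
      fps_nth (fps_nth A i) j * fps_nth (fps_nth B (m - i)) (n - m - j))"
    by (simp add: sum.Sigma)
  \<comment> \<open>The new outer index k = i + j is the total degree taken from \<open>A\<close>,
    and n - k is the one taken from \<open>B\<close>.\<close>
  also have "\<dots> = (\<Sum>(k, i, l)\<in>(SIGMA k:{..n}. SIGMA i:{..k}. {..n - k}).
      fps_nth (fps_nth A i) (k - i) * fps_nth (fps_nth B l) (n - k - l))"
    by (rule sum.reindex_bij_witness
          [where i = "\<lambda>(k, i, l). (i + l, i, k - i)" and j = "\<lambda>(m, i, j). (i + j, i, m - i)"])
      (auto simp: add.commute)
  also have "\<dots> = (\<Sum>k\<le>n. \<Sum>i\<le>k. \<Sum>l\<le>n - k.
      fps_nth (fps_nth A i) (k - i) * fps_nth (fps_nth B l) (n - k - l))"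
    by (simp add: sum.Sigma)
  also have "\<dots> = fps_nth (fps_collapse A * fps_collapse B) n"
    by (simp add: fps_collapse_nth fps_mult_nth atLeast0AtMost sum_product)
  finally show "fps_nth (fps_collapse (A * B)) n = fps_nth (fps_collapse A * fps_collapse B) n" .
qed

lemma gessel_series_collapse:
  "gessel_series a b =
     fps_collapse (Abs_fps (\<lambda>n. \<Sum>i\<le>n. \<Sum>j\<le>n. of_nat (gessel_count i j n) * a ^ i * b ^ j))"
proof -
  define q where "q n = (\<Sum>i\<le>n. \<Sum>j\<le>n. of_nat (gessel_count i j n) * a ^ i * b ^ j)" for n
  have "(\<lambda>N. \<Sum>n<N. q n * fps_X ^ n) \<longlonglongrightarrow> fps_collapse (Abs_fps q)"
  proof (rule tendsto_fpsI)
    fix m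
    have "fps_nth (\<Sum>n<N. q n * fps_X ^ n) m = fps_nth (fps_collapse (Abs_fps q)) m" if "N > m" for N
    proof -
      have "fps_nth (\<Sum>n<N. q n * fps_X ^ n) m = (\<Sum>n\<le>m. fps_nth (q n * fps_X ^ n) m)"
        unfolding fps_sum_nth using that
        by (intro sum.mono_neutral_right) (auto simp: fps_X_power_mult_right_nth)
      then show ?thesis
        by (simp add: fps_collapse_nth fps_X_power_mult_right_nth)
    qed
    then show "\<forall>\<^sub>F N in sequentially.
        fps_nth (\<Sum>n<N. q n * fps_X ^ n) m = fps_nth (fps_collapse (Abs_fps q)) m"
      by (auto intro: eventually_mono[OF eventually_gt_at_top[of m]])
  qed
  then have "(\<lambda>n. q n * fps_X ^ n) sums fps_collapse (Abs_fps q)"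
    by (simp add: sums_def)
  moreover have "(\<lambda>n. q n * fps_X ^ n) sums gessel_series a b"
    unfolding q_def by (rule sums_gessel_series)
  ultimately show ?thesis
    unfolding q_def by (rule sums_unique2[symmetric])
qed

section \<open>Recursion by the last step and the functional equation\<close>

lemma gessel_walks_Suc:
  "gessel_walks i j (Suc n) = (\<Union>s\<in>gessel_steps.
     {w @ [s] | w. length w = n \<and> set w \<subseteq> gessel_steps \<and> sum_list w + s = (int i, int j) \<and>
        (\<forall>k\<le>n. 0 \<le> fst (sum_list (take k w)) \<and> 0 \<le> snd (sum_list (take k w)))})"
  (is "_ = (\<Union>s\<in>_. ?B s)")
proof (intro equalityI subsetI)
  fix w assume w: "w \<in> gessel_walks i j (Suc n)"
  then have len: "length w = Suc n"
    by (simp add: gessel_walks_def)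
  then obtain v s where v: "w = v @ [s]"
    by (metis append_butlast_last_id list.size(3) nat.distinct(1))
  have tk: "take k v = take k w" if "k \<le> n" for k
    using len that by (simp add: v)
  have "\<forall>k\<le>n. 0 \<le> fst (sum_list (take k v)) \<and> 0 \<le> snd (sum_list (take k v))"
    using w tk by (simp add: gessel_walks_def)
  then have "v @ [s] \<in> ?B s"
    using w len by (simp add: gessel_walks_def v)
  moreover have "s \<in> gessel_steps"
    using w by (auto simp: gessel_walks_def v)
  ultimately show "w \<in> (\<Union>s\<in>gessel_steps. ?B s)"
    unfolding v by blast
next
  fix w assume "w \<in> (\<Union>s\<in>gessel_steps. ?B s)"
  then obtain v s where v: "w = v @ [s]" "s \<in> gessel_steps" "length v = n" "set v \<subseteq> gessel_steps"
    "sum_list v + s = (int i, int j)"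
    "\<forall>k\<le>n. 0 \<le> fst (sum_list (take k v)) \<and> 0 \<le> snd (sum_list (take k v))"
    by blast
  have "0 \<le> fst (sum_list (take k w)) \<and> 0 \<le> snd (sum_list (take k w))" if "k \<le> Suc n" for k
  proof (cases "k \<le> n")
    case False
    with that v show ?thesis
      by simp
  qed (use v in auto)
  with v show "w \<in> gessel_walks i j (Suc n)"
    by (auto simp: gessel_walks_def)
qed

lemma finite_gessel_walks: "finite (gessel_walks i j n)"
proof (rule finite_subset)
  show "gessel_walks i j n \<subseteq> {w. set w \<subseteq> gessel_steps \<and> length w = n}"
    by (auto simp: gessel_walks_def)
qed (auto intro!: finite_lists_length_eq simp: gessel_steps_def)

lemma card_gessel_walks_last:
  "card {w @ [s] | w. length w = n \<and> set w \<subseteq> gessel_steps \<and> sum_list w + s = (int i, int j) \<and>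
        (\<forall>k\<le>n. 0 \<le> fst (sum_list (take k w)) \<and> 0 \<le> snd (sum_list (take k w)))} =
    (if fst s \<le> int i \<and> snd s \<le> int j then gessel_count (nat (int i - fst s)) (nat (int j - snd s)) n else 0)"
    (is "card ?A = _")
proof (cases "fst s \<le> int i \<and> snd s \<le> int j")
  case True
  then have "?A = (\<lambda>w. w @ [s]) ` gessel_walks (nat (int i - fst s)) (nat (int j - snd s)) n"
    by (auto simp: gessel_walks_def prod_eq_iff)
  moreover have "inj_on (\<lambda>w. w @ [s]) X" for X
    by (auto simp: inj_on_def)
  ultimately show ?thesis
    using True by (simp add: card_image gessel_count_def)
next
  case False
  have "?A = {}"
  proof (rule ccontr)
    assume "?A \<noteq> {}"
    then obtain w where w: "length w = n" "sum_list w + s = (int i, int j)"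
      "\<forall>k\<le>n. 0 \<le> fst (sum_list (take k w)) \<and> 0 \<le> snd (sum_list (take k w))"
      by blast
    then have "0 \<le> fst (sum_list w) \<and> 0 \<le> snd (sum_list w)"
      by fastforce
    with w False show False
      by (auto simp: prod_eq_iff)
  qed
  then have "card ?A = 0"
    by (simp only: card.empty)
  with False show ?thesis
    by (simp only: if_False)
qed

lemma gessel_count_0: "gessel_count i j 0 = (if i = 0 \<and> j = 0 then 1 else 0)"
proof -
  have "gessel_walks i j 0 = (if i = 0 \<and> j = 0 then {[]} else {})"
    by (auto simp: gessel_walks_def zero_prod_def)
  then show ?thesis
    by (simp add: gessel_count_def)
qed

lemma gessel_count_Suc:
  "gessel_count i j (Suc n) =
     (if i \<ge> 1 then gessel_count (i - 1) j n else 0) +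
     (if i \<ge> 1 \<and> j \<ge> 1 then gessel_count (i - 1) (j - 1) n else 0) +
     gessel_count (i + 1) j n + gessel_count (i + 1) (j + 1) n"
proof -
  let ?B = "\<lambda>s. {w @ [s] | w. length w = n \<and> set w \<subseteq> gessel_steps \<and> sum_list w + s = (int i, int j) \<and>
        (\<forall>k\<le>n. 0 \<le> fst (sum_list (take k w)) \<and> 0 \<le> snd (sum_list (take k w)))}"
  have "finite (?B s)" if "s \<in> gessel_steps" for s
    using finite_subset[OF _ finite_gessel_walks[of i j "Suc n"]] that
    unfolding gessel_walks_Suc by blast
  then have "card (\<Union>s\<in>gessel_steps. ?B s) = (\<Sum>s\<in>gessel_steps. card (?B s))"
    by (intro card_UN_disjoint) (auto simp: gessel_steps_def)
  then have "gessel_count i j (Suc n) = (\<Sum>s\<in>gessel_steps. if fst s \<le> int i \<and> snd s \<le> int j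
      then gessel_count (nat (int i - fst s)) (nat (int j - snd s)) n else 0)"
    unfolding gessel_count_def[of i j "Suc n"] gessel_walks_Suc by (simp only: card_gessel_walks_last)
  also have "\<dots> = (if i \<ge> 1 then gessel_count (i - 1) j n else 0) +
     (if i \<ge> 1 \<and> j \<ge> 1 then gessel_count (i - 1) (j - 1) n else 0) +
     gessel_count (i + 1) j n + gessel_count (i + 1) (j + 1) n"
    by (auto simp: gessel_steps_def nat_diff_distrib nat_add_distrib)
  finally show ?thesis .
qed

text \<open>Every step changes the abscissa by one, so the abscissa has the parity of the length.
  This makes Q(xt, 0) even in t.\<close>

lemma gessel_count_parity: "odd (i + n) \<Longrightarrow> gessel_count i j n = 0"
proof (induction n arbitrary: i j)
  case (Suc n)
  then show ?case
    by (auto simp: gessel_count_Suc)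
qed (auto simp: gessel_count_0 elim: oddE)

definition gessel_poly :: "'a::comm_ring_1 \<Rightarrow> 'a \<Rightarrow> nat \<Rightarrow> 'a" where
  "gessel_poly a b n = (\<Sum>i\<le>n. \<Sum>j\<le>n. of_nat (gessel_count i j n) * a ^ i * b ^ j)"

text \<open>Shifted sums leave the square i, j \<le> n. Larger rectangles only add zero terms and
  make the ranges on the two sides agree.\<close>

lemma gessel_poly_bound:
  assumes "n \<le> M" "n \<le> K"
  shows "gessel_poly a b n = (\<Sum>i\<le>M. \<Sum>j\<le>K. of_nat (gessel_count i j n) * a ^ i * b ^ j)"
proof -
  have "(\<Sum>i\<le>M. \<Sum>j\<le>K. of_nat (gessel_count i j n) * a ^ i * b ^ j) =
        (\<Sum>i\<le>n. \<Sum>j\<le>K. of_nat (gessel_count i j n) * a ^ i * b ^ j)"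
    using assms by (intro sum.mono_neutral_right) (auto simp: gessel_count_eq_0)
  also have "\<dots> = (\<Sum>i\<le>n. \<Sum>j\<le>n. of_nat (gessel_count i j n) * a ^ i * b ^ j)"
    using assms by (intro sum.cong refl sum.mono_neutral_right) (auto simp: gessel_count_eq_0)
  finally show ?thesis
    by (simp add: gessel_poly_def)
qed

lemma gessel_poly_0: "gessel_poly a b 0 = 1"
  by (simp add: gessel_poly_def gessel_count_0)

text \<open>West steps are forbidden from one axis and South-West steps from both; inclusion and
  exclusion at the origin gives the last term. The factor a b replaces division by a and b, which
  may be 0.\<close>

lemma gessel_poly_Suc:
  "a * b * gessel_poly a b (Suc n) = (a\<^sup>2 * b + a\<^sup>2 * b\<^sup>2 + b + 1) * gessel_poly a b n
     - gessel_poly a 0 n - (1 + b) * gessel_poly 0 b n + gessel_poly 0 0 n"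
proof -
  let ?M = "Suc n"
  define g where "g i j = (of_nat (gessel_count i j n) :: 'a)" for i j
  have c: "of_nat (gessel_count i j (Suc n)) = (if i = 0 then 0 else g (i - 1) j) +
      (if i = 0 \<or> j = 0 then 0 else g (i - 1) (j - 1)) + g (Suc i) j + g (Suc i) (Suc j)" for i j
    by (auto simp: gessel_count_Suc g_def)
  have q: "gessel_poly a' b' n = (\<Sum>i\<le>M. \<Sum>j\<le>K. g i j * a' ^ i * b' ^ j)"
    if "n \<le> M" "n \<le> K" for M K and a' b' :: 'a
    unfolding g_def using that by (rule gessel_poly_bound)
  have q0: "gessel_poly 0 b' n = (\<Sum>j\<le>K. g 0 j * b' ^ j)" if "n \<le> K" for K b'
    using q[of 0 K 0 b'] q[of n K 0 b'] that
    by (simp add: sum.atMost_shift power_0_left)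
  have qa0: "gessel_poly a' 0 n = (\<Sum>i\<le>K. g i 0 * a' ^ i)" if "n \<le> K" for K a'
    using q[of K n a' 0] that by (simp add: sum.atMost_shift power_0_left)
  have "gessel_poly a b (Suc n) =
      (\<Sum>i\<le>?M. \<Sum>j\<le>?M. (if i = 0 then 0 else g (i - 1) j) * a ^ i * b ^ j) +
      (\<Sum>i\<le>?M. \<Sum>j\<le>?M. (if i = 0 \<or> j = 0 then 0 else g (i - 1) (j - 1)) * a ^ i * b ^ j) +
      (\<Sum>i\<le>?M. \<Sum>j\<le>?M. g (Suc i) j * a ^ i * b ^ j) +
      (\<Sum>i\<le>?M. \<Sum>j\<le>?M. g (Suc i) (Suc j) * a ^ i * b ^ j)" (is "_ = ?A1 + ?A2 + ?A3 + ?A4")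
    by (simp only: gessel_poly_def c distrib_right sum.distrib)
  moreover have "?A1 = a * gessel_poly a b n"
    unfolding q[of n ?M, OF le_refl le_SucI[OF le_refl]]
    by (subst sum.atMost_Suc_shift) (simp add: sum_distrib_left mult_ac del: sum.atMost_Suc)
  moreover have "?A2 = a * b * gessel_poly a b n"
    unfolding q[OF le_refl le_refl]
    by (simp add: sum.atMost_Suc_shift sum_distrib_left mult_ac del: sum.atMost_Suc)
  moreover have "a * ?A3 = gessel_poly a b n - gessel_poly 0 b n"
  proof -
    have "gessel_poly a b n = (\<Sum>i\<le>Suc ?M. \<Sum>j\<le>?M. g i j * a ^ i * b ^ j)"
      by (rule q) auto
    also have "\<dots> = (\<Sum>j\<le>?M. g 0 j * b ^ j) + a * ?A3"
      by (subst sum.atMost_Suc_shift) (simp add: sum_distrib_left mult_ac del: sum.atMost_Suc)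
    finally show ?thesis
      using q0[of ?M b] by simp
  qed
  moreover have "a * b * ?A4 = gessel_poly a b n - gessel_poly 0 b n - gessel_poly a 0 n + gessel_poly 0 0 n"
  proof -
    have "gessel_poly a b n = (\<Sum>i\<le>Suc ?M. \<Sum>j\<le>Suc ?M. g i j * a ^ i * b ^ j)"
      by (rule q) auto
    also have "\<dots> = (\<Sum>j\<le>Suc ?M. g 0 j * b ^ j) + (\<Sum>i\<le>?M. \<Sum>j\<le>Suc ?M. g (Suc i) j * a ^ Suc i * b ^ j)"
      by (subst sum.atMost_Suc_shift) (simp del: sum.atMost_Suc)
    also have "(\<Sum>i\<le>?M. \<Sum>j\<le>Suc ?M. g (Suc i) j * a ^ Suc i * b ^ j) =
        (\<Sum>i\<le>?M. g (Suc i) 0 * a ^ Suc i) + (\<Sum>i\<le>?M. \<Sum>j\<le>?M. g (Suc i) (Suc j) * a ^ Suc i * b ^ Suc j)"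
      unfolding sum.atMost_Suc_shift[of _ ?M] by (simp add: sum.distrib del: sum.atMost_Suc)
    also have "(\<Sum>i\<le>?M. \<Sum>j\<le>?M. g (Suc i) (Suc j) * a ^ Suc i * b ^ Suc j) = a * b * ?A4"
      by (simp add: sum_distrib_left mult_ac del: sum.atMost_Suc)
    also have "(\<Sum>i\<le>?M. g (Suc i) 0 * a ^ Suc i) = gessel_poly a 0 n - gessel_poly 0 0 n"
    proof -
      have "gessel_poly a 0 n = (\<Sum>i\<le>Suc ?M. g i 0 * a ^ i)"
        by (rule qa0) simp
      also have "\<dots> = g 0 0 + (\<Sum>i\<le>?M. g (Suc i) 0 * a ^ Suc i)"
        unfolding sum.atMost_Suc_shift[of _ ?M] by simp
      also have "g 0 0 = gessel_poly 0 0 n"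
        using q0[of n 0] by (simp add: power_0_left sum.atMost_shift)
      finally show ?thesis
        by simp
    qed
    finally show ?thesis
      using q0[of "Suc ?M" b] by (simp del: sum.atMost_Suc)
  qed
  \<comment> \<open>\<open>A3\<close> and \<open>A4\<close> are known only up to the factors a and a
    b, hence the regrouping.\<close>
  moreover have "a * b * G = (a\<^sup>2 * b + a\<^sup>2 * b\<^sup>2 + b + 1) * q - qa - (1 + b) * qb + q0"
    if "G = A1 + A2 + A3 + A4" "A1 = a * q" "A2 = a * b * q" "a * A3 = q - qb"
      "a * b * A4 = q - qb - qa + q0" for G A1 A2 A3 A4 q qa qb q0
  proof -
    have "a * b * G = a * b * (a * q) + a * b * (a * b * q) + b * (a * A3) + a * b * A4"
      using that(1-3) by (simp add: algebra_simps)
    then show ?thesis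
      unfolding that(4,5) by (simp add: algebra_simps power2_eq_square)
  qed
  ultimately show ?thesis
    by blast
qed

text \<open>The equation is summed with a separate variable for the length, which is then identified
  with t. So a and b can be arbitrary series in t, in particular b can be the root of the
  kernel.\<close>

lemma gessel_series_functional_eq:
  fixes a b :: "'a::comm_ring_1 fps"
  shows "(a * b - fps_X * (a\<^sup>2 * b + a\<^sup>2 * b\<^sup>2 + b + 1)) * gessel_series a b =
    a * b - fps_X * gessel_series a 0 - fps_X * (1 + b) * gessel_series 0 b + fps_X * gessel_series 0 0"
proof -
  define Q where "Q a b = Abs_fps (gessel_poly a b)" for a b :: "'a fps"
  have Q: "gessel_series a b = fps_collapse (Q a b)" for a b :: "'a fps"
    unfolding gessel_series_collapse Q_def gessel_poly_def[abs_def] ..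
  have "fps_const (a * b) * Q a b = fps_const (a * b) +
      fps_X * (fps_const (a\<^sup>2 * b + a\<^sup>2 * b\<^sup>2 + b + 1) * Q a b - Q a 0 - fps_const (1 + b) * Q 0 b + Q 0 0)"
  proof (rule fps_ext)
    fix n
    show "fps_nth (fps_const (a * b) * Q a b) n = fps_nth (fps_const (a * b) +
      fps_X * (fps_const (a\<^sup>2 * b + a\<^sup>2 * b\<^sup>2 + b + 1) * Q a b - Q a 0 - fps_const (1 + b) * Q 0 b + Q 0 0)) n"
      by (cases n) (simp_all add: Q_def gessel_poly_0 gessel_poly_Suc)
  qed
  from arg_cong[OF this, of fps_collapse] show ?thesis
    unfolding fps_collapse_mult fps_collapse_add fps_collapse_diff fps_collapse_const fps_collapse_X Q[symmetric]
    by (simp add: algebra_simps)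
qed

section \<open>Ring homomorphisms and substitution of series\<close>

definition ring_morph :: "('a::comm_ring_1 \<Rightarrow> 'b::comm_ring_1) \<Rightarrow> bool" where
  "ring_morph h \<longleftrightarrow> h 1 = 1 \<and> (\<forall>x y. h (x + y) = h x + h y) \<and> (\<forall>x y. h (x * y) = h x * h y)"

lemma ring_morphI:
  "h 1 = 1 \<Longrightarrow> (\<And>x y. h (x + y) = h x + h y) \<Longrightarrow> (\<And>x y. h (x * y) = h x * h y) \<Longrightarrow> ring_morph h"
  by (simp add: ring_morph_def)

context
  fixes h :: "'a::comm_ring_1 \<Rightarrow> 'b::comm_ring_1"
  assumes h: "ring_morph h"
begin

lemma ring_morph_1: "h 1 = 1"
  and ring_morph_add: "h (x + y) = h x + h y"
  and ring_morph_mult: "h (x * y) = h x * h y"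
  using h by (simp_all add: ring_morph_def)

lemma ring_morph_0: "h 0 = 0"
  using ring_morph_add[of 0 0] by simp

lemma ring_morph_minus: "h (- x) = - h x"
  using ring_morph_add[of x "- x"] by (simp add: ring_morph_0 eq_neg_iff_add_eq_0 add.commute)

lemma ring_morph_diff: "h (x - y) = h x - h y"
  using ring_morph_add[of x "- y"] by (simp add: ring_morph_minus)

lemma ring_morph_power: "h (x ^ n) = h x ^ n"
  by (induction n) (simp_all add: ring_morph_1 ring_morph_mult)

lemma ring_morph_of_nat: "h (of_nat n) = of_nat n"
  by (induction n) (simp_all add: ring_morph_0 ring_morph_1 ring_morph_add)

lemma ring_morph_numeral: "h (numeral n) = numeral n"
  using ring_morph_of_nat[of "numeral n"] by simp

lemma ring_morph_of_int: "h (of_int n) = of_int n"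
  by (cases n rule: int_cases2) (simp_all add: ring_morph_of_nat ring_morph_minus)

lemma ring_morph_sum: "h (sum f A) = (\<Sum>i\<in>A. h (f i))"
  by (induction A rule: infinite_finite_induct) (simp_all add: ring_morph_0 ring_morph_add)

lemmas ring_morph_simps = ring_morph_0 ring_morph_1 ring_morph_add ring_morph_mult ring_morph_minus
  ring_morph_diff ring_morph_power ring_morph_of_nat ring_morph_numeral ring_morph_of_int

definition poly_eval :: "'b \<Rightarrow> 'a poly \<Rightarrow> 'b" where
  "poly_eval a p = poly (map_poly h p) a"

lemma poly_eval_0: "poly_eval a 0 = 0"
  and poly_eval_pCons: "poly_eval a (pCons c p) = h c + a * poly_eval a p"
  by (simp_all add: poly_eval_def map_poly_pCons ring_morph_0)

lemma poly_eval_add: "poly_eval a (p + q) = poly_eval a p + poly_eval a q"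
  by (induction p q rule: poly_induct2)
    (simp_all add: poly_eval_0 poly_eval_pCons ring_morph_add algebra_simps)

lemma poly_eval_smult: "poly_eval a (smult c p) = h c * poly_eval a p"
  by (induction p) (simp_all add: poly_eval_0 poly_eval_pCons ring_morph_mult algebra_simps)

lemma poly_eval_mult: "poly_eval a (p * q) = poly_eval a p * poly_eval a q"
  by (induction p)
    (simp_all add: poly_eval_0 poly_eval_pCons poly_eval_add poly_eval_smult ring_morph_0 algebra_simps)

lemma ring_morph_poly: "ring_morph (\<lambda>p. poly (map_poly h p) a)"
proof (rule ring_morphI)
  show "poly (map_poly h 1) a = 1"
    by (simp add: map_poly_1 ring_morph_1)
qed (use poly_eval_add poly_eval_mult in \<open>simp_all add: poly_eval_def\<close>)

lemma ring_morph_comp: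
  fixes g :: "'b \<Rightarrow> 'c::comm_ring_1"
  assumes "ring_morph g"
  shows "ring_morph (\<lambda>x. g (h x))"
  using h assms by (simp add: ring_morph_def)

end

definition fps_map :: "('a \<Rightarrow> 'b) \<Rightarrow> 'a fps \<Rightarrow> 'b fps" where
  "fps_map h f = Abs_fps (\<lambda>n. h (fps_nth f n))"

lemma fps_map_nth [simp]: "fps_nth (fps_map h f) n = h (fps_nth f n)"
  by (simp add: fps_map_def)

lemma ring_morph_fps_map:
  assumes "ring_morph h"
  shows "ring_morph (fps_map h)"
  by (intro ring_morphI fps_ext)
    (simp_all add: fps_mult_nth ring_morph_simps[OF assms] ring_morph_sum[OF assms] fps_one_nth)

lemma ring_morph_collapse: "ring_morph fps_collapse"
  using fps_collapse_const[of 1] 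
  by (intro ring_morphI) (simp_all add: fps_collapse_add fps_collapse_mult)

lemma ring_morph_of_rat: "ring_morph (of_rat :: rat \<Rightarrow> 'a::field_char_0)"
  by (intro ring_morphI) (simp_all add: of_rat_add of_rat_mult)

lemma ring_morph_fps_const: "ring_morph fps_const"
  by (intro ring_morphI) simp_all

definition ratpoly_eval :: "'a::field_char_0 fps \<Rightarrow> rat poly \<Rightarrow> 'a fps" where
  "ratpoly_eval a p = poly (map_poly (\<lambda>c. fps_const (of_rat c)) p) a"

lemma ring_morph_const_of_rat: "ring_morph (\<lambda>c. fps_const (of_rat c :: 'a::field_char_0))"
  by (rule ring_morph_comp[OF ring_morph_of_rat ring_morph_fps_const])

lemma ring_morph_ratpoly_eval: "ring_morph (ratpoly_eval a)"
  using ring_morph_poly[OF ring_morph_const_of_rat] by (simp add: ratpoly_eval_def[abs_def])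

lemma ratpoly_eval_pCons: "ratpoly_eval a (pCons c p) = fps_const (of_rat c) + a * ratpoly_eval a p"
  by (simp add: ratpoly_eval_def map_poly_pCons)

lemma ratpoly_eval_0: "ratpoly_eval a 0 = 0"
  by (simp add: ratpoly_eval_def)

text \<open>A series in \<open>t\<close> over \<open>\<rat>[x]\<close> is evaluated at \<open>x = a\<close>, where \<open>a\<close> is again a series in \<open>t\<close>.\<close>

definition fps_psub :: "'a::field_char_0 fps \<Rightarrow> rat poly fps \<Rightarrow> 'a fps" where
  "fps_psub a f = fps_collapse (fps_map (ratpoly_eval a) f)"

lemma ring_morph_fps_psub: "ring_morph (fps_psub a)"
  using ring_morph_comp[OF ring_morph_fps_map[OF ring_morph_ratpoly_eval] ring_morph_collapse]
  by (simp add: fps_psub_def[abs_def])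

lemmas fps_psub_simps = ring_morph_simps[OF ring_morph_fps_psub]

lemma fps_map_const: "h 0 = 0 \<Longrightarrow> fps_map h (fps_const c) = fps_const (h c)"
  by (rule fps_ext) simp

lemma fps_psub_const: "fps_psub a (fps_const p) = ratpoly_eval a p"
  by (simp add: fps_psub_def fps_map_const ratpoly_eval_0)

lemma fps_psub_X: "fps_psub a fps_X = fps_X"
proof -
  have "fps_map (ratpoly_eval a) fps_X = fps_X"
    by (rule fps_ext) (simp add: fps_X_def ring_morph_simps[OF ring_morph_ratpoly_eval])
  then show ?thesis
    by (simp add: fps_psub_def)
qed

lemma fps_psub_var: "fps_psub a (fps_const [:0, 1:]) = a"
  by (simp add: fps_psub_const ratpoly_eval_pCons ratpoly_eval_0)

lemma fps_collapse_consts: "fps_collapse (Abs_fps (\<lambda>n. fps_const (g n))) = Abs_fps g"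
proof (rule fps_ext)
  fix n
  have "(\<Sum>m\<le>n. fps_nth (fps_const (g m)) (n - m)) = (\<Sum>m\<in>{n}. fps_nth (fps_const (g m)) (n - m))"
    by (intro sum.mono_neutral_right) auto
  then show "fps_nth (fps_collapse (Abs_fps (\<lambda>n. fps_const (g n)))) n = fps_nth (Abs_fps g) n"
    by (simp add: fps_collapse_nth)
qed

lemma fps_psub_lift: "fps_psub a (fps_map (\<lambda>c. [:c:]) f) = fps_map of_rat f"
proof -
  have "fps_map (ratpoly_eval a) (fps_map (\<lambda>c. [:c:]) f) = Abs_fps (\<lambda>n. fps_const (of_rat (fps_nth f n)))"
    by (rule fps_ext) (simp add: ratpoly_eval_pCons ratpoly_eval_0)
  then show ?thesis
    by (simp add: fps_psub_def fps_collapse_consts fps_map_def)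
qed

lemma fps_psub_nth_0: "fps_nth (fps_psub a f) 0 = fps_nth (ratpoly_eval a (fps_nth f 0)) 0"
  by (simp add: fps_psub_def fps_collapse_nth)

lemma gessel_poly_morph:
  assumes "ring_morph h"
  shows "h (gessel_poly a b n) = gessel_poly (h a) (h b) n"
  by (simp add: gessel_poly_def ring_morph_simps[OF assms] ring_morph_sum[OF assms])

lemma gessel_series_const: "gessel_series (fps_const p) (fps_const r) = Abs_fps (gessel_poly p r)"
  unfolding gessel_series_collapse gessel_poly_def[symmetric]
  using gessel_poly_morph[OF ring_morph_fps_const, of p r] fps_collapse_consts[of "gessel_poly p r"]
  by simp

lemma fps_psub_gessel_series:
  "fps_psub a (gessel_series (fps_const p) (fps_const r)) = gessel_series (ratpoly_eval a p) (ratpoly_eval a r)"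
proof -
  have "fps_map (ratpoly_eval a) (Abs_fps (gessel_poly p r)) =
        Abs_fps (gessel_poly (ratpoly_eval a p) (ratpoly_eval a r))"
    by (rule fps_ext) (simp add: gessel_poly_morph[OF ring_morph_ratpoly_eval])
  then show ?thesis
    by (simp add: fps_psub_def gessel_series_const gessel_series_collapse[of "ratpoly_eval a p"]
        gessel_poly_def[abs_def])
qed

lemma of_rat_fract: "(of_rat c :: rat poly fract) = to_fract [:c:]"
proof -
  have "ring_morph (\<lambda>c :: rat. to_fract [:c:])"
    by (intro ring_morphI) (simp_all flip: to_fract_add to_fract_mult add: one_pCons[symmetric])
  from ring_morph_of_int[OF this] have of_int: "(of_int n :: rat poly fract) = to_fract [:of_int n:]" for n
    by simp
  obtain a b where c: "quotient_of c = (a, b)"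
    by force
  have b: "b > 0"
    using c quotient_of_denom_pos by blast
  have cab: "c = of_int a / of_int b"
    using c quotient_of_div by blast
  have "to_fract [:c:] * of_int b = to_fract [:of_int a:]"
    using b by (simp add: of_int cab flip: to_fract_mult)
  then show ?thesis
    using b by (simp add: cab of_rat_divide of_int field_simps)
qed

lemma lift_fps_eq: "lift_fps f = fps_map of_rat f"
  by (simp add: lift_fps_def fps_map_def of_rat_fract)

text \<open>The copy of \<rat>[x][[t]] in \<rat>(x)[[t]]. Having polynomial coefficients is the
  property that separates the two sides of the equation along the root of the kernel.\<close>

definition fps_integral_coeffs :: "'a::idom fract fps set" where
  "fps_integral_coeffs = {f. \<forall>n. fps_nth f n \<in> range to_fract}"

lemma range_to_fract_closed:
  "u \<in> range to_fract \<Longrightarrow> v \<in> range to_fract \<Longrightarrow> u + v \<in> range to_fract"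
  "u \<in> range to_fract \<Longrightarrow> v \<in> range to_fract \<Longrightarrow> u * v \<in> range to_fract"
  "0 \<in> range to_fract" "1 \<in> range to_fract"
proof -
  show "0 \<in> range to_fract" "1 \<in> range to_fract"
    by (metis rangeI to_fract_0 to_fract_1)+
qed (auto simp flip: to_fract_add to_fract_mult)

lemma range_to_fract_sum:
  "(\<And>i. i \<in> A \<Longrightarrow> f i \<in> range to_fract) \<Longrightarrow> sum f A \<in> range to_fract"
  by (induction A rule: infinite_finite_induct) (auto intro: range_to_fract_closed)

lemma fps_integral_coeffs_closed:
  assumes "f \<in> fps_integral_coeffs" "g \<in> fps_integral_coeffs"
  shows "f + g \<in> fps_integral_coeffs" "f * g \<in> fps_integral_coeffs"
  using assms by (auto simp: fps_integral_coeffs_def fps_mult_nth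
      intro!: range_to_fract_closed(1,2) range_to_fract_sum)

lemma fps_psub_integral_coeffs:
  assumes "a \<in> fps_integral_coeffs"
  shows "fps_psub a f \<in> (fps_integral_coeffs :: rat poly fract fps set)"
proof -
  have c: "fps_const (of_rat c) \<in> (fps_integral_coeffs :: rat poly fract fps set)" for c
    by (auto simp: fps_integral_coeffs_def of_rat_fract intro: range_to_fract_closed)
  have "ratpoly_eval a p \<in> fps_integral_coeffs" for p
  proof (induction p)
    case 0
    then show ?case
      using c[of 0] by (simp add: ratpoly_eval_0)
  qed (auto simp: ratpoly_eval_pCons intro!: fps_integral_coeffs_closed c assms)
  then show ?thesis
    by (auto simp: fps_integral_coeffs_def fps_psub_def fps_collapse_nth intro!: range_to_fract_sum)
qed

lemma ratpoly_eval_scaled_nth: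
  "fps_nth (ratpoly_eval (fps_const x * fps_X) p) k = of_rat (coeff p k) * x ^ k"
proof (induction p arbitrary: k)
  case (pCons c p)
  then show ?case
    by (cases k) (simp_all add: ratpoly_eval_pCons mult.assoc)
qed (simp add: ratpoly_eval_0)

lemma univ_var_eval: "poly (map_poly of_rat p) univ_var = to_fract p"
proof (induction p)
  case (pCons c p)
  have "pCons c p = [:c:] + [:0, 1:] * p"
    by simp
  then have "to_fract (pCons c p) = to_fract [:c:] + univ_var * to_fract p"
    by (metis to_fract_add to_fract_mult univ_var_def)
  with pCons show ?case
    by (simp add: map_poly_pCons of_rat_fract)
qed simp

text \<open>The monomial x^k t^m goes to x^k t^(m + k), so different monomials stay
  different.\<close>

lemma fps_psub_scaled_inj:
  assumes "fps_psub (fps_const univ_var * fps_X) f = fps_psub (fps_const univ_var * fps_X) g"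
  shows "f = g"
proof -
  define d where "d = f - g"
  have d: "fps_psub (fps_const univ_var * fps_X) d = 0"
    using assms by (simp add: d_def fps_psub_simps)
  have "coeff (fps_nth d m) k = 0" for m k
  proof -
    \<comment> \<open>\<open>P\<close> is the coefficient of t^(m + k) after the substitution; its
      term in x^k stems from t^m alone.\<close>
    define P where "P = (\<Sum>i\<le>m + k. monom (coeff (fps_nth d i) (m + k - i)) (m + k - i))"
    have "0 = (\<Sum>i\<le>m + k. of_rat (coeff (fps_nth d i) (m + k - i)) * univ_var ^ (m + k - i))"
      using arg_cong[OF d, of "\<lambda>f. fps_nth f (m + k)"]
      by (simp add: fps_psub_def fps_collapse_nth ratpoly_eval_scaled_nth)
    also have "\<dots> = (\<Sum>i\<le>m + k. to_fract (monom (coeff (fps_nth d i) (m + k - i)) (m + k - i)))"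
      by (simp flip: univ_var_eval add: map_poly_monom poly_monom)
    also have "\<dots> = to_fract P"
      by (simp add: P_def to_fract_sum)
    finally have "coeff P k = 0"
      by simp
    then have "0 = (\<Sum>i\<le>m + k. if m + k - i = k then coeff (fps_nth d i) (m + k - i) else 0)"
      by (simp add: P_def coeff_sum)
    also have "\<dots> = (\<Sum>i\<in>{m}. if m + k - i = k then coeff (fps_nth d i) (m + k - i) else 0)"
      by (intro sum.mono_neutral_right) auto
    finally show ?thesis
      by simp
  qed
  then have "d = 0"
    by (intro fps_ext poly_eqI) simp
  then show ?thesis
    by (simp add: d_def)
qed

section \<open>The kernel and the closed forms\<close>

definition gessel_D :: "'a::comm_ring_1 \<Rightarrow> 'a \<Rightarrow> 'a" where
  "gessel_D T U = U^2 - 9 * T + 8 * T * U + T^2 - T * U^2"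

definition gessel_K :: "'a::comm_ring_1 \<Rightarrow> 'a \<Rightarrow> 'a \<Rightarrow> 'a" where
  "gessel_K T U V = (T - 1)^2 * U^2 * V^2 - 4 * (T - 1) * U^2 * V - (T + 3) * (T - 1) * U^2
     - 8 * T * (T - 1) * U * V^2 + 8 * T * (T + 3) * U * V + T * (9 - T) * (T - 1) * V^2
     - 4 * T * (5 * T + 3) * V + T * (T + 3) * (T - 1)"

definition gessel_C :: "'a::comm_ring_1 \<Rightarrow> 'a \<Rightarrow> 'a \<Rightarrow> 'a" where
  "gessel_C T U V = - (V^4 * U^4 * T^4) + 2 * V^4 * U^4 * T^2 - V^4 * U^4 + 12 * V^4 * U^3 * T^4 + 4 * V^4 *
       U^3 * T^3 - 12 * V^4 * U^3 * T^2 - 4 * V^4 * U^3 * T + V^4 * U^2 * T^5 - 44 * V^4 * U^2 * T^4 -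
       2 * V^4 * U^2 * T^3 + 36 * V^4 * U^2 * T^2 + 9 * V^4 * U^2 * T - 4 * V^4 * U * T^5 + 68 * V^4 *
       U * T^4 - 28 * V^4 * U * T^3 - 36 * V^4 * U * T^2 + 4 * V^4 * T^5 - 40 * V^4 * T^4 + 36 * V^4 *
       T^3 + 2 * V^3 * U^4 * T^4 + 4 * V^3 * U^4 * T^3 - 4 * V^3 * U^4 * T - 2 * V^3 * U^4 - 16 * V^3
       * U^3 * T^4 - 48 * V^3 * U^3 * T^3 - 48 * V^3 * U^3 * T^2 - 16 * V^3 * U^3 * T - 2 * V^3 * U^2
       * T^5 + 28 * V^3 * U^2 * T^4 + 152 * V^3 * U^2 * T^3 + 164 * V^3 * U^2 * T^2 + 42 * V^3 * U^2 *
       T + 8 * V^3 * U * T^5 + 8 * V^3 * U * T^4 - 232 * V^3 * U * T^3 - 168 * V^3 * U * T^2 - 8 * V^3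
       * T^5 - 32 * V^3 * T^4 + 168 * V^3 * T^3 - V^2 * U^4 * T^4 + 2 * V^2 * U^4 * T^2 - V^2 * U^4 +
       4 * V^2 * U^3 * T^4 + 12 * V^2 * U^3 * T^3 - 4 * V^2 * U^3 * T^2 - 12 * V^2 * U^3 * T + 2 * V^2
       * U^2 * T^5 + 24 * V^2 * U^2 * T^4 + 44 * V^2 * U^2 * T^3 + 120 * V^2 * U^2 * T^2 + 66 * V^2 *
       U^2 * T - 12 * V^2 * U * T^5 - 84 * V^2 * U * T^4 - 212 * V^2 * U * T^3 - 204 * V^2 * U * T^2 -
       V^2 * T^6 + 16 * V^2 * T^5 + 58 * V^2 * T^4 + 192 * V^2 * T^3 - 9 * V^2 * T^2 - 2 * V * U^2 *
       T^5 - 20 * V * U^2 * T^4 - 40 * V * U^2 * T^3 + 20 * V * U^2 * T^2 + 42 * V * U^2 * T + 8 * V *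
       U * T^5 + 40 * V * U * T^4 + 24 * V * U * T^3 - 72 * V * U * T^2 + 2 * V * T^6 - 4 * V * T^5 -
       16 * V * T^4 + 36 * V * T^3 - 18 * V * T^2 + U^2 * T^5 + 4 * U^2 * T^4 - 2 * U^2 * T^3 - 12 *
       U^2 * T^2 + 9 * U^2 * T - T^6 - 4 * T^5 + 2 * T^4 + 12 * T^3 - 9 * T^2"

text \<open>With \<open>x\<close> and \<open>y\<close> expressed through \<open>U\<close> and \<open>V\<close>, the kernel
  splits into three factors that are biquadratic in \<open>U\<close> and \<open>V\<close>; \<^term>\<open>gessel_K\<close> is the one
  that vanishes on the branch in question, and \<^term>\<open>gessel_C\<close> is the product of the other two.\<close>

lemma kernel_factorization:
  fixes T U V :: "'a::idom"
  defines "xn \<equiv> 16 * T^2 * (U^2 - T)" and "xd \<equiv> (U + U * T - 2 * T) * gessel_D T U"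
    and "yn \<equiv> 1 - T + 3 * V + V * T" and "yd \<equiv> V^2 * (3 + V + T - V * T)"
  shows "256 * T^3 * (xn * yn * xd * yd - xd^2 * (yd^2 + yn * yd))
      - (T - 1) * (T + 3)^3 * xn^2 * yn * (yd + yn)
    = 256 * T^3 * gessel_K T U V * gessel_C T U V"
  unfolding xn_def xd_def yn_def yd_def gessel_K_def gessel_D_def gessel_C_def by algebra

text \<open>The left side is x y - (S - S0) - (1 + y) R, multiplied by the common denominator, with
  all quantities expressed through Z, U, V. The factors 1 + V and 1 + Z + V - V Z occur once and not
  squared, because 1 + y supplies one of each. The bracket on the right is the cofactor of
  \<open>gessel_K\<close>.\<close>

lemma kernel_identity:
  fixes T Z U V :: "'a::idom"
  assumes "Z^2 = T"
  defines "xn \<equiv> 16 * T^2 * (U^2 - T)" and "xe \<equiv> U + U * T - 2 * T"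
    and "yn \<equiv> 1 - T + 3 * V + V * T" and "yd \<equiv> V^2 * (3 + V + T - V * T)"
  shows "xn * yn * ((1 - T) * (T + 3)^3 * (U + Z) * (1 + Z) * (1 + V) * (1 + Z + V - V * Z))
      - (16 * T * xe * gessel_M T U Z * (1 + Z)
          - 32 * Z^3 * (3 + 3 * Z - 3 * Z^2 + Z^3) * (1 - T) * (U + Z) * gessel_D T U)
        * xe * yd * (1 + V) * (1 + Z + V - V * Z)
      - ((1 + Z) * V + 1 - Z) * - (16 * V * Z^3 * (3 + V + T - V * T) * gessel_N T V Z)
        * xe * (U + Z) * gessel_D T U * (1 + Z)
    = 16 * (1 + Z) * T * gessel_K T U V *
       (V^4 * U^2 * Z^8 - V^4 * U^2 * Z^7 + 3 * V^4 * U^2 * Z^6 - 3 * V^4 * U^2 * Z^5 - V^4 * U^2 * Z^4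
       + V^4 * U^2 * Z^3 - 3 * V^4 * U^2 * Z^2 + 3 * V^4 * U^2 * Z + V^4 * U * Z^9 - 3 * V^4 * U * Z^8
       + 5 * V^4 * U * Z^7 - 7 * V^4 * U * Z^6 + 3 * V^4 * U * Z^5 + 7 * V^4 * U * Z^4 - 9 * V^4 * U *
       Z^3 + 3 * V^4 * U * Z^2 - 2 * V^4 * Z^9 + 2 * V^4 * Z^8 - 4 * V^4 * Z^7 + 4 * V^4 * Z^6 + 6 *
       V^4 * Z^5 - 6 * V^4 * Z^4 - V^3 * U^3 * Z^7 + V^3 * U^3 * Z^6 - V^3 * U^3 * Z^5 + V^3 * U^3 *
       Z^4 + V^3 * U^3 * Z^3 - V^3 * U^3 * Z^2 + V^3 * U^3 * Z - V^3 * U^3 + 10 * V^3 * U^2 * Z^7 - 6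
       * V^3 * U^2 * Z^6 + 4 * V^3 * U^2 * Z^5 - 16 * V^3 * U^2 * Z^4 + 6 * V^3 * U^2 * Z^3 - 10 * V^3
       * U^2 * Z^2 + 12 * V^3 * U^2 * Z + V^3 * U * Z^9 - V^3 * U * Z^8 - 35 * V^3 * U * Z^7 + 3 * V^3
       * U * Z^6 - 9 * V^3 * U * Z^5 + 41 * V^3 * U * Z^4 - 21 * V^3 * U * Z^3 + 21 * V^3 * U * Z^2 -
       2 * V^3 * Z^9 + 2 * V^3 * Z^8 + 40 * V^3 * Z^7 + 8 * V^3 * Z^6 - 6 * V^3 * Z^5 - 42 * V^3 * Z^4
       + V^2 * U^3 * Z^7 + V^2 * U^3 * Z^6 + V^2 * U^3 * Z^5 + V^2 * U^3 * Z^4 - V^2 * U^3 * Z^3 - V^2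
       * U^3 * Z^2 - V^2 * U^3 * Z - V^2 * U^3 - 6 * V^2 * U^2 * Z^7 - 10 * V^2 * U^2 * Z^6 - 28 * V^2
       * U^2 * Z^5 - 16 * V^2 * U^2 * Z^4 - 10 * V^2 * U^2 * Z^3 - 6 * V^2 * U^2 * Z^2 + 12 * V^2 *
       U^2 * Z - V^2 * U * Z^9 - 5 * V^2 * U * Z^8 - V^2 * U * Z^7 + 19 * V^2 * U * Z^6 + 97 * V^2 * U
       * Z^5 + 69 * V^2 * U * Z^4 + 33 * V^2 * U * Z^3 + 45 * V^2 * U * Z^2 + 2 * V^2 * Z^9 + 10 * V^2
       * Z^8 + 16 * V^2 * Z^7 - 16 * V^2 * Z^6 - 114 * V^2 * Z^5 - 90 * V^2 * Z^4 - V * U^2 * Z^8 - V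
       * U^2 * Z^7 - 3 * V * U^2 * Z^6 - 3 * V * U^2 * Z^5 + V * U^2 * Z^4 + V * U^2 * Z^3 + 3 * V *
       U^2 * Z^2 + 3 * V * U^2 * Z + 8 * V * U * Z^8 + 20 * V * U * Z^7 + 36 * V * U * Z^6 + 72 * V *
       U * Z^5 + 48 * V * U * Z^4 + 36 * V * U * Z^3 + 36 * V * U * Z^2 + V * Z^10 + V * Z^9 - 9 * V *
       Z^8 - 33 * V * Z^7 - 57 * V * Z^6 - 105 * V * Z^5 - 63 * V * Z^4 + 9 * V * Z^3 - U * Z^9 - U *
       Z^8 - 5 * U * Z^7 - 5 * U * Z^6 - 3 * U * Z^5 - 3 * U * Z^4 + 9 * U * Z^3 + 9 * U * Z^2 - Z^10
       - Z^9 - 5 * Z^8 - 5 * Z^7 - 3 * Z^6 - 3 * Z^5 + 9 * Z^4 + 9 * Z^3)"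
  unfolding xn_def xe_def yn_def yd_def gessel_K_def gessel_D_def gessel_M_def gessel_N_def assms(1)[symmetric]
  by algebra

text \<open>The hypothesis on x y is the kernel at (xt, y), divided by t. Once t^2, x and y are
  replaced by their expressions in T, U, V and the denominators are cleared, it says that
  \<open>gessel_K\<close> times \<open>gessel_C\<close> is 0.\<close>

lemma gessel_K_eq_0:
  fixes T U V x y t :: "'a::idom"
  assumes T: "256 * T^3 * t^2 = (T - 1) * (T + 3)^3" "256 * T \<noteq> 0"
    and U: "16 * T^2 * (U^2 - T) = x * ((U + U * T - 2 * T) * gessel_D T U)"
    and V: "1 - T + 3 * V + V * T = y * (V^2 * (3 + V + T - V * T))"
    and kernel: "x * y = 1 + y + t^2 * x^2 * y * (1 + y)"
    and C: "gessel_C T U V \<noteq> 0"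
  shows "gessel_K T U V = 0"
proof -
  define xd where "xd = (U + U * T - 2 * T) * gessel_D T U"
  define yd where "yd = V^2 * (3 + V + T - V * T)"
  have "256 * T^3 * gessel_K T U V * gessel_C T U V =
    256 * T^3 * (x * xd * (y * yd) * xd * yd - xd^2 * (yd^2 + y * yd * yd))
      - (T - 1) * (T + 3)^3 * (x * xd)^2 * (y * yd) * (yd + y * yd)"
    by (simp only: kernel_factorization[symmetric] U V flip: xd_def yd_def)
  also have "\<dots> = 256 * T^3 * (x * y - (1 + y + t^2 * x^2 * y * (1 + y))) * xd^2 * yd^2"
    unfolding T(1)[symmetric] by algebra
  also have "\<dots> = 0"
    by (simp only: kernel diff_self mult_zero_right mult_zero_left)
  finally show ?thesis
    using T(2) C by simp
qed

lemma kernel_solution: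
  fixes T Z U V x y t S R S0 :: "'a::idom"
  assumes T: "256 * T^3 * t^2 = (T - 1) * (T + 3)^3" "Z^2 = T"
    and U: "16 * T^2 * (U^2 - T) = x * ((U + U * T - 2 * T) * gessel_D T U)"
    and V: "1 - T + 3 * V + V * T = y * (V^2 * (3 + V + T - V * T))"
    and kernel: "x * y = 1 + y + t^2 * x^2 * y * (1 + y)"
    and S: "S * ((1 - T) * (T + 3)^3 * (U + Z) * gessel_D T U) = 16 * T * (U + U * T - 2 * T) * gessel_M T U Z"
    and R: "R * ((T - 1) * (T + 3)^3 * (1 + V)^2 * (1 + Z + V - V * Z)^2)
              = 16 * V * Z^3 * (3 + V + T - V * T) * gessel_N T V Z"
    and S0: "S0 * ((1 + Z) * (Z^2 + 3)^3) = 32 * Z^3 * (3 + 3 * Z - 3 * Z^2 + Z^3)"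
    and nz: "256 * T \<noteq> 0" "gessel_C T U V \<noteq> 0" "U + U * T - 2 * T \<noteq> 0" "gessel_D T U \<noteq> 0"
      "V \<noteq> 0" "3 + V + T - V * T \<noteq> 0" "1 - T \<noteq> 0" "T + 3 \<noteq> 0" "U + Z \<noteq> 0" "1 + Z \<noteq> 0" "1 + V \<noteq> 0"
      "1 + Z + V - V * Z \<noteq> 0"
  shows "x * y = S + (1 + y) * R - S0"
proof -
  define xe D W c M N where defs: "xe = U + U * T - 2 * T" "D = gessel_D T U" "W = 3 + V + T - V * T"
    "c = (1 - T) * (T + 3)^3" "M = gessel_M T U Z" "N = gessel_N T V Z"
  define l where "l = 1 + Z + V - V * Z"
  have K: "gessel_K T U V = 0"
    using gessel_K_eq_0[OF T(1) nz(1) U V kernel nz(2)] .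
  \<comment> \<open>The numerator of 1 + y splits into three factors, two of which cancel against
    the squares in the denominator of R.\<close>
  have y1: "(1 + y) * (V^2 * W) = (1 + V) * ((1 + Z) * V + 1 - Z) * l"
  proof -
    have "(1 + y) * (V^2 * W) = V^2 * W + (1 - T + 3 * V + V * T)"
      unfolding V defs by (simp add: algebra_simps)
    also have "\<dots> = (1 + V) * ((1 + Z) * V + 1 - Z) * l"
      unfolding defs l_def T(2)[symmetric] by algebra
    finally show ?thesis .
  qed
  \<comment> \<open>\<open>c\<close> contains 1 - T where the denominator of R has T - 1; hence the
    sign.\<close>
  have R': "R * (c * (1 + V)^2 * l^2) = - (16 * V * Z^3 * W * N)"
  proof -
    have "R * (c * (1 + V)^2 * l^2) = - (R * ((T - 1) * (T + 3)^3 * (1 + V)^2 * (1 + Z + V - V * Z)^2))"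
      unfolding defs l_def by algebra
    then show ?thesis
      unfolding R defs .
  qed
  \<comment> \<open>The difference of the two sides times the common denominator of its terms,
    regrouped so that each of the given equations can be inserted; the result is the left side of
    \<open>kernel_identity\<close>.\<close>
  have "xe * (D * V^2 * W * c * (U + Z) * (1 + Z) * (1 + V) * l) * (x * y - (S + (1 + y) * R - S0)) =
      (x * (xe * D)) * (y * (V^2 * W)) * (c * (U + Z) * (1 + Z) * (1 + V) * l)
      - ((S * (c * (U + Z) * D)) * (1 + Z) - (S0 * ((1 + Z) * (T + 3)^3)) * (1 - T) * (U + Z) * D)
        * xe * (V^2 * W) * (1 + V) * l
      - ((1 + y) * (V^2 * W)) * R * (c * (1 + V) * l) * xe * (U + Z) * D * (1 + Z)"
    unfolding defs(4) by algebra
  also have "\<dots> = (16 * T^2 * (U^2 - T)) * (1 - T + 3 * V + V * T) * (c * (U + Z) * (1 + Z) * (1 + V) * l)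
      - ((16 * T * xe * M) * (1 + Z) - (32 * Z^3 * (3 + 3 * Z - 3 * Z^2 + Z^3)) * (1 - T) * (U + Z) * D)
        * xe * (V^2 * W) * (1 + V) * l
      - (((1 + V) * ((1 + Z) * V + 1 - Z) * l) * R * (c * (1 + V) * l)) * xe * (U + Z) * D * (1 + Z)"
    unfolding y1 U[folded defs, symmetric] V[folded defs, symmetric] S[folded defs] S0[unfolded T(2)]
    by (simp only: T(2))
  also have "((1 + V) * ((1 + Z) * V + 1 - Z) * l) * R * (c * (1 + V) * l) =
      ((1 + Z) * V + 1 - Z) * (R * (c * (1 + V)^2 * l^2))"
    by algebra
  also have "(16 * T^2 * (U^2 - T)) * (1 - T + 3 * V + V * T) * (c * (U + Z) * (1 + Z) * (1 + V) * l)
      - ((16 * T * xe * M) * (1 + Z) - (32 * Z^3 * (3 + 3 * Z - 3 * Z^2 + Z^3)) * (1 - T) * (U + Z) * D)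
        * xe * (V^2 * W) * (1 + V) * l
      - (((1 + Z) * V + 1 - Z) * (R * (c * (1 + V)^2 * l^2))) * xe * (U + Z) * D * (1 + Z) = 0"
    unfolding R' using kernel_identity[OF T(2), of U V] unfolding K defs l_def
    by (simp only: mult_zero_right mult_zero_left)
  finally show ?thesis
    using nz unfolding defs l_def by simp
qed

section \<open>The series T, Z, U, V and the closed forms as power series\<close>

lemma ex1_gessel_T:
  "\<exists>!T :: rat fps. fps_nth T 0 = 1 \<and> (T - 1) * (T + 3) ^ 3 = 256 * fps_X ^ 2 * T ^ 3"
proof -
  \<comment> \<open>The coefficients of (T - 1) (T + 3)^3 - 256 t^2 T^3, whose derivative at T = 1,
    t = 0 is 4 + 24 + 36 = 64.\<close>
  have "\<exists>!T :: rat fps. fps_nth T 0 = fps_nth 1 0 \<and> poly [:- 27, 0, 18, 8 - 256 * fps_X ^ 2, 1:] T = 0"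
    by (rule fps_hensel[where e = "1 / 64"]) (simp_all add: pderiv_pCons fps_X_power_mult_nth)
  moreover have "poly [:- 27, 0, 18, 8 - 256 * fps_X ^ 2, 1:] T = 0 \<longleftrightarrow>
      (T - 1) * (T + 3) ^ 3 = 256 * fps_X ^ 2 * T ^ 3" for T :: "rat fps"
  proof -
    have "poly [:- 27, 0, 18, 8 - 256 * fps_X ^ 2, 1:] T = (T - 1) * (T + 3) ^ 3 - 256 * fps_X ^ 2 * T ^ 3"
      by (simp add: algebra_simps power2_eq_square power3_eq_cube)
    then show ?thesis
      by simp
  qed
  ultimately show ?thesis
    by simp
qed

definition gessel_T :: "rat fps" where
  "gessel_T = (THE T. fps_nth T 0 = 1 \<and> (T - 1) * (T + 3) ^ 3 = 256 * fps_X ^ 2 * T ^ 3)"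

lemma gessel_T: "fps_nth gessel_T 0 = 1" "(gessel_T - 1) * (gessel_T + 3) ^ 3 = 256 * fps_X ^ 2 * gessel_T ^ 3"
  using theI'[OF ex1_gessel_T] unfolding gessel_T_def by blast+

lemma gessel_T_unique:
  "fps_nth S 0 = 1 \<Longrightarrow> (S - 1) * (S + 3) ^ 3 = 256 * fps_X ^ 2 * S ^ 3 \<Longrightarrow> S = gessel_T"
  using ex1_gessel_T gessel_T by blast

lemma ex1_gessel_Z: "\<exists>!Z. fps_nth Z 0 = 1 \<and> Z ^ 2 = gessel_T"
proof -
  have "\<exists>!Z. fps_nth Z 0 = fps_nth 1 0 \<and> poly [:- gessel_T, 0, 1:] Z = 0"
    by (rule fps_hensel[where e = "1 / 2"]) (simp_all add: pderiv_pCons gessel_T)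
  then show ?thesis
    by (simp add: power2_eq_square)
qed

definition gessel_Z :: "rat fps" where
  "gessel_Z = (THE Z. fps_nth Z 0 = 1 \<and> Z ^ 2 = gessel_T)"

lemma gessel_Z: "fps_nth gessel_Z 0 = 1" "gessel_Z ^ 2 = gessel_T"
  using theI'[OF ex1_gessel_Z] unfolding gessel_Z_def by blast+

lemma gessel_Z_unique: "fps_nth S 0 = 1 \<Longrightarrow> S ^ 2 = gessel_T \<Longrightarrow> S = gessel_Z"
  using ex1_gessel_Z gessel_Z by blast

text \<open>This is (T - 1) / t^2, in a form that shows it to be a unit. Denominators with the
  factor T - 1 become t^2 times a unit.\<close>

definition gessel_tau :: "rat fps" where
  "gessel_tau = 256 * gessel_T ^ 3 / (gessel_T + 3) ^ 3"

lemma gessel_tau: "gessel_T = 1 + fps_X ^ 2 * gessel_tau" "fps_nth gessel_tau 0 = 4"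
proof -
  have nz: "fps_nth ((gessel_T + 3) ^ 3) 0 \<noteq> 0"
    by (simp add: gessel_T fps_nth_power_0)
  then have "(gessel_T - 1) * (gessel_T + 3) ^ 3 = (fps_X ^ 2 * gessel_tau) * (gessel_T + 3) ^ 3"
    by (simp add: gessel_T gessel_tau_def fps_divide_unit mult.assoc inverse_mult_eq_1)
  moreover have "(gessel_T + 3) ^ 3 \<noteq> 0"
    using nz by fastforce
  ultimately have "gessel_T - 1 = fps_X ^ 2 * gessel_tau"
    by (metis mult_right_cancel)
  then show "gessel_T = 1 + fps_X ^ 2 * gessel_tau"
    by (simp add: algebra_simps)
  show "fps_nth gessel_tau 0 = 4"
    using nz by (simp add: gessel_tau_def fps_divide_unit gessel_T fps_nth_power_0)
qed

abbreviation fps_lift :: "rat fps \<Rightarrow> rat poly fps" where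
  "fps_lift \<equiv> fps_map (\<lambda>c. [:c:])"

lemma ring_morph_fps_lift: "ring_morph fps_lift"
  by (intro ring_morph_fps_map ring_morphI) (simp_all add: one_pCons)

lemmas fps_lift_simps = ring_morph_simps[OF ring_morph_fps_lift]

lemma fps_lift_X: "fps_lift fps_X = fps_X"
  by (rule fps_ext) (simp add: fps_X_def one_pCons)

lemma fps_lift_gessel_T:
  "fps_lift gessel_T = 1 + fps_X ^ 2 * fps_lift gessel_tau" "fps_nth (fps_lift gessel_tau) 0 = [:4:]"
  by (subst gessel_tau(1)) (simp_all add: fps_lift_simps fps_lift_X gessel_tau)

text \<open>The series \<open>V(y)\<close> of the theorem, and the series \<open>U(x/t) = 1 + t\<^sup>2 w\<close>, with the
  variable \<open>x\<close> or \<open>y\<close> of the coefficients.\<close>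

definition fps_var :: "rat poly fps" where
  "fps_var = fps_const [:0, 1:]"

lemma ex_gessel_V:
  "\<exists>v. let T = fps_lift gessel_T; V = fps_X ^ 2 * v in fps_nth v 0 = 1 \<and>
     1 - T + 3 * V + V * T = fps_var * (V ^ 2 * (3 + V + T - V * T))"
proof -
  define T where "T = fps_lift gessel_T"
  define tau where "tau = fps_lift gessel_tau"
  have T: "T = 1 + fps_X ^ 2 * tau" "fps_nth tau 0 = [:4:]"
    unfolding T_def tau_def by (rule fps_lift_gessel_T)+
  have "\<exists>!V. fps_nth V 0 = fps_nth 0 0 \<and>
      poly [:1 - T, 3 + T, - (fps_var * (3 + T)), - (fps_var * (1 - T)):] V = 0"
    by (rule fps_hensel[where e = "[:1 / 4:]"])
      (simp_all add: pderiv_pCons T numeral_poly one_pCons)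
  then obtain V where V0: "fps_nth V 0 = 0"
    and V: "poly [:1 - T, 3 + T, - (fps_var * (3 + T)), - (fps_var * (1 - T)):] V = 0"
    by auto
  have V1: "1 - T + 3 * V + V * T = fps_var * (V ^ 2 * (3 + V + T - V * T))"
    using V by (simp add: algebra_simps power2_eq_square)
  \<comment> \<open>The equation reads V u = T - 1 with a unit u, so V is t^2 times a unit. As u and
    tau both have constant term 4, the quotient v starts with 1.\<close>
  define u where "u = 3 + T - fps_var * V * (3 + V + T - V * T)"
  have u0: "fps_nth u 0 = [:4:]"
    by (simp add: u_def T V0 numeral_poly one_pCons)
  have "\<exists>g. u * g = 1"
    by (rule fps_unit_inverse[where e = "[:1 / 4:]"]) (simp add: u0 one_pCons)
  then obtain g where g: "u * g = 1"
    by blast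
  have "V * u = fps_X ^ 2 * tau"
    using V1 unfolding u_def by (simp add: T algebra_simps power2_eq_square)
  then have "V * (u * g) = fps_X ^ 2 * (tau * g)"
    by (simp add: mult.assoc[symmetric])
  then have "V = fps_X ^ 2 * (tau * g)"
    by (simp add: g)
  moreover have "fps_nth (tau * g) 0 = 1"
  proof -
    have "[:4:] * fps_nth g 0 = 1"
      using arg_cong[OF g, of "\<lambda>f. fps_nth f 0"] by (simp add: u0)
    then show ?thesis
      by (simp add: T numeral_poly)
  qed
  ultimately show ?thesis
    using V1 unfolding T_def by (intro exI[of _ "tau * g"]) (simp add: Let_def)
qed

definition gessel_v :: "rat poly fps" where
  "gessel_v = (SOME v. let T = fps_lift gessel_T; V = fps_X ^ 2 * v in fps_nth v 0 = 1 \<and>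
     1 - T + 3 * V + V * T = fps_var * (V ^ 2 * (3 + V + T - V * T)))"

definition gessel_V :: "rat poly fps" where
  "gessel_V = fps_X ^ 2 * gessel_v"

lemma gessel_V: "fps_nth gessel_v 0 = 1" "let T = fps_lift gessel_T in
     1 - T + 3 * gessel_V + gessel_V * T = fps_var * (gessel_V ^ 2 * (3 + gessel_V + T - gessel_V * T))"
  using someI_ex[OF ex_gessel_V] unfolding gessel_v_def[symmetric] gessel_V_def[symmetric] by (simp_all add: Let_def)

text \<open>At t = 0 both T and U are 1, where the factors of the equation for U vanish. These
  expansions extract the powers of t that have to be cancelled.\<close>

lemma gessel_D_expand:
  fixes X tau w :: "'a::idom"
  shows "gessel_D (1 + X ^ 2 * tau) (1 + X ^ 2 * w) =
    X ^ 2 * (8 * w + 6 * X ^ 2 * w * tau - X ^ 4 * w ^ 2 * tau + X ^ 2 * tau ^ 2)"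
  unfolding gessel_D_def by algebra

lemma gessel_E_expand:
  fixes X tau w :: "'a::idom"
  shows "(1 + X ^ 2 * w) + (1 + X ^ 2 * w) * (1 + X ^ 2 * tau) - 2 * (1 + X ^ 2 * tau)
    = X ^ 2 * ((2 * w - tau + X ^ 2 * w ^ 2) + X ^ 2 * w * (tau - w))"
  by algebra

lemma gessel_U_equation_expand:
  fixes X y tau w T U :: "'a::idom"
  assumes "T = 1 + X ^ 2 * tau" "U = 1 + X ^ 2 * w"
  shows "16 * T ^ 2 * (U ^ 2 - T) * X - y * ((U + U * T - 2 * T) * gessel_D T U) =
    X ^ 3 * (16 * T ^ 2 * (2 * w - tau + X ^ 2 * w ^ 2) - y * X * ((2 * w - tau + X ^ 2 * tau * w)
      * (8 * w + 6 * X ^ 2 * w * tau - X ^ 4 * w ^ 2 * tau + X ^ 2 * tau ^ 2)))"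
  unfolding assms gessel_D_def by algebra

lemma ex_gessel_U:
  "\<exists>w. let T = fps_lift gessel_T; U = 1 + fps_X ^ 2 * w in fps_nth w 0 = 2 \<and>
     16 * T ^ 2 * (U ^ 2 - T) * fps_X = fps_var * ((U + U * T - 2 * T) * gessel_D T U)"
proof -
  define T where "T = fps_lift gessel_T"
  define tau where "tau = fps_lift gessel_tau"
  have T: "T = 1 + fps_X ^ 2 * tau" "fps_nth tau 0 = [:4:]"
    unfolding T_def tau_def by (rule fps_lift_gessel_T)+
  define E where "E = [:- tau, 2 + fps_X ^ 2 * tau:]"
  define D where "D = [:fps_X ^ 2 * tau ^ 2, 8 + 6 * fps_X ^ 2 * tau, - (fps_X ^ 4 * tau):]"
  \<comment> \<open>With x / t for x, multiplied by t, the equation has the double root U = 1 at t =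
    0, and Hensel's lemma fails. In terms of w it is divisible by t^3; the quotient \<open>F\<close>
    starts with 16 (2 w - tau), which gives w(0) = 2 and the derivative 32.\<close>
  define F where "F = smult (16 * T ^ 2) [:- tau, 2, fps_X ^ 2:] - smult (fps_var * fps_X) (E * D)"
  have "\<exists>!w. fps_nth w 0 = fps_nth 2 0 \<and> poly F w = 0"
    by (rule fps_hensel[where e = "[:1 / 32:]"])
      (simp_all add: F_def pderiv_diff pderiv_smult pderiv_pCons T fps_nth_power_0 numeral_poly one_pCons poly_const_pow mult.assoc)
  then obtain w where w: "fps_nth w 0 = 2" "poly F w = 0"
    by auto
  define U where "U = 1 + fps_X ^ 2 * w"
  have "16 * T ^ 2 * (U ^ 2 - T) * fps_X - fps_var * ((U + U * T - 2 * T) * gessel_D T U) = fps_X ^ 3 * poly F w"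
    unfolding gessel_U_equation_expand[OF T(1) U_def] F_def E_def D_def
    by (simp add: algebra_simps power2_eq_square)
  then show ?thesis
    using w unfolding T_def U_def by (intro exI[of _ w]) (simp add: Let_def)
qed

definition gessel_w :: "rat poly fps" where
  "gessel_w = (SOME w. let T = fps_lift gessel_T; U = 1 + fps_X ^ 2 * w in fps_nth w 0 = 2 \<and>
     16 * T ^ 2 * (U ^ 2 - T) * fps_X = fps_var * ((U + U * T - 2 * T) * gessel_D T U))"

definition gessel_U :: "rat poly fps" where
  "gessel_U = 1 + fps_X ^ 2 * gessel_w"

lemma gessel_U: "fps_nth gessel_w 0 = 2" "let T = fps_lift gessel_T in
     16 * T ^ 2 * (gessel_U ^ 2 - T) * fps_X = fps_var * ((gessel_U + gessel_U * T - 2 * T) * gessel_D T gessel_U)"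
  using someI_ex[OF ex_gessel_U] unfolding gessel_w_def[symmetric] gessel_U_def[symmetric] by (simp_all add: Let_def)

text \<open>T - 1 in the denominator and V in the numerator contain t^2 once each. The rest of the
  denominator is a unit, with constant term 4 * 64 * 1 * 4 = 1024.\<close>

lemma ex_gessel_R:
  "\<exists>R. let T = fps_lift gessel_T; Z = fps_lift gessel_Z; V = gessel_V in
     R * ((T - 1) * (T + 3)^3 * (1 + V)^2 * (1 + Z + V - V * Z)^2)
       = 16 * V * Z^3 * (3 + V + T - V * T) * gessel_N T V Z"
proof -
  define T where "T = fps_lift gessel_T"
  define Z where "Z = fps_lift gessel_Z"
  define tau where "tau = fps_lift gessel_tau"
  have T: "T = 1 + fps_X ^ 2 * tau" "fps_nth tau 0 = [:4:]"
    unfolding T_def tau_def by (rule fps_lift_gessel_T)+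
  have Z0: "fps_nth Z 0 = 1"
    by (simp add: Z_def gessel_Z one_pCons)
  define u where "u = tau * (T + 3)^3 * (1 + gessel_V)^2 * (1 + Z + gessel_V - gessel_V * Z)^2"
  have u0: "fps_nth u 0 = [:1024:]"
    by (simp add: u_def T Z0 fps_nth_power_0 gessel_V_def numeral_poly poly_const_pow)
  have "\<exists>g. u * g = 1"
    by (rule fps_unit_inverse[where e = "[:1 / 1024:]"]) (simp add: u0 one_pCons)
  then obtain g where g: "u * g = 1"
    by blast
  define R where "R = 16 * gessel_v * Z^3 * (3 + gessel_V + T - gessel_V * T) * gessel_N T gessel_V Z * g"
  have "R * ((T - 1) * (T + 3)^3 * (1 + gessel_V)^2 * (1 + Z + gessel_V - gessel_V * Z)^2) =
      R * fps_X ^ 2 * u"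
    unfolding u_def by (simp add: T)
  also have "\<dots> = 16 * (fps_X ^ 2 * gessel_v) * Z^3 * (3 + gessel_V + T - gessel_V * T) * gessel_N T gessel_V Z * (u * g)"
    unfolding R_def by (simp add: mult_ac)
  finally show ?thesis
    unfolding g T_def[symmetric] Z_def[symmetric] Let_def gessel_V_def[symmetric] by auto
qed

text \<open>The denominator contains t^4, from 1 - T and \<open>gessel_D\<close>, whereas U + U T -
  2 T obviously contains only t^2. The missing t^2 comes from the equation for U, which says that e
  times a unit is divisible by t^2. What remains of the denominator has constant term 4 * 64 * 2 *
  16 = 8192.\<close>

lemma ex_gessel_S:
  "\<exists>S. let T = fps_lift gessel_T; Z = fps_lift gessel_Z; U = gessel_U in
     S * ((1 - T) * (T + 3)^3 * (U + Z) * gessel_D T U) = 16 * T * (U + U * T - 2 * T) * gessel_M T U Z"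
proof -
  define T where "T = fps_lift gessel_T"
  define Z where "Z = fps_lift gessel_Z"
  define tau where "tau = fps_lift gessel_tau"
  define w where "w = gessel_w"
  define U where "U = gessel_U"
  have T: "T = 1 + fps_X ^ 2 * tau" "fps_nth tau 0 = [:4:]"
    unfolding T_def tau_def by (rule fps_lift_gessel_T)+
  have Z0: "fps_nth Z 0 = 1"
    by (simp add: Z_def gessel_Z one_pCons)
  have U: "U = 1 + fps_X ^ 2 * w" "fps_nth w 0 = [:2:]"
    by (simp_all add: U_def w_def gessel_U_def gessel_U numeral_poly)
  define d where "d = 8 * w + 6 * fps_X ^ 2 * w * tau - fps_X ^ 4 * w ^ 2 * tau + fps_X ^ 2 * tau ^ 2"
  define e where "e = (2 * w - tau + fps_X ^ 2 * w ^ 2) + fps_X ^ 2 * w * (tau - w)"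
  have D: "gessel_D T U = fps_X ^ 2 * d"
    unfolding T U d_def by (rule gessel_D_expand)
  have E: "U + U * T - 2 * T = fps_X ^ 2 * e"
    unfolding T U e_def by (rule gessel_E_expand)
  have "16 * T ^ 2 * (U ^ 2 - T) * fps_X = fps_var * ((fps_X ^ 2 * e) * (fps_X ^ 2 * d))"
    using gessel_U(2) unfolding D[symmetric] E[symmetric] by (simp add: Let_def T_def U_def)
  moreover have "U ^ 2 - T = fps_X ^ 2 * (e - fps_X ^ 2 * w * (tau - w))"
    unfolding T U e_def by (simp add: algebra_simps power2_eq_square)
  ultimately have "16 * T ^ 2 * (fps_X ^ 2 * (e - fps_X ^ 2 * w * (tau - w))) * fps_X =
      fps_var * ((fps_X ^ 2 * e) * (fps_X ^ 2 * d))"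
    by (simp only:)
  then have "fps_X ^ 3 * (16 * T ^ 2 * (e - fps_X ^ 2 * w * (tau - w))) = fps_X ^ 3 * (fps_X * fps_var * e * d)"
    by (simp add: power2_eq_square power3_eq_cube mult_ac)
  then have eq: "16 * T ^ 2 * (e - fps_X ^ 2 * w * (tau - w)) = fps_X * fps_var * e * d"
    by simp
  define a where "a = 16 * T ^ 2 - fps_X * fps_var * d"
  have ae: "e * a = fps_X ^ 2 * (16 * T ^ 2 * w * (tau - w))"
    using eq unfolding a_def by (simp add: algebra_simps)
  have "\<exists>g. a * g = 1"
    by (rule fps_unit_inverse[where e = "[:1 / 16:]"])
      (simp add: a_def T fps_nth_power_0 numeral_poly one_pCons poly_const_pow mult.assoc)
  then obtain g where g: "a * g = 1"
    by blast
  define e2 where "e2 = 16 * T ^ 2 * w * (tau - w) * g"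
  have e2: "e = fps_X ^ 2 * e2"
  proof -
    have "e = (e * a) * g"
      by (simp add: mult.assoc g)
    also have "\<dots> = fps_X ^ 2 * e2"
      unfolding ae e2_def by (simp add: mult.assoc)
    finally show ?thesis .
  qed
  define u where "u = tau * (T + 3)^3 * (U + Z) * d"
  have u0: "fps_nth u 0 = [:8192:]"
    by (simp add: u_def T U Z0 d_def fps_nth_power_0 numeral_poly poly_const_pow mult.assoc)
  have "\<exists>h. u * h = 1"
    by (rule fps_unit_inverse[where e = "[:1 / 8192:]"]) (simp add: u0 one_pCons)
  then obtain h where h: "u * h = 1"
    by blast
  define S where "S = - (16 * T * e2 * gessel_M T U Z * h)"
  have "S * ((1 - T) * (T + 3)^3 * (U + Z) * gessel_D T U) = - S * fps_X ^ 4 * u"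
  proof -
    have "1 - T = - (fps_X ^ 2 * tau)"
      by (simp add: T)
    then show ?thesis
      unfolding u_def D by (simp add: power_numeral_reduce mult_ac)
  qed
  also have "\<dots> = 16 * T * (fps_X ^ 2 * (fps_X ^ 2 * e2)) * gessel_M T U Z * (u * h)"
    unfolding S_def by (simp add: power_numeral_reduce mult_ac)
  also have "\<dots> = 16 * T * (U + U * T - 2 * T) * gessel_M T U Z"
    unfolding h E e2[symmetric] by simp
  finally show ?thesis
    unfolding T_def Z_def U_def Let_def by blast
qed

text \<open>The closed forms of \<open>Q(0, y)\<close> and, with \<open>x / t\<close> for \<open>x\<close>, of \<open>Q(x, 0)\<close>.\<close>

definition gessel_R :: "rat poly fps" where
  "gessel_R = (SOME R. let T = fps_lift gessel_T; Z = fps_lift gessel_Z; V = gessel_V in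
     R * ((T - 1) * (T + 3)^3 * (1 + V)^2 * (1 + Z + V - V * Z)^2)
       = 16 * V * Z^3 * (3 + V + T - V * T) * gessel_N T V Z)"

definition gessel_S :: "rat poly fps" where
  "gessel_S = (SOME S. let T = fps_lift gessel_T; Z = fps_lift gessel_Z; U = gessel_U in
     S * ((1 - T) * (T + 3)^3 * (U + Z) * gessel_D T U) = 16 * T * (U + U * T - 2 * T) * gessel_M T U Z)"

lemmas gessel_R = someI_ex[OF ex_gessel_R, folded gessel_R_def]
lemmas gessel_S = someI_ex[OF ex_gessel_S, folded gessel_S_def]

section \<open>The equations and nonvanishing conditions at an arbitrary series\<close>

abbreviation fps_rat :: "rat fps \<Rightarrow> 'a::field_char_0 fps" where
  "fps_rat \<equiv> fps_map of_rat"

lemma ring_morph_fps_rat: "ring_morph fps_rat"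
  by (intro ring_morph_fps_map ring_morph_of_rat)

lemmas fps_rat_simps = ring_morph_simps[OF ring_morph_fps_rat]

lemma fps_rat_X: "fps_rat fps_X = fps_X"
  by (rule fps_ext) (simp add: fps_X_def)

lemma fps_rat_gessel_T:
  "fps_rat gessel_T = 1 + fps_X ^ 2 * fps_rat gessel_tau" "fps_nth (fps_rat gessel_tau) 0 = 4"
proof -
  show "fps_rat gessel_T = 1 + fps_X ^ 2 * fps_rat gessel_tau"
    by (subst gessel_tau(1)) (simp add: fps_rat_simps fps_rat_X)
  show "fps_nth (fps_rat gessel_tau) 0 = 4"
    unfolding fps_map_nth gessel_tau(2) by simp
qed

lemma fps_rat_gessel_Z: "fps_rat gessel_Z ^ 2 = fps_rat gessel_T" "fps_nth (fps_rat gessel_Z) 0 = 1"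
  by (simp_all flip: gessel_Z(2) add: fps_rat_simps gessel_Z(1))

lemma fps_rat_T_eq:
  "256 * fps_rat gessel_T ^ 3 * fps_X ^ 2 = (fps_rat gessel_T - 1) * (fps_rat gessel_T + 3) ^ 3"
proof -
  have "fps_rat (256 * fps_X ^ 2 * gessel_T ^ 3) = fps_rat ((gessel_T - 1) * (gessel_T + 3) ^ 3)"
    by (simp only: gessel_T(2))
  then show ?thesis
    unfolding fps_rat_simps fps_rat_X by (simp only: mult_ac)
qed

lemma ring_morph_gessel:
  assumes "ring_morph h"
  shows "h (gessel_M a b c) = gessel_M (h a) (h b) (h c)"
    "h (gessel_N a b c) = gessel_N (h a) (h b) (h c)" "h (gessel_D a b) = gessel_D (h a) (h b)"
  by (simp_all add: gessel_M_def gessel_N_def gessel_D_def ring_morph_simps[OF assms])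

context
  fixes a :: "'a::field_char_0 fps" and T Z U V S R :: "'a fps"
  defines "T \<equiv> fps_rat gessel_T" and "Z \<equiv> fps_rat gessel_Z" and "U \<equiv> fps_psub a gessel_U"
    and "V \<equiv> fps_psub a gessel_V" and "R \<equiv> fps_psub a gessel_R" and "S \<equiv> fps_psub a gessel_S"
begin

lemma psub_V_eq: "1 - T + 3 * V + V * T = a * (V ^ 2 * (3 + V + T - V * T))"
  using arg_cong[OF gessel_V(2)[unfolded Let_def], of "fps_psub a"]
  by (simp add: fps_psub_simps fps_psub_lift fps_var_def fps_psub_var T_def V_def)

lemma psub_V_expand: "\<exists>v. V = fps_X ^ 2 * v \<and> fps_nth v 0 = 1"
proof (intro exI conjI)
  show "V = fps_X ^ 2 * fps_psub a gessel_v"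
    by (simp add: V_def gessel_V_def fps_psub_simps fps_psub_X)
  show "fps_nth (fps_psub a gessel_v) 0 = 1"
    by (simp add: fps_psub_nth_0 gessel_V ring_morph_simps[OF ring_morph_ratpoly_eval])
qed

lemma psub_U_eq: "16 * T ^ 2 * (U ^ 2 - T) * fps_X = a * ((U + U * T - 2 * T) * gessel_D T U)"
  using arg_cong[OF gessel_U(2)[unfolded Let_def], of "fps_psub a"]
  by (simp add: fps_psub_simps fps_psub_lift fps_var_def fps_psub_var fps_psub_X T_def U_def
      ring_morph_gessel[OF ring_morph_fps_psub])

lemma psub_U_expand: "\<exists>w. U = 1 + fps_X ^ 2 * w \<and> fps_nth w 0 = 2"
proof (intro exI conjI)
  show "U = 1 + fps_X ^ 2 * fps_psub a gessel_w"
    by (simp add: U_def gessel_U_def fps_psub_simps fps_psub_X)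
  show "fps_nth (fps_psub a gessel_w) 0 = 2"
    by (simp add: fps_psub_nth_0 gessel_U ring_morph_simps[OF ring_morph_ratpoly_eval])
qed

lemma psub_S_eq:
  "S * ((1 - T) * (T + 3)^3 * (U + Z) * gessel_D T U) = 16 * T * (U + U * T - 2 * T) * gessel_M T U Z"
  using arg_cong[OF gessel_S[unfolded Let_def], of "fps_psub a"]
  by (simp add: fps_psub_simps fps_psub_lift T_def U_def Z_def S_def ring_morph_gessel[OF ring_morph_fps_psub])

lemma psub_R_eq:
  "R * ((T - 1) * (T + 3)^3 * (1 + V)^2 * (1 + Z + V - V * Z)^2)
       = 16 * V * Z^3 * (3 + V + T - V * T) * gessel_N T V Z"
  using arg_cong[OF gessel_R[unfolded Let_def], of "fps_psub a"]
  by (simp add: fps_psub_simps fps_psub_lift T_def V_def Z_def R_def ring_morph_gessel[OF ring_morph_fps_psub])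

lemma psub_gessel_nonzero:
  "T \<noteq> 0" "1 - T \<noteq> 0" "T + 3 \<noteq> 0" "1 + Z \<noteq> 0" "V \<noteq> 0" "1 + V \<noteq> 0" "3 + V + T - V * T \<noteq> 0"
  "1 + Z + V - V * Z \<noteq> 0" "U + Z \<noteq> 0" "gessel_D T U \<noteq> 0" "U + U * T - 2 * T \<noteq> 0"
proof -
  have nz: "f \<noteq> 0" if "fps_nth f 0 \<noteq> 0" for f :: "'a fps"
    using that by auto
  obtain v where v: "V = fps_X ^ 2 * v" "fps_nth v 0 = 1"
    using psub_V_expand by blast
  obtain w where w: "U = 1 + fps_X ^ 2 * w" "fps_nth w 0 = 2"
    using psub_U_expand by blast
  define tau :: "'a fps" where "tau = fps_rat gessel_tau"
  have T: "T = 1 + fps_X ^ 2 * tau" "fps_nth tau 0 = 4"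
    by (simp_all only: T_def tau_def fps_rat_gessel_T)
  have Z0: "fps_nth Z 0 = 1"
    unfolding Z_def by (rule fps_rat_gessel_Z)
  show "T \<noteq> 0" "T + 3 \<noteq> 0" "1 + Z \<noteq> 0" "1 + V \<noteq> 0" "3 + V + T - V * T \<noteq> 0"
    "1 + Z + V - V * Z \<noteq> 0" "U + Z \<noteq> 0"
    by (rule nz, simp add: v w Z0 T)+
  have "tau \<noteq> 0" "v \<noteq> 0" "w \<noteq> 0"
    by (rule nz, simp add: v w T)+
  then show T1: "1 - T \<noteq> 0" and "V \<noteq> 0"
    by (simp_all add: v T)
  have "8 * w + 6 * fps_X ^ 2 * w * tau - fps_X ^ 4 * w ^ 2 * tau + fps_X ^ 2 * tau ^ 2 \<noteq> 0"
    by (rule nz) (simp add: w T mult.assoc)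
  then show D: "gessel_D T U \<noteq> 0"
    unfolding T w gessel_D_expand by simp
  \<comment> \<open>If this factor vanished, the equation for U would give U^2 = T and turn the
    factor into U (U - 1)^2, although U differs from 0 and 1.\<close>
  show "U + U * T - 2 * T \<noteq> 0"
  proof
    assume E: "U + U * T - 2 * T = 0"
    then have "U ^ 2 = T"
      using psub_U_eq \<open>T \<noteq> 0\<close> by simp
    with E have "U * (U - 1) ^ 2 = 0"
      by (simp add: algebra_simps power2_eq_square flip: \<open>U ^ 2 = T\<close>)
    moreover have "U \<noteq> 0"
      by (rule nz) (simp add: w)
    ultimately have "fps_X ^ 2 * w = 0"
      by (simp add: w)
    with \<open>w \<noteq> 0\<close> show False
      by simp
  qed
qed

end

text \<open>At the branch in question \<^term>\<open>gessel_C\<close> vanishes to order exactly ten, so that the terms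
  of lower order have to be seen to cancel.\<close>

lemma gessel_C_expand:
  fixes X v p q :: "'a::idom"
  shows "gessel_C (1 + 4 * X^2 * v - X^4 * p) (1 + 2 * X^2 * v + X^4 * q) (X^2 * v) =
    X^10 * (- 64 * v * (p * (p + 2 * q) + 8 * (p + q) * v^2) + X^2 *
      (- (4096 * v^12 * X^12) + 4096 * v^11 * p * X^14 - 8192 * v^11 * q * X^14 + 24576 * v^11 * X^10 - 1536 * v^10 *
       p^2 * X^16 + 8192 * v^10 * p * q * X^16 - 26624 * v^10 * p * X^12 - 6144 * v^10 * q^2 * X^16 + 36864 * v^10 *
       q * X^12 - 12288 * v^10 * X^8 + 256 * v^9 * p^3 * X^18 - 3072 * v^9 * p^2 * q * X^18 + 11008 * v^9 * p^2 *
       X^14 + 6144 * v^9 * p * q^2 * X^18 - 39936 * v^9 * p * q * X^14 + 22528 * v^9 * p * X^10 - 2048 * v^9 * q^3 *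
       X^18 + 19456 * v^9 * q^2 * X^14 - 2048 * v^9 * q * X^10 - 32768 * v^9 * X^6 - 16 * v^8 * p^4 * X^20 + 512 *
       v^8 * p^3 * q * X^20 - 2112 * v^8 * p^3 * X^16 - 2304 * v^8 * p^2 * q^2 * X^20 + 16384 * v^8 * p^2 * q * X^16
       - 13120 * v^8 * p^2 * X^12 + 2048 * v^8 * p * q^3 * X^20 - 21248 * v^8 * p * q^2 * X^16 + 16640 * v^8 * p * q
       * X^12 + 23552 * v^8 * p * X^8 - 256 * v^8 * q^4 * X^20 + 4096 * v^8 * q^3 * X^16 + 7936 * v^8 * q^2 * X^12 -
       49152 * v^8 * q * X^8 + 9216 * v^8 * X^4 - 32 * v^7 * p^4 * q * X^22 + 176 * v^7 * p^4 * X^18 + 384 * v^7 *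
       p^3 * q^2 * X^22 - 3072 * v^7 * p^3 * q * X^18 + 3296 * v^7 * p^3 * X^14 - 768 * v^7 * p^2 * q^3 * X^22 + 8704
       * v^7 * p^2 * q^2 * X^18 - 12480 * v^7 * p^2 * q * X^14 - 3456 * v^7 * p^2 * X^10 + 256 * v^7 * p * q^4 * X^22
       - 4608 * v^7 * p * q^3 * X^18 - 128 * v^7 * p * q^2 * X^14 + 40960 * v^7 * p * q * X^10 - 12288 * v^7 * p *
       X^6 + 256 * v^7 * q^4 * X^18 + 3840 * v^7 * q^3 * X^14 - 20992 * v^7 * q^2 * X^10 + 3072 * v^7 * q * X^6 +
       16384 * v^7 * X^2 - 4 * v^6 * p^5 * X^20 - 24 * v^6 * p^4 * q^2 * X^24 + 240 * v^6 * p^4 * q * X^20 - 356 *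
       v^6 * p^4 * X^16 + 128 * v^6 * p^3 * q^3 * X^24 - 1600 * v^6 * p^3 * q^2 * X^20 + 3408 * v^6 * p^3 * q * X^16
       - 912 * v^6 * p^3 * X^12 - 96 * v^6 * p^2 * q^4 * X^24 + 1920 * v^6 * p^2 * q^3 * X^20 - 3104 * v^6 * p^2 *
       q^2 * X^16 - 10080 * v^6 * p^2 * q * X^12 + 1984 * v^6 * p^2 * X^8 - 320 * v^6 * p * q^4 * X^20 - 1984 * v^6 *
       p * q^3 * X^16 + 19520 * v^6 * p * q^2 * X^12 - 15616 * v^6 * p * q * X^8 - 8960 * v^6 * p * X^4 + 448 * v^6 *
       q^4 * X^16 - 2176 * v^6 * q^3 * X^12 - 6656 * v^6 * q^2 * X^8 + 19968 * v^6 * q * X^4 + 3072 * v^6 - 4 * v^5 *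
       p^5 * q * X^22 + 12 * v^5 * p^5 * X^18 - 8 * v^5 * p^4 * q^3 * X^26 + 116 * v^5 * p^4 * q^2 * X^22 - 364 * v^5
       * p^4 * q * X^18 + 272 * v^5 * p^4 * X^14 + 16 * v^5 * p^3 * q^4 * X^26 - 352 * v^5 * p^3 * q^3 * X^22 + 1112
       * v^5 * p^3 * q^2 * X^18 + 240 * v^5 * p^3 * q * X^14 + 1440 * v^5 * p^3 * X^10 + 144 * v^5 * p^2 * q^4 * X^22
       + 16 * v^5 * p^2 * q^3 * X^18 - 5728 * v^5 * p^2 * q^2 * X^14 + 7648 * v^5 * p^2 * q * X^10 + 1856 * v^5 * p^2
       * X^6 - 288 * v^5 * p * q^4 * X^18 + 2624 * v^5 * p * q^3 * X^14 - 512 * v^5 * p * q^2 * X^10 - 10496 * v^5 *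
       p * q * X^6 - 4864 * v^5 * p * X^2 + 128 * v^5 * q^4 * X^14 - 2176 * v^5 * q^3 * X^10 + 5888 * v^5 * q^2 * X^6
       - v^4 * p^5 * q^2 * X^24 + 10 * v^4 * p^5 * q * X^20 - 17 * v^4 * p^5 * X^16 - v^4 * p^4 * q^4 * X^28 + 24 *
       v^4 * p^4 * q^3 * X^24 - 121 * v^4 * p^4 * q^2 * X^20 + 170 * v^4 * p^4 * q * X^16 - 512 * v^4 * p^4 * X^12 -
       28 * v^4 * p^3 * q^4 * X^24 + 124 * v^4 * p^3 * q^3 * X^20 + 484 * v^4 * p^3 * q^2 * X^16 - 776 * v^4 * p^3 *
       q * X^12 - 1104 * v^4 * p^3 * X^8 + 44 * v^4 * p^2 * q^4 * X^20 - 904 * v^4 * p^2 * q^3 * X^16 + 1904 * v^4 *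
       p^2 * q^2 * X^12 - 736 * v^4 * p^2 * q * X^8 + 5184 * v^4 * p^2 * X^4 + 1056 * v^4 * p * q^3 * X^12 - 4928 *
       v^4 * p * q^2 * X^8 + 4608 * v^4 * p * q * X^4 - 3072 * v^4 * p - 384 * v^4 * q^3 * X^8 + 2560 * v^4 * q^2 *
       X^4 - 3072 * v^4 * q + 2 * v^3 * p^5 * q^2 * X^22 - 12 * v^3 * p^5 * q * X^18 + 50 * v^3 * p^5 * X^14 + 2 *
       v^3 * p^4 * q^4 * X^26 - 16 * v^3 * p^4 * q^3 * X^22 + 22 * v^3 * p^4 * q^2 * X^18 - 116 * v^3 * p^4 * q *
       X^14 + 444 * v^3 * p^4 * X^10 + 4 * v^3 * p^3 * q^4 * X^22 + 96 * v^3 * p^3 * q^3 * X^18 - 372 * v^3 * p^3 *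
       q^2 * X^14 + 768 * v^3 * p^3 * q * X^10 - 1936 * v^3 * p^3 * X^6 - 24 * v^3 * p^2 * q^4 * X^18 - 80 * v^3 *
       p^2 * q^3 * X^14 + 688 * v^3 * p^2 * q^2 * X^10 - 1152 * v^3 * p^2 * q * X^6 + 1728 * v^3 * p^2 * X^2 + 16 *
       v^3 * p * q^4 * X^14 - 64 * v^3 * p * q^3 * X^10 - 320 * v^3 * p * q^2 * X^6 + 512 * v^3 * p * q * X^2 + 256 *
       v^3 * q^2 * X^2 - v^2 * p^6 * X^16 - 2 * v^2 * p^5 * q^2 * X^20 + 16 * v^2 * p^5 * q * X^16 - 60 * v^2 * p^5 *
       X^12 - v^2 * p^4 * q^4 * X^24 - 28 * v^2 * p^4 * q * X^12 + 212 * v^2 * p^4 * X^8 + 4 * v^2 * p^3 * q^4 * X^20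
       - 12 * v^2 * p^3 * q^3 * X^16 + 100 * v^2 * p^3 * q^2 * X^12 - 376 * v^2 * p^3 * q * X^8 + 16 * v^2 * p^3 *
       X^4 - 4 * v^2 * p^2 * q^4 * X^16 + 40 * v^2 * p^2 * q^3 * X^12 - 256 * v^2 * p^2 * q^2 * X^8 + 1248 * v^2 *
       p^2 * q * X^4 - 192 * v^2 * p^2 - 32 * v^2 * p * q^3 * X^8 + 128 * v^2 * p * q^2 * X^4 - 768 * v^2 * p * q + 2
       * v * p^6 * X^14 + 2 * v * p^5 * q^2 * X^18 - 8 * v * p^5 * q * X^14 + 6 * v * p^5 * X^10 - 10 * v * p^4 * q^2
       * X^14 + 96 * v * p^4 * q * X^10 - 100 * v * p^4 * X^6 - 4 * v * p^3 * q^2 * X^10 - 368 * v * p^3 * q * X^6 +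
       192 * v * p^3 * X^2 + 48 * v * p^2 * q^2 * X^6 + 480 * v * p^2 * q * X^2 - p^6 * X^12 - p^5 * q^2 * X^16 - 2 *
       p^5 * q * X^12 + 9 * p^5 * X^8 + 9 * p^4 * q^2 * X^12 + 18 * p^4 * q * X^8 - 24 * p^4 * X^4 - 24 * p^3 * q^2 *
       X^8 - 48 * p^3 * q * X^4 + 16 * p^3 + 16 * p^2 * q^2 * X^4 + 32 * p^2 * q))"
  unfolding gessel_C_def by algebra

text \<open>The equation for V gives T = 1 + 4 V - t^4 p, and the one for U gives U = 1 + 2 V + t^4
  q. Here p depends on b, but p + 2 q starts with -4 for all x and b. In the lowest coefficient of
  \<open>gessel_C_expand\<close> this makes p cancel, and 1024 is left.\<close>

lemma gessel_C_nonzero: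
  fixes x b :: "'a::field_char_0 fps"
  shows "gessel_C (fps_rat gessel_T) (fps_psub (x * fps_X) gessel_U) (fps_psub b gessel_V) \<noteq> 0"
proof -
  define T U V :: "'a fps" where defs: "T = fps_rat gessel_T" "U = fps_psub (x * fps_X) gessel_U" "V = fps_psub b gessel_V"
  define tau :: "'a fps" where "tau = fps_rat gessel_tau"
  obtain v where v: "V = fps_X ^ 2 * v" "fps_nth v 0 = 1"
    using psub_V_expand[of b] unfolding defs by blast
  obtain w where w: "U = 1 + fps_X ^ 2 * w" "fps_nth w 0 = 2"
    using psub_U_expand[of "x * fps_X"] unfolding defs by blast
  have T: "T = 1 + fps_X ^ 2 * tau" "fps_nth tau 0 = 4"
    by (simp_all only: defs tau_def fps_rat_gessel_T)
  define p where "p = b * v^2 * (3 + V + T - V * T) - tau * v"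
  have p: "fps_X^2 * tau = 4 * fps_X^2 * v - fps_X^4 * p"
    using psub_V_eq[of b, folded defs] unfolding p_def v(1) T(1)
    by (simp add: algebra_simps power_numeral_reduce)
  define e where "e = (2 * w - tau + fps_X ^ 2 * w ^ 2) + fps_X ^ 2 * w * (tau - w)"
  define d where "d = 8 * w + 6 * fps_X ^ 2 * w * tau - fps_X ^ 4 * w ^ 2 * tau + fps_X ^ 2 * tau ^ 2"
  \<comment> \<open>This is (2 w - tau) / t^2, taken from the equation for U. As e has constant term
    0, its constant term is that of - w^2.\<close>
  define r where "r = x * e * d * inverse (16 * T^2) - w^2"
  have r: "fps_X^4 * r = 2 * fps_X^2 * w - fps_X^2 * tau"
  proof -
    have D: "gessel_D T U = fps_X ^ 2 * d" and E: "U + U * T - 2 * T = fps_X ^ 2 * e"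
      unfolding T w d_def e_def by (rule gessel_D_expand gessel_E_expand)+
    have inv: "inverse (16 * T^2) * (16 * T^2) = 1"
      by (rule inverse_mult_eq_1) (simp add: T fps_nth_power_0)
    have "fps_X * (16 * T ^ 2 * (U ^ 2 - T)) = fps_X * (x * (fps_X ^ 2 * e * (fps_X ^ 2 * d)))"
      using psub_U_eq[of "x * fps_X", folded defs] unfolding D E by (simp add: mult_ac)
    then have eq: "16 * T ^ 2 * (U ^ 2 - T) = x * (fps_X ^ 2 * e * (fps_X ^ 2 * d))"
      by (metis mult_left_cancel fps_X_neq_zero)
    have "U ^ 2 - T = (inverse (16 * T^2) * (16 * T ^ 2)) * (U ^ 2 - T)"
      unfolding inv by simp
    also have "\<dots> = inverse (16 * T^2) * (16 * T ^ 2 * (U ^ 2 - T))"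
      by (rule mult.assoc)
    also have "\<dots> = inverse (16 * T^2) * (x * (fps_X ^ 2 * e * (fps_X ^ 2 * d)))"
      by (simp only: eq)
    also have "\<dots> = fps_X ^ 4 * (x * e * d * inverse (16 * T^2))"
      by (simp add: power_numeral_reduce mult_ac)
    finally have "U ^ 2 - T = fps_X ^ 4 * (x * e * d * inverse (16 * T^2))" .
    then have "fps_X ^ 4 * (r + w^2) = U ^ 2 - T"
      unfolding r_def by simp
    then show ?thesis
      unfolding w(1) T(1) by (simp add: algebra_simps power_numeral_reduce)
  qed
  have r0: "fps_nth r 0 = - 4"
    by (simp add: r_def e_def w T mult.assoc fps_nth_power_0)
  define q where "q = fps_const (1 / 2) * (r - p)"
  have q: "2 * q = r - p"
  proof -
    have "2 * q = fps_const (2 * (1 / 2)) * (r - p)"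
      unfolding q_def by (simp only: mult.assoc[symmetric] fps_const_mult[symmetric] numeral_fps_const)
    then show ?thesis
      by simp
  qed
  have "2 * (fps_X^2 * w) = 2 * (2 * fps_X^2 * v + fps_X^4 * q)"
  proof -
    have "2 * (2 * fps_X^2 * v + fps_X^4 * q) = 4 * fps_X^2 * v + fps_X^4 * (2 * q)"
      by (simp add: algebra_simps)
    also have "\<dots> = 4 * fps_X^2 * v - fps_X^4 * p + fps_X^4 * r"
      unfolding q by (simp add: algebra_simps)
    also have "\<dots> = 2 * (fps_X^2 * w)"
      unfolding p[symmetric] r by simp
    finally show ?thesis ..
  qed
  then have w': "fps_X^2 * w = 2 * fps_X^2 * v + fps_X^4 * q"
    by (simp only: mult_cancel_left) simp
  have TU: "T = 1 + 4 * fps_X^2 * v - fps_X^4 * p" "U = 1 + 2 * fps_X^2 * v + fps_X^4 * q"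
    unfolding T(1) p w(1) w' by (simp_all add: algebra_simps)
  have "fps_nth (- 64 * v * (p * (p + 2 * q) + 8 * (p + q) * v^2)) 0 = 1024"
    using arg_cong[OF q, of "\<lambda>f. fps_nth f 0"] unfolding q
    by (simp add: v r0 fps_nth_power_0 q_def algebra_simps)
  then have "fps_nth (- 64 * v * (p * (p + 2 * q) + 8 * (p + q) * v^2) + fps_X ^ 2 * H) 0 \<noteq> 0" for H
    by (simp add: fps_X_power_mult_nth)
  then have "- 64 * v * (p * (p + 2 * q) + 8 * (p + q) * v^2) + fps_X ^ 2 * H \<noteq> 0" for H
    by (metis fps_zero_nth)
  then show ?thesis
    unfolding defs[symmetric] TU v(1) gessel_C_expand by simp
qed

section \<open>The root of the kernel and uniqueness of the solution\<close>

lemma to_fract_power: "to_fract (p ^ n) = to_fract p ^ n"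
  by (induction n) simp_all

text \<open>With xt for x, the coefficient of b^2 in the kernel is divisible by t^2. Modulo t the
  equation is (x - 1) b = 1, which is linear in b, so Hensel's lemma applies over \<rat>(x).\<close>

lemma ex_kernel_root:
  "\<exists>b :: rat poly fract fps. fps_nth b 0 = 1 / (univ_var - 1) \<and>
     fps_const univ_var * b = 1 + b + fps_X ^ 2 * fps_const univ_var ^ 2 * b * (1 + b)"
proof -
  define x where "x = (fps_const univ_var :: rat poly fract fps)"
  have x1: "univ_var - 1 \<noteq> 0"
  proof
    assume "univ_var - 1 = 0"
    then have "to_fract [:0, 1:] = to_fract (1 :: rat poly)"
      by (simp add: univ_var_def)
    then show False
      by (simp add: one_pCons del: to_fract_1)
  qed
  have "\<exists>!b. fps_nth b 0 = fps_nth (fps_const (1 / (univ_var - 1))) 0 \<and>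
      poly [:- 1, x - 1 - fps_X ^ 2 * x ^ 2, - (fps_X ^ 2 * x ^ 2):] b = 0"
    using x1 by (intro fps_hensel[where e = "1 / (univ_var - 1)"])
      (simp_all add: pderiv_pCons x_def field_simps mult.assoc)
  then obtain b where b: "fps_nth b 0 = 1 / (univ_var - 1)"
    "poly [:- 1, x - 1 - fps_X ^ 2 * x ^ 2, - (fps_X ^ 2 * x ^ 2):] b = 0"
    by auto
  have "x * b - (1 + b + fps_X ^ 2 * x ^ 2 * b * (1 + b)) =
      poly [:- 1, x - 1 - fps_X ^ 2 * x ^ 2, - (fps_X ^ 2 * x ^ 2):] b"
    by (simp add: algebra_simps)
  then have "x * b = 1 + b + fps_X ^ 2 * x ^ 2 * b * (1 + b)"
    unfolding b(2) by simp
  with b(1) show ?thesis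
    unfolding x_def by blast
qed

text \<open>At \<open>t = 0\<close> the kernel is \<open>x y - 1 - y\<close>, so that \<open>y = 1 / (x - 1)\<close>, and a polynomial in \<open>x\<close> that is also
  a polynomial in \<open>1 / (x - 1)\<close> is constant.\<close>

lemma poly_inverse_not_poly:
  assumes "poly (map_poly of_rat q) (1 / (univ_var - 1)) \<in> range to_fract"
  shows "degree q = 0"
proof (rule ccontr)
  assume deg: "degree q \<noteq> 0"
  define u where "u = univ_var - 1"
  have u: "u = to_fract [:- 1, 1:]"
    by (simp add: u_def univ_var_def one_pCons flip: to_fract_diff to_fract_1)
  have u0: "u \<noteq> 0"
    by (simp add: u)
  obtain g where g: "poly (map_poly of_rat q) (1 / u) = to_fract g"
    using assms unfolding u_def by blast
  let ?m = "degree q"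
  have "to_fract (g * [:- 1, 1:] ^ ?m) = poly (map_poly of_rat q) (1 / u) * u ^ ?m"
    by (simp only: g to_fract_mult to_fract_power u[symmetric])
  also have "\<dots> = (\<Sum>i\<le>?m. of_rat (coeff q i) * (1 / u) ^ i * u ^ ?m)"
    by (simp add: poly_altdef degree_map_poly coeff_map_poly sum_distrib_right)
  also have "\<dots> = (\<Sum>i\<le>?m. of_rat (coeff q i) * u ^ (?m - i))"
    using u0 by (intro sum.cong refl) (simp add: power_diff field_simps)
  also have "\<dots> = to_fract (\<Sum>i\<le>?m. [:coeff q i:] * [:- 1, 1:] ^ (?m - i))"
    by (simp only: to_fract_sum to_fract_mult to_fract_power u of_rat_fract)
  finally have "g * [:- 1, 1:] ^ ?m = (\<Sum>i\<le>?m. [:coeff q i:] * [:- 1, 1:] ^ (?m - i))"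
    by (simp only: to_fract_eq_iff)
  \<comment> \<open>At x = 1 the left side vanishes, and on the right only the leading coefficient
    of q survives.\<close>
  from arg_cong[OF this, of "\<lambda>p. poly p 1"] have "0 = (\<Sum>i\<le>?m. coeff q i * 0 ^ (?m - i))"
    using deg by (simp add: poly_sum zero_power)
  also have "\<dots> = (\<Sum>i\<in>{?m}. coeff q i * 0 ^ (?m - i))"
    by (intro sum.mono_neutral_right) (auto simp: power_0_left)
  finally show False
    using deg by auto
qed

text \<open>The lowest coefficient in t of (1 + b) rho(b) is (1 + y) r(y) at y = 1 / (x - 1), where
  the polynomial r is nonzero. The factor 1 + y makes its degree positive, so the remaining case of
  a constant is excluded too.\<close>

lemma fps_psub_not_integral:
  assumes b: "fps_nth b 0 = 1 / (univ_var - 1)" and "(1 + b) * fps_psub b rho \<in> fps_integral_coeffs"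
  shows "rho = 0"
proof (rule ccontr)
  assume "rho \<noteq> 0"
  define n where "n = subdegree rho"
  define r where "r = fps_shift n rho"
  have rho: "rho = fps_X ^ n * r"
    unfolding r_def n_def by (metis subdegree_decompose mult.commute)
  have r0: "fps_nth r 0 \<noteq> 0"
    using \<open>rho \<noteq> 0\<close> by (simp add: r_def n_def)
  define y where "y = 1 / (univ_var - 1)"
  have "fps_nth (ratpoly_eval b p) 0 = poly (map_poly of_rat p) y" for p
    by (induction p) (simp_all add: ratpoly_eval_0 ratpoly_eval_pCons map_poly_pCons b y_def)
  then have "fps_nth ((1 + b) * fps_psub b rho) n = (1 + y) * poly (map_poly of_rat (fps_nth r 0)) y"
    by (simp add: rho fps_psub_simps fps_psub_X mult.left_commute[of _ "fps_X ^ n"] fps_X_power_mult_nth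
        fps_psub_nth_0 b y_def)
  also have "\<dots> = poly (map_poly of_rat ([:1, 1:] * fps_nth r 0)) y"
    using ring_morph_mult[OF ring_morph_poly[OF ring_morph_of_rat, of y], of "[:1, 1:]" "fps_nth r 0"]
    by (simp add: map_poly_pCons del: mult_pCons_left)
  finally have "poly (map_poly of_rat ([:1, 1:] * fps_nth r 0)) y \<in> range to_fract"
    using assms(2) unfolding fps_integral_coeffs_def by (metis mem_Collect_eq)
  then have "degree ([:1, 1:] * fps_nth r 0) = 0"
    unfolding y_def by (rule poly_inverse_not_poly)
  moreover have "degree ([:1, 1:] * fps_nth r 0) = 1 + degree (fps_nth r 0)"
    by (subst degree_mult_eq) (use r0 in auto)
  ultimately show False
    by simp
qed

definition gessel_S0 :: "rat fps" where
  "gessel_S0 = 32 * gessel_Z^3 * (3 + 3 * gessel_Z - 3 * gessel_Z^2 + gessel_Z^3)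
     / ((1 + gessel_Z) * (gessel_Z^2 + 3)^3)"

lemma gessel_S0_eq:
  "gessel_S0 * ((1 + gessel_Z) * (gessel_Z^2 + 3)^3) = 32 * gessel_Z^3 * (3 + 3 * gessel_Z - 3 * gessel_Z^2 + gessel_Z^3)"
proof -
  have "fps_nth ((1 + gessel_Z) * (gessel_Z^2 + 3)^3) 0 \<noteq> 0"
    by (simp add: gessel_Z gessel_T fps_nth_power_0)
  then show ?thesis
    by (simp add: gessel_S0_def fps_divide_unit inverse_mult_eq_1 mult.assoc)
qed

text \<open>At y = 0 the equation for V is linear, V = (T - 1) / (T + 3), and the closed form of
  Q(0, y) becomes that of Q(0, 0). The factor \<open>q^5\<close> clears the powers of V, of which
  the right side has five.\<close>

lemma value_at_y_0:
  fixes T Z V q :: "'a::idom"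
  assumes T: "Z ^ 2 = T" "T + 3 = q" and Vq: "V * q = T - 1"
  shows "q^5 * (32 * Z^3 * (3 + 3 * Z - 3 * Z^2 + Z^3) * ((T - 1) * (1 + V)^2 * (1 + Z + V - V * Z)^2))
    = q^5 * (16 * V * Z^3 * (3 + V + T - V * T) * gessel_N T V Z * (1 + Z))"
proof -
  have 1: "(1 + V) * q = 2 * T + 2" "(1 + Z + V - V * Z) * q = (1 + Z) * q + (T - 1) * (1 - Z)"
    "(3 + V + T - V * T) * q = (3 + T) * q + (T - 1) * (1 - T)"
  proof -
    have "(1 + V) * q = q + V * q" "(1 + Z + V - V * Z) * q = (1 + Z) * q + (V * q) * (1 - Z)"
      "(3 + V + T - V * T) * q = (3 + T) * q + (V * q) * (1 - T)"
      by (simp_all add: algebra_simps)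
    then show "(1 + V) * q = 2 * T + 2" "(1 + Z + V - V * Z) * q = (1 + Z) * q + (T - 1) * (1 - Z)"
      "(3 + V + T - V * T) * q = (3 + T) * q + (T - 1) * (1 - T)"
      unfolding Vq by (simp_all add: T(2)[symmetric])
  qed
  have "gessel_N T V Z * q^3 = (Z - 1)^2 * (T + 3) * (V * q)^3 + (T - 1) * (T + 2 * Z - 7) * (V * q)^2 * q
     + (T - 1) * (T - 2 * Z - 7) * (V * q) * q^2 + (Z + 1)^2 * (T + 3) * q^3"
    unfolding gessel_N_def by algebra
  note N = this[unfolded Vq]
  have "q^5 * (32 * Z^3 * (3 + 3 * Z - 3 * Z^2 + Z^3) * ((T - 1) * (1 + V)^2 * (1 + Z + V - V * Z)^2))
    = 32 * Z^3 * (3 + 3 * Z - 3 * Z^2 + Z^3) * (T - 1) * ((1 + V) * q)^2 * ((1 + Z + V - V * Z) * q)^2 * q"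
    by algebra
  also have "\<dots> = 16 * (T - 1) * Z^3 * ((3 + T) * q + (T - 1) * (1 - T)) * ((Z - 1)^2 * (T + 3) * (T - 1)^3 + (T - 1) * (T + 2 * Z - 7) * (T - 1)^2 * q
     + (T - 1) * (T - 2 * Z - 7) * (T - 1) * q^2 + (Z + 1)^2 * (T + 3) * q^3) * (1 + Z)"
    unfolding 1 unfolding T(2)[symmetric] unfolding T(1)[symmetric] by algebra
  also have "\<dots> = 16 * (V * q) * Z^3 * ((3 + V + T - V * T) * q) * (gessel_N T V Z * q^3) * (1 + Z)"
    unfolding 1 N Vq ..
  also have "\<dots> = q^5 * (16 * V * Z^3 * (3 + V + T - V * T) * gessel_N T V Z * (1 + Z))"
    by (simp add: power_numeral_reduce mult_ac)
  finally show ?thesis .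
qed

lemma gessel_R_0: "fps_psub 0 gessel_R = gessel_S0"
proof -
  define T Z V q :: "rat fps" where defs: "T = gessel_T" "Z = gessel_Z" "V = fps_psub 0 gessel_V" "q = T + 3"
  have r: "fps_rat f = f" for f
    by (rule fps_ext) simp
  note nz = psub_gessel_nonzero(1-4)[where 'a = rat, unfolded r, folded defs]
    psub_gessel_nonzero(5-8)[of "0 :: rat fps", unfolded r, folded defs]
  have "V * q = T - 1"
    using psub_V_eq[of "0 :: rat fps"] unfolding r by (simp add: defs algebra_simps)
  from value_at_y_0[OF _ _ this] gessel_Z nz(3)
  have "32 * Z^3 * (3 + 3 * Z - 3 * Z^2 + Z^3) * ((T - 1) * (1 + V)^2 * (1 + Z + V - V * Z)^2)
    = 16 * V * Z^3 * (3 + V + T - V * T) * gessel_N T V Z * (1 + Z)"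
    by (simp add: defs)
  also have "16 * V * Z^3 * (3 + V + T - V * T) * gessel_N T V Z =
      fps_psub 0 gessel_R * ((T - 1) * (T + 3)^3 * (1 + V)^2 * (1 + Z + V - V * Z)^2)"
    using psub_R_eq[of "0 :: rat fps"] unfolding r by (simp add: defs)
  finally have "(gessel_S0 * ((1 + Z) * (Z^2 + 3)^3)) * ((T - 1) * (1 + V)^2 * (1 + Z + V - V * Z)^2)
    = fps_psub 0 gessel_R * ((T - 1) * (T + 3)^3 * (1 + V)^2 * (1 + Z + V - V * Z)^2) * (1 + Z)"
    by (simp add: gessel_S0_eq[folded defs])
  moreover have "Z ^ 2 = T"
    by (simp add: defs gessel_Z)
  moreover have "(1 + Z) * (T + 3)^3 * (T - 1) * (1 + V)^2 * (1 + Z + V - V * Z)^2 \<noteq> 0"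
    using nz by (auto simp: defs)
  ultimately have "((1 + Z) * (T + 3)^3 * (T - 1) * (1 + V)^2 * (1 + Z + V - V * Z)^2) * fps_psub 0 gessel_R
    = ((1 + Z) * (T + 3)^3 * (T - 1) * (1 + V)^2 * (1 + Z + V - V * Z)^2) * gessel_S0"
    by (simp add: mult_ac)
  with \<open>(1 + Z) * (T + 3)^3 * (T - 1) * (1 + V)^2 * (1 + Z + V - V * Z)^2 \<noteq> 0\<close> show ?thesis
    by (metis mult_left_cancel)
qed

lemma fps_psub_gessel_x: "fps_psub a (gessel_series fps_var 0) = gessel_series a 0"
  and fps_psub_gessel_y: "fps_psub a (gessel_series 0 fps_var) = gessel_series 0 a"
  using fps_psub_gessel_series[of a "[:0, 1:]" 0] fps_psub_gessel_series[of a 0 "[:0, 1:]"]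
  by (simp_all add: fps_var_def ratpoly_eval_pCons ratpoly_eval_0)

lemma gessel_series_0_0_morph:
  assumes "ring_morph h"
  shows "fps_map h (gessel_series 0 0) = gessel_series 0 0"
  using gessel_series_const[of "0 :: 'a" 0] gessel_series_const[of "0 :: 'b" 0] gessel_poly_morph[OF assms, of 0 0]
  by (intro fps_ext) (simp add: ring_morph_0[OF assms])

text \<open>The difference of the two solutions satisfies an equation in which (1 + b) r(b) has
  coefficients in \<rat>[x], so r = 0. Then y = 0 settles Q(0, 0), and injectivity of the
  substitution of xt settles Q(x, 0).\<close>

lemma gessel_series_eq:
  "gessel_series fps_var 0 = gessel_S" "gessel_series 0 fps_var = gessel_R" "gessel_series 0 0 = gessel_S0"
proof -
  define x where "x = (fps_const univ_var :: rat poly fract fps)"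
  obtain b :: "rat poly fract fps" where b: "fps_nth b 0 = 1 / (univ_var - 1)"
    and kernel: "x * b = 1 + b + fps_X ^ 2 * x ^ 2 * b * (1 + b)"
    using ex_kernel_root unfolding x_def by blast
  define a where "a = x * fps_X"
  have nz: "fps_nth f 0 \<noteq> 0 \<Longrightarrow> f \<noteq> 0" for f :: "rat poly fract fps"
    by auto
  have 1: "x * b = gessel_series a 0 + (1 + b) * gessel_series 0 b - gessel_series 0 0"
  proof -
    \<comment> \<open>At (xt, b) the kernel is t times the equation that defines b, so Q(xt, b)
      drops out.\<close>
    have "a * b - fps_X * (a\<^sup>2 * b + a\<^sup>2 * b\<^sup>2 + b + 1) =
        fps_X * (x * b - (1 + b + fps_X ^ 2 * x ^ 2 * b * (1 + b)))"
      by (simp add: a_def algebra_simps power2_eq_square)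
    also have "\<dots> = 0"
      by (simp only: kernel diff_self mult_zero_right)
    finally have "0 = a * b - fps_X * gessel_series a 0 - fps_X * (1 + b) * gessel_series 0 b + fps_X * gessel_series 0 0"
      using gessel_series_functional_eq[of a b] by simp
    also have "\<dots> = fps_X * (x * b - (gessel_series a 0 + (1 + b) * gessel_series 0 b - gessel_series 0 0))"
      by (simp add: a_def algebra_simps)
    finally show ?thesis
      by simp
  qed
  define T :: "rat poly fract fps" where "T = fps_rat gessel_T"
  define Z :: "rat poly fract fps" where "Z = fps_rat gessel_Z"
  have U: "16 * T^2 * ((fps_psub a gessel_U)^2 - T) =
      x * ((fps_psub a gessel_U + fps_psub a gessel_U * T - 2 * T) * gessel_D T (fps_psub a gessel_U))"
  proof -
    have "fps_X * (16 * T^2 * ((fps_psub a gessel_U)^2 - T)) =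
      fps_X * (x * ((fps_psub a gessel_U + fps_psub a gessel_U * T - 2 * T) * gessel_D T (fps_psub a gessel_U)))"
      using psub_U_eq[of a] unfolding a_def T_def by (simp add: mult_ac)
    then show ?thesis
      by simp
  qed
  have C: "gessel_C T (fps_psub a gessel_U) (fps_psub b gessel_V) \<noteq> 0"
    unfolding a_def T_def by (rule gessel_C_nonzero)
  have "fps_rat gessel_S0 * ((1 + Z) * (Z^2 + 3)^3) = 32 * Z^3 * (3 + 3 * Z - 3 * Z^2 + Z^3)"
    using arg_cong[OF gessel_S0_eq, of fps_rat] unfolding Z_def by (simp add: fps_rat_simps)
  note S0 = this
  have 256: "256 * T \<noteq> 0"
    using psub_gessel_nonzero(1) by (simp add: T_def)
  have 2: "x * b = fps_psub a gessel_S + (1 + b) * fps_psub b gessel_R - fps_rat gessel_S0"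
    using kernel_solution[OF fps_rat_T_eq fps_rat_gessel_Z(1) U[unfolded T_def] psub_V_eq kernel psub_S_eq psub_R_eq
        S0[unfolded Z_def] 256[unfolded T_def] C[unfolded T_def]]
      psub_gessel_nonzero(1-4)[where 'a = "rat poly fract"] psub_gessel_nonzero(5-8)[of b]
      psub_gessel_nonzero(9-11)[of a]
    by blast
  define s where "s = gessel_S - gessel_series fps_var 0"
  define r where "r = gessel_R - gessel_series 0 fps_var"
  define c where "c = gessel_S0 - gessel_series 0 0"
  have c': "fps_psub a (fps_lift c) = fps_rat gessel_S0 - gessel_series 0 0"
    by (simp add: fps_psub_lift c_def fps_rat_simps gessel_series_0_0_morph[OF ring_morph_of_rat])
  have 3: "(1 + b) * fps_psub b r = fps_psub a (fps_lift c - s)"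
  proof -
    have "u2 - u1 = (q2 - q1) - (s2 - s1)" if "s1 + u1 - q1 = s2 + u2 - q2"
      for s1 s2 u1 u2 q1 q2 :: "rat poly fract fps"
      using that by (simp add: algebra_simps)
    from this[OF 1[symmetric, THEN trans, OF 2]] show ?thesis
      unfolding r_def s_def fps_psub_simps c'[unfolded fps_psub_simps] fps_psub_gessel_x fps_psub_gessel_y
      by (simp add: right_diff_distrib)
  qed
  moreover have "a \<in> fps_integral_coeffs"
    by (auto simp: a_def x_def fps_integral_coeffs_def univ_var_def fps_X_def intro: range_to_fract_closed)
  ultimately have "(1 + b) * fps_psub b r \<in> fps_integral_coeffs"
    by (simp add: fps_psub_integral_coeffs)
  then have "r = 0"
    by (rule fps_psub_not_integral[OF b])
  then show R: "gessel_series 0 fps_var = gessel_R"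
    by (simp add: r_def)
  have "fps_psub a (fps_lift c - s) = fps_psub a 0"
    unfolding 3[symmetric] \<open>r = 0\<close> by (simp add: fps_psub_simps)
  then have s: "fps_lift c - s = 0"
    unfolding a_def x_def by (rule fps_psub_scaled_inj)
  show S00: "gessel_series 0 0 = gessel_S0"
    using arg_cong[OF R, of "fps_psub (0 :: rat fps)"] by (simp add: gessel_R_0 fps_psub_gessel_y)
  have "s = 0"
    using s by (simp add: c_def S00 ring_morph_0[OF ring_morph_fps_lift])
  then show "gessel_series fps_var 0 = gessel_S"
    by (simp add: s_def)
qed

section \<open>Degrees\<close>

definition subfield :: "'a::field set \<Rightarrow> bool" where
  "subfield F \<longleftrightarrow> 1 \<in> F \<and> (\<forall>x\<in>F. \<forall>y\<in>F. x - y \<in> F) \<and> (\<forall>x\<in>F. \<forall>y\<in>F. x * y \<in> F) \<and> (\<forall>x\<in>F. inverse x \<in> F)"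

definition subring :: "'a::comm_ring_1 set \<Rightarrow> bool" where
  "subring F \<longleftrightarrow> 1 \<in> F \<and> (\<forall>x\<in>F. \<forall>y\<in>F. x - y \<in> F) \<and> (\<forall>x\<in>F. \<forall>y\<in>F. x * y \<in> F)"

lemma subfield_imp_subring: "subfield F \<Longrightarrow> subring F"
  by (simp add: subfield_def subring_def)

context
  fixes F :: "'a::comm_ring_1 set"
  assumes F: "subring F"
begin

lemma subring_one: "1 \<in> F"
  and subring_diff: "x \<in> F \<Longrightarrow> y \<in> F \<Longrightarrow> x - y \<in> F"
  and subring_mult: "x \<in> F \<Longrightarrow> y \<in> F \<Longrightarrow> x * y \<in> F"
  using F by (simp_all add: subring_def)

lemma subring_zero: "0 \<in> F"
  using subring_diff[OF subring_one subring_one] by simp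

lemma subring_uminus: "x \<in> F \<Longrightarrow> - x \<in> F"
  using subring_diff[OF subring_zero, of x] by simp

lemma subring_add: "x \<in> F \<Longrightarrow> y \<in> F \<Longrightarrow> x + y \<in> F"
  using subring_diff[of x "- y"] subring_uminus[of y] by simp

lemma subring_power: "x \<in> F \<Longrightarrow> x ^ n \<in> F"
  by (induction n) (simp_all add: subring_one subring_mult)

lemma subring_of_nat: "of_nat n \<in> F"
  by (induction n) (simp_all add: subring_zero subring_one subring_add)

lemma subring_of_int: "of_int n \<in> F"
  by (cases n rule: int_cases2) (simp_all add: subring_of_nat subring_uminus)

lemma subring_numeral: "numeral n \<in> F"
  using subring_of_nat[of "numeral n"] by simp

lemma subring_sum: "(\<And>i. i \<in> I \<Longrightarrow> f i \<in> F) \<Longrightarrow> sum f I \<in> F"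
  by (induction I rule: infinite_finite_induct) (simp_all add: subring_zero subring_add)

lemma subring_poly: "(\<And>i. coeff p i \<in> F) \<Longrightarrow> x \<in> F \<Longrightarrow> poly p x \<in> F"
  unfolding poly_altdef by (intro subring_sum subring_mult subring_power)

lemma subring_poly_pCons: "a \<in> F \<Longrightarrow> (\<And>i. coeff p i \<in> F) \<Longrightarrow> coeff (pCons a p) i \<in> F"
  by (cases i) simp_all

lemmas subring_intros = subring_zero subring_one subring_diff subring_mult subring_uminus subring_add
  subring_power subring_of_nat subring_of_int subring_numeral

end

lemma subfield_inverse: "subfield F \<Longrightarrow> x \<in> F \<Longrightarrow> inverse x \<in> F"
  by (simp add: subfield_def)

lemma subfield_divide: "subfield F \<Longrightarrow> x \<in> F \<Longrightarrow> y \<in> F \<Longrightarrow> x / y \<in> F"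
  by (simp add: subfield_def divide_inverse)

lemma subfield_subfield_generated: "subfield (subfield_generated S)"
  unfolding subfield_def by (auto intro: subfield_generated.intros)

lemma subfield_generated_subset:
  assumes "subfield E" "S \<subseteq> E"
  shows "subfield_generated S \<subseteq> E"
proof
  fix x assume "x \<in> subfield_generated S"
  then show "x \<in> E"
    by induction (use assms in \<open>auto simp: subfield_def\<close>)
qed

lemma subfield_generated_mono: "S \<subseteq> S' \<Longrightarrow> subfield_generated S \<subseteq> subfield_generated S'"
  by (rule subfield_generated_subset[OF subfield_subfield_generated]) (auto intro: subfield_generated.base)

inductive_set subring_generated :: "'a::comm_ring_1 set \<Rightarrow> 'a set" for S where
  base: "s \<in> S \<Longrightarrow> s \<in> subring_generated S"
| one: "1 \<in> subring_generated S"
| diff: "u \<in> subring_generated S \<Longrightarrow> v \<in> subring_generated S \<Longrightarrow> u - v \<in> subring_generated S"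
| mult: "u \<in> subring_generated S \<Longrightarrow> v \<in> subring_generated S \<Longrightarrow> u * v \<in> subring_generated S"

lemma subring_subring_generated: "subring (subring_generated S)"
  unfolding subring_def by (auto intro: subring_generated.intros)

lemmas subring_generated_intros = subring_intros[OF subring_subring_generated]

lemma subfield_generated_fraction:
  assumes "x \<in> subfield_generated S"
  shows "\<exists>n d. n \<in> subring_generated S \<and> d \<in> subring_generated S \<and> d \<noteq> 0 \<and> x = n / d"
  using assms
proof induction
  case (base s)
  then show ?case
    by (intro exI[of _ s] exI[of _ 1]) (auto intro: subring_generated.intros)
next
  case one
  then show ?case
    by (intro exI[of _ 1]) (auto intro: subring_generated.intros)
next
  case (diff u v)
  then obtain n d n' d' where "n \<in> subring_generated S" "d \<in> subring_generated S" "d \<noteq> 0" "u = n / d"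
    "n' \<in> subring_generated S" "d' \<in> subring_generated S" "d' \<noteq> 0" "v = n' / d'"
    by blast
  then show ?case
    by (intro exI[of _ "n * d' - n' * d"] exI[of _ "d * d'"]) (auto intro: subring_generated.intros simp: field_simps)
next
  case (mult u v)
  then obtain n d n' d' where "n \<in> subring_generated S" "d \<in> subring_generated S" "d \<noteq> 0" "u = n / d"
    "n' \<in> subring_generated S" "d' \<in> subring_generated S" "d' \<noteq> 0" "v = n' / d'"
    by blast
  then show ?case
    by (intro exI[of _ "n * n'"] exI[of _ "d * d'"]) (auto intro: subring_generated.intros)
next
  case (inverse u)
  then obtain n d where nd: "n \<in> subring_generated S" "d \<in> subring_generated S" "d \<noteq> 0" "u = n / d"
    by blast
  show ?case
  proof (cases "n = 0")
    case True
    with nd show ?thesis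
      by (intro exI[of _ 0] exI[of _ 1]) (auto intro: subring_generated_intros)
  next
    case False
    with nd show ?thesis
      by (intro exI[of _ d] exI[of _ n]) auto
  qed
qed

lemma annihilates_over_mono: "F \<subseteq> F' \<Longrightarrow> annihilates_over F a p \<Longrightarrow> annihilates_over F' a p"
  by (auto simp: annihilates_over_def)

lemma annihilates_over_degree: "annihilates_over F a p \<Longrightarrow> degree p \<ge> 1"
  by (auto simp: annihilates_over_def Suc_le_eq elim!: degree_eq_zeroE intro!: Nat.gr0I)

text \<open>Multiplication by a common denominator. Coefficients that are polynomials in the
  generators can be specialized and mapped, which is not possible for arbitrary elements of the
  field.\<close>

lemma annihilates_over_clear:
  assumes "annihilates_over (subfield_generated S) a p"
  shows "\<exists>r. degree r = degree p \<and> r \<noteq> 0 \<and> (\<forall>i. coeff r i \<in> subring_generated S) \<and> poly r a = 0"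
proof -
  have "\<exists>d. d \<in> subring_generated S \<and> d \<noteq> 0 \<and> (\<forall>i<n. d * coeff p i \<in> subring_generated S)" for n
  proof (induction n)
    case 0
    then show ?case
      by (intro exI[of _ 1]) (auto intro: subring_generated.intros)
  next
    case (Suc n)
    then obtain d where d: "d \<in> subring_generated S" "d \<noteq> 0" "\<And>i. i < n \<Longrightarrow> d * coeff p i \<in> subring_generated S"
      by blast
    have "coeff p n \<in> subfield_generated S"
      using assms by (simp add: annihilates_over_def)
    then obtain n' d' where nd: "n' \<in> subring_generated S" "d' \<in> subring_generated S" "d' \<noteq> 0" "coeff p n = n' / d'"
      using subfield_generated_fraction by blast
    have "d' * d * coeff p i \<in> subring_generated S" if "i < Suc n" for i
    proof (cases "i = n")
      case True
      have "d' * d * coeff p i = d * n'"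
        using nd(3,4) True by simp
      then show ?thesis
        by (simp only: subring_generated.mult[OF d(1) nd(1)])
    next
      case False
      with that d nd show ?thesis
        by (auto simp: mult.assoc intro: subring_generated.intros)
    qed
    with d nd show ?case
      by (intro exI[of _ "d' * d"]) (auto intro: subring_generated.intros)
  qed
  from this[of "Suc (degree p)"] obtain d where d: "d \<in> subring_generated S" "d \<noteq> 0"
    "\<forall>i<Suc (degree p). d * coeff p i \<in> subring_generated S"
    by blast
  have "d * coeff p i \<in> subring_generated S" for i
    using d by (cases "i \<le> degree p") (auto simp: coeff_eq_0 intro: subring_generated_intros)
  with d assms show ?thesis
    by (intro exI[of _ "smult d p"]) (auto simp: annihilates_over_def)
qed

lemma algebraic_of_degreeI:
  assumes F: "subfield F" and p: "annihilates_over F a p" "degree p \<le> d"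
    and lower: "\<And>r. annihilates_over F a r \<Longrightarrow> d \<le> degree r"
  shows "algebraic_of_degree F a d"
proof -
  define q where "q = smult (inverse (lead_coeff p)) p"
  have "p \<noteq> 0"
    using p by (simp add: annihilates_over_def)
  then have q: "lead_coeff q = 1" "degree q = degree p"
    by (simp_all add: q_def)
  have "annihilates_over F a q"
    using p(1) q(1) \<open>p \<noteq> 0\<close> F by (auto simp: annihilates_over_def q_def subfield_def)
  moreover have "degree q = d"
    using lower[OF p(1)] p(2) q(2) by simp
  ultimately show ?thesis
    using q(1) lower unfolding algebraic_of_degree_def minimal_polynomial_def by auto
qed

section \<open>Finite extensions given by a spanning family\<close>

lemma subfield_linear_dependence:
  fixes M :: "'i \<Rightarrow> nat \<Rightarrow> 'a::field"
  assumes F: "subfield F" and "finite I" "n < card I" "\<And>i j. i \<in> I \<Longrightarrow> M i j \<in> F"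
  shows "\<exists>c. (\<forall>i\<in>I. c i \<in> F) \<and> (\<exists>i\<in>I. c i \<noteq> 0) \<and> (\<forall>j<n. (\<Sum>i\<in>I. c i * M i j) = 0)"
  using assms(2-)
proof (induction n arbitrary: I M)
  case 0
  then show ?case
    by (intro exI[of _ "\<lambda>_. 1"]) (use F in \<open>auto simp: subfield_def card_gt_0_iff\<close>)
next
  case (Suc n)
  show ?case
  proof (cases "\<forall>i\<in>I. M i n = 0")
    case True
    obtain c where "\<forall>i\<in>I. c i \<in> F" "\<exists>i\<in>I. c i \<noteq> 0" "\<forall>j<n. (\<Sum>i\<in>I. c i * M i j) = 0"
      using Suc.IH[of I M] Suc.prems by auto
    with True show ?thesis
      by (intro exI[of _ c]) (auto simp: less_Suc_eq)
  next
    case False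
    then obtain p where p: "p \<in> I" "M p n \<noteq> 0"
      by blast
    define k where "k i = M i n / M p n" for i
    have k: "k i \<in> F" if "i \<in> I" for i
      unfolding k_def using that p Suc.prems(3) by (intro subfield_divide[OF F])
    have "\<exists>c. (\<forall>i\<in>I - {p}. c i \<in> F) \<and> (\<exists>i\<in>I - {p}. c i \<noteq> 0) \<and>
        (\<forall>j<n. (\<Sum>i\<in>I - {p}. c i * (M i j - k i * M p j)) = 0)"
    proof (rule Suc.IH)
      show "M i j - k i * M p j \<in> F" if "i \<in> I - {p}" for i j
        using that k p Suc.prems(3) by (auto intro!: subring_intros[OF subfield_imp_subring[OF F]])
    qed (use Suc.prems p in auto)
    then obtain c where c: "\<And>i. i \<in> I - {p} \<Longrightarrow> c i \<in> F" "\<exists>i\<in>I - {p}. c i \<noteq> 0"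
      "\<And>j. j < n \<Longrightarrow> (\<Sum>i\<in>I - {p}. c i * (M i j - k i * M p j)) = 0"
      by blast
    define c' where "c' i = (if i = p then - (\<Sum>i\<in>I - {p}. c i * k i) else c i)" for i
    have "c' i \<in> F" if "i \<in> I" for i
      using that c(1) k by (auto simp: c'_def intro!: subring_uminus subring_sum subring_mult subfield_imp_subring[OF F])
    moreover have "\<exists>i\<in>I. c' i \<noteq> 0"
      using c(2) by (auto simp: c'_def)
    moreover have "(\<Sum>i\<in>I. c' i * M i j) = 0" if "j < Suc n" for j
    proof -
      have "(\<Sum>i\<in>I. c' i * M i j) = c' p * M p j + (\<Sum>i\<in>I - {p}. c' i * M i j)"
        using p(1) Suc.prems(1) by (rule sum.remove[rotated])
      also have "(\<Sum>i\<in>I - {p}. c' i * M i j) = (\<Sum>i\<in>I - {p}. c i * M i j)"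
        by (intro sum.cong) (auto simp: c'_def)
      also have "c' p * M p j + (\<Sum>i\<in>I - {p}. c i * M i j) = (\<Sum>i\<in>I - {p}. c i * (M i j - k i * M p j))"
        by (simp add: c'_def sum_distrib_right sum_distrib_left sum_subtractf algebra_simps)
      also have "\<dots> = 0"
      proof (cases "j = n")
        case True
        then show ?thesis
          using p by (simp add: k_def)
      qed (use c(3) that in auto)
      finally show ?thesis .
    qed
    ultimately show ?thesis
      by blast
  qed
qed

text \<open>\<open>n\<close> only bounds the degree from above, since the family \<open>b\<close>
  may be dependent; lower bounds come from specialization. E is required to be a ring and turns out
  to be a field.\<close>

definition fin_ext :: "'a::field set \<Rightarrow> 'a set \<Rightarrow> nat \<Rightarrow> bool" where
  "fin_ext F E n \<longleftrightarrow> subfield F \<and> subring E \<and> F \<subseteq> E \<and>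
     (\<exists>b. \<forall>x\<in>E. \<exists>c. (\<forall>i<n. c i \<in> F) \<and> x = (\<Sum>i<n. c i * b i))"

lemma fin_extI:
  fixes b :: "'i \<Rightarrow> 'a::field"
  assumes "subfield F" "subring E" "F \<subseteq> E" "finite I"
    and "\<And>x. x \<in> E \<Longrightarrow> \<exists>c. (\<forall>i\<in>I. c i \<in> F) \<and> x = (\<Sum>i\<in>I. c i * b i)"
  shows "fin_ext F E (card I)"
proof -
  obtain h where h: "bij_betw h {..<card I} I"
    using ex_bij_betw_nat_finite[OF assms(4)] by (auto simp: atLeast0LessThan)
  have "\<exists>c. (\<forall>i<card I. c i \<in> F) \<and> x = (\<Sum>i<card I. c i * b (h i))" if x: "x \<in> E" for x
  proof -
    obtain c where c: "\<forall>i\<in>I. c i \<in> F" "x = (\<Sum>i\<in>I. c i * b i)"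
      using assms(5)[OF x] by blast
    have "x = (\<Sum>i<card I. c (h i) * b (h i))"
      unfolding c(2) using h by (rule sum.reindex_bij_betw[symmetric])
    moreover have "\<forall>i<card I. c (h i) \<in> F"
      using c(1) h by (auto simp: bij_betw_def)
    ultimately show ?thesis
      by (intro exI[of _ "\<lambda>i. c (h i)"]) auto
  qed
  then show ?thesis
    unfolding fin_ext_def using assms(1-3) by (intro conjI exI[of _ "\<lambda>i. b (h i)"]) auto
qed

lemma fin_ext_refl:
  assumes "subfield F"
  shows "fin_ext F F 1"
proof -
  have "fin_ext F F (card {()})"
  proof (rule fin_extI[where b = "\<lambda>_. 1"])
    show "\<exists>c. (\<forall>i\<in>{()}. c i \<in> F) \<and> x = (\<Sum>i\<in>{()}. c i * 1)" if "x \<in> F" for x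
      using that by (intro exI[of _ "\<lambda>_. x"]) simp
  qed (use assms subfield_imp_subring in auto)
  then show ?thesis
    by simp
qed

text \<open>The n + 1 powers 1, w, ..., w^n are linear combinations of n elements and hence
  dependent.\<close>

lemma fin_ext_annihilator:
  assumes E: "fin_ext F E n" and w: "w \<in> E"
  shows "\<exists>p. annihilates_over F w p \<and> degree p \<le> n"
proof -
  have F: "subfield F" and subring: "subring E"
    using E by (simp_all add: fin_ext_def)
  obtain b where b: "\<forall>x\<in>E. \<exists>c. (\<forall>i<n. c i \<in> F) \<and> x = (\<Sum>i<n. c i * b i)"
    using E by (auto simp: fin_ext_def)
  have "\<forall>k. \<exists>c. (\<forall>i<n. c i \<in> F) \<and> w ^ k = (\<Sum>i<n. c i * b i)"
    using b w subring_power[OF subring] by blast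
  then obtain M where M: "\<And>k i. i < n \<Longrightarrow> M k i \<in> F" "\<And>k. w ^ k = (\<Sum>i<n. M k i * b i)"
    by metis
  have "(if i < n then M k i else 0) \<in> F" for k i
    using M(1) subring_zero[OF subfield_imp_subring[OF F]] by simp
  then obtain c where c: "\<forall>k\<in>{..n}. c k \<in> F" "\<exists>k\<in>{..n}. c k \<noteq> 0"
    "\<forall>i<n. (\<Sum>k\<in>{..n}. c k * (if i < n then M k i else 0)) = 0"
    using subfield_linear_dependence[OF F, of "{..n}" n "\<lambda>k i. if i < n then M k i else 0"] by auto
  define p where "p = (\<Sum>k\<le>n. monom (c k) k)"
  have coeff: "coeff p i = (if i \<le> n then c i else 0)" for i
    by (simp add: p_def coeff_sum)
  have "poly p w = (\<Sum>k\<le>n. c k * w ^ k)"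
    by (simp add: p_def poly_sum poly_monom)
  also have "\<dots> = (\<Sum>k\<le>n. \<Sum>i<n. c k * M k i * b i)"
    by (simp add: M(2) sum_distrib_left mult.assoc)
  also have "\<dots> = (\<Sum>i<n. (\<Sum>k\<le>n. c k * M k i) * b i)"
    by (subst sum.swap) (simp add: sum_distrib_right)
  also have "\<dots> = 0"
    using c(3) by simp
  finally have "poly p w = 0" .
  moreover have "p \<noteq> 0"
    using c(2) coeff by (metis atMost_iff coeff_0)
  moreover have "coeff p i \<in> F" for i
    using c(1) subring_zero[OF subfield_imp_subring[OF F]] by (simp add: coeff)
  moreover have "degree p \<le> n"
    by (rule degree_le) (simp add: coeff)
  ultimately show ?thesis
    by (auto simp: annihilates_over_def)
qed

text \<open>An annihilator of w, divided by its powers of the variable, reads a + w r(w) = 0 with a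
  nonzero, so 1 / w = - r(w) / a.\<close>

lemma fin_ext_subfield:
  assumes E: "fin_ext F E n"
  shows "subfield E"
proof -
  have F: "subfield F" and subring: "subring E" and FE: "F \<subseteq> E"
    using E by (simp_all add: fin_ext_def)
  have "inverse w \<in> E" if w: "w \<in> E" for w
  proof (cases "w = 0")
    case True
    then show ?thesis
      using subring_zero[OF subring] by simp
  next
    case False
    obtain p where p: "annihilates_over F w p"
      using fin_ext_annihilator[OF E w] by blast
    have "\<exists>q. annihilates_over F w q \<and> coeff q 0 \<noteq> 0"
      using p
    proof (induction p)
      case (pCons a r)
      show ?case
      proof (cases "a = 0")
        case True
        have "coeff r i \<in> F" for i
          using pCons(3) coeff_pCons_Suc[of a r i] by (metis annihilates_over_def)
        then have "annihilates_over F w r"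
          using pCons(3) True \<open>w \<noteq> 0\<close> by (auto simp: annihilates_over_def)
        then show ?thesis
          by (rule pCons.IH)
      qed (use pCons(3) in auto)
    qed (simp add: annihilates_over_def)
    then obtain q where q: "annihilates_over F w q" "coeff q 0 \<noteq> 0"
      by blast
    obtain a r where ar: "q = pCons a r"
      by (cases q) auto
    have "a + w * poly r w = 0" "a \<noteq> 0"
      using q by (auto simp: annihilates_over_def ar)
    then have "inverse w = - poly r w * inverse a"
      using False by (simp add: field_simps eq_neg_iff_add_eq_0)
    moreover have "coeff r i \<in> F" for i
      using q(1) coeff_pCons_Suc[of a r i] by (metis annihilates_over_def ar)
    moreover have "a \<in> F"
      using q(1) coeff_pCons_0[of a r] by (metis annihilates_over_def ar)
    ultimately show ?thesis
      using FE w subfield_inverse[OF F]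
      by (auto intro!: subring_mult[OF subring] subring_uminus[OF subring] subring_poly[OF subring])
  qed
  then show ?thesis
    using subring by (simp add: subfield_def subring_def)
qed

text \<open>The polynomials in v over E of degree below that of p form a ring, since p reduces every
  higher power of v. The products of powers of v with a spanning family of E span it over F.\<close>

lemma fin_ext_adjoin:
  assumes E: "fin_ext F E n" and p: "annihilates_over E v p"
  shows "\<exists>E'. fin_ext F E' (n * degree p) \<and> E \<subseteq> E' \<and> v \<in> E'"
proof -
  have F: "subfield F" and subring: "subring E" and FE: "F \<subseteq> E" and EF: "subfield E"
    using E fin_ext_subfield[OF E] by (simp_all add: fin_ext_def)
  let ?m = "degree p"
  define E' where "E' = {\<Sum>j<?m. e j * v ^ j | e. \<forall>j. e j \<in> E}"
  have m: "?m \<ge> 1"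
    using p by (rule annihilates_over_degree)
  have in_E': "(\<Sum>j<?m. e j * v ^ j) \<in> E'" if "\<And>j. e j \<in> E" for e
    using that by (auto simp: E'_def)
  have E'_diff: "x - y \<in> E'" if xy: "x \<in> E'" "y \<in> E'" for x y
  proof -
    obtain e f where "x = (\<Sum>j<?m. e j * v ^ j)" "y = (\<Sum>j<?m. f j * v ^ j)" "\<forall>j. e j \<in> E" "\<forall>j. f j \<in> E"
      using xy by (auto simp: E'_def)
    moreover from this have "x - y = (\<Sum>j<?m. (e j - f j) * v ^ j)"
      by (simp add: sum_subtractf left_diff_distrib)
    ultimately show ?thesis
      using in_E'[of "\<lambda>j. e j - f j"] subring_diff[OF subring] by simp
  qed
  have E'_smult: "a * x \<in> E'" if a: "a \<in> E" and x: "x \<in> E'" for a x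
  proof -
    obtain e where "x = (\<Sum>j<?m. e j * v ^ j)" "\<forall>j. e j \<in> E"
      using x by (auto simp: E'_def)
    moreover from this have "a * x = (\<Sum>j<?m. (a * e j) * v ^ j)"
      by (simp add: sum_distrib_left mult.assoc)
    ultimately show ?thesis
      using in_E'[of "\<lambda>j. a * e j"] subring_mult[OF subring] a by simp
  qed
  have pow: "v ^ k \<in> E'" for k
  proof (induction k rule: less_induct)
    case (less k)
    show ?case
    proof (cases "k < ?m")
      case True
      have "v ^ k = (\<Sum>j<?m. (if j = k then 1 else 0) * v ^ j)"
        using True by (simp add: if_distrib[of "\<lambda>a. a * _"] cong: if_cong)
      also have "\<dots> \<in> E'"
        using subring_one[OF subring] subring_zero[OF subring] by (intro in_E') auto
      finally show ?thesis .
    next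
      case False
      have c: "coeff p j \<in> E" for j
        using p by (simp add: annihilates_over_def)
      have "0 = (\<Sum>j\<le>?m. coeff p j * v ^ j)"
        using p by (simp add: annihilates_over_def poly_altdef)
      also have "\<dots> = lead_coeff p * v ^ ?m + (\<Sum>j<?m. coeff p j * v ^ j)"
        by (simp add: lessThan_Suc_atMost[symmetric])
      finally have "lead_coeff p * v ^ ?m = - (\<Sum>j<?m. coeff p j * v ^ j)"
        by (simp add: eq_neg_iff_add_eq_0)
      moreover have lc: "lead_coeff p \<noteq> 0"
        using p by (simp add: annihilates_over_def)
      ultimately have "v ^ ?m = - inverse (lead_coeff p) * (\<Sum>j<?m. coeff p j * v ^ j)"
        by (simp add: field_simps)
      then have "v ^ k = - inverse (lead_coeff p) * (\<Sum>j<?m. coeff p j * v ^ j) * v ^ (k - ?m)"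
        using False by (metis le_add_diff_inverse not_less power_add)
      also have "\<dots> = (\<Sum>j<?m. (- inverse (lead_coeff p) * coeff p j) * v ^ (j + (k - ?m)))"
        by (simp add: sum_distrib_left sum_distrib_right power_add mult_ac)
      also have "\<dots> \<in> E'"
      proof -
        have zero: "0 \<in> E'"
          using in_E'[of "\<lambda>_. 0"] subring_zero[OF subring] by simp
        have add: "x + y \<in> E'" if "x \<in> E'" "y \<in> E'" for x y
          using E'_diff[OF that(1) E'_diff[OF zero that(2)]] by simp
        have "(\<Sum>j\<in>J. (- inverse (lead_coeff p) * coeff p j) * v ^ (j + (k - ?m))) \<in> E'" if "J \<subseteq> {..<?m}" for J
          using finite_subset[OF that finite_lessThan] that
        proof (induction J)
          case (insert j J)
          have "j + (k - ?m) < k"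
            using insert(4) False by auto
          then have "v ^ (j + (k - ?m)) \<in> E'"
            by (rule less)
          moreover have "- inverse (lead_coeff p) * coeff p j \<in> E"
            using c subfield_inverse[OF EF] by (intro subring_intros[OF subring]) auto
          ultimately have "- inverse (lead_coeff p) * coeff p j * v ^ (j + (k - ?m)) \<in> E'"
            by (intro E'_smult)
          with insert show ?case
            unfolding sum.insert[OF insert(1,2)] using add by blast
        qed (simp add: zero)
        then show ?thesis
          by blast
      qed
      finally show ?thesis .
    qed
  qed
  have zero: "0 \<in> E'"
    using in_E'[of "\<lambda>_. 0"] subring_zero[OF subring] by simp
  have add: "x + y \<in> E'" if "x \<in> E'" "y \<in> E'" for x y
    using E'_diff[OF that(1) E'_diff[OF zero that(2)]] by simp
  have sum: "(\<And>i. i \<in> I \<Longrightarrow> f i \<in> E') \<Longrightarrow> sum f I \<in> E'" for f :: "nat \<Rightarrow> 'a" and I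
    by (induction I rule: infinite_finite_induct) (simp_all add: zero add)
  have mult: "x * y \<in> E'" if xy: "x \<in> E'" "y \<in> E'" for x y
  proof -
    obtain e f where ef: "x = (\<Sum>j<?m. e j * v ^ j)" "y = (\<Sum>j<?m. f j * v ^ j)" "\<forall>j. e j \<in> E" "\<forall>j. f j \<in> E"
      using xy by (auto simp: E'_def)
    have "x * y = (\<Sum>i<?m. \<Sum>j<?m. (e i * f j) * v ^ (i + j))"
      unfolding ef sum_product by (simp add: power_add mult_ac)
    also have "\<dots> \<in> E'"
      using ef by (intro sum E'_smult pow subring_mult[OF subring]) auto
    finally show ?thesis .
  qed
  have EE': "E \<subseteq> E'"
    using E'_smult[OF _ pow[of 0]] by auto
  have E'_subring: "subring E'"
    unfolding subring_def using pow[of 0] E'_diff mult by simp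
  obtain b where b: "\<forall>x\<in>E. \<exists>c. (\<forall>i<n. c i \<in> F) \<and> x = (\<Sum>i<n. c i * b i)"
    using E by (auto simp: fin_ext_def)
  have "fin_ext F E' (card ({..<n} \<times> {..<?m}))"
  proof (rule fin_extI[where b = "\<lambda>(i, j). b i * v ^ j"])
    fix x assume "x \<in> E'"
    then obtain e where e: "x = (\<Sum>j<?m. e j * v ^ j)" "\<forall>j. e j \<in> E"
      by (auto simp: E'_def)
    have "\<forall>j. \<exists>c. (\<forall>i<n. c i \<in> F) \<and> e j = (\<Sum>i<n. c i * b i)"
      using b e(2) by blast
    then obtain c where c: "\<And>j i. i < n \<Longrightarrow> c j i \<in> F" "\<And>j. e j = (\<Sum>i<n. c j i * b i)"
      by metis
    have "x = (\<Sum>j<?m. \<Sum>i<n. c j i * (b i * v ^ j))"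
      by (simp add: e(1) c(2) sum_distrib_right mult.assoc)
    also have "\<dots> = (\<Sum>i<n. \<Sum>j<?m. c j i * (b i * v ^ j))"
      by (rule sum.swap)
    also have "\<dots> = (\<Sum>(i, j)\<in>{..<n} \<times> {..<?m}. c j i * (b i * v ^ j))"
      by (simp add: sum.cartesian_product)
    finally show "\<exists>c. (\<forall>i\<in>{..<n} \<times> {..<?m}. c i \<in> F) \<and>
        x = (\<Sum>i\<in>{..<n} \<times> {..<?m}. c i * (case i of (i, j) \<Rightarrow> b i * v ^ j))"
      using c(1) by (intro exI[of _ "\<lambda>(i, j). c j i"]) (auto simp: case_prod_unfold)
  qed (use F FE EE' E'_subring in auto)
  then show ?thesis
    using EE' pow[of 1] by (intro exI[of _ E']) simp
qed

text \<open>Nested polynomials in up to three variables. The coefficients are integers, because the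
  same polynomial is evaluated in characteristic 0 and in characteristic 277.\<close>

definition ev1 :: "'a::comm_ring_1 \<Rightarrow> int poly \<Rightarrow> 'a" where
  "ev1 a p = poly (map_poly of_int p) a"

definition ev2 :: "'a::comm_ring_1 \<Rightarrow> 'a \<Rightarrow> int poly poly \<Rightarrow> 'a" where
  "ev2 a b p = poly (map_poly (ev1 a) p) b"

definition ev3 :: "'a::comm_ring_1 \<Rightarrow> 'a \<Rightarrow> 'a \<Rightarrow> int poly poly poly \<Rightarrow> 'a" where
  "ev3 a b c p = poly (map_poly (ev2 a b) p) c"

lemma ring_morph_of_int': "ring_morph of_int"
  by (intro ring_morphI) simp_all

lemma ring_morph_ev1: "ring_morph (ev1 a)"
  using ring_morph_poly[OF ring_morph_of_int'] by (simp add: ev1_def[abs_def])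

lemma ring_morph_ev2: "ring_morph (ev2 a b)"
  using ring_morph_poly[OF ring_morph_ev1] by (simp add: ev2_def[abs_def])

lemma ring_morph_ev3: "ring_morph (ev3 a b c)"
  using ring_morph_poly[OF ring_morph_ev2] by (simp add: ev3_def[abs_def])

lemmas ev3_simps = ring_morph_simps[OF ring_morph_ev3]

lemma ev1_pCons: "ev1 a (pCons k p) = of_int k + a * ev1 a p" and ev1_0: "ev1 a 0 = 0"
  by (simp_all add: ev1_def map_poly_pCons)

lemma ev2_pCons: "ev2 a b (pCons k p) = ev1 a k + b * ev2 a b p" and ev2_0: "ev2 a b 0 = 0"
  by (simp_all add: ev2_def map_poly_pCons ev1_0)

lemma ev3_pCons: "ev3 a b c (pCons k p) = ev2 a b k + c * ev3 a b c p" and ev3_0: "ev3 a b c 0 = 0"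
  by (simp_all add: ev3_def map_poly_pCons ev2_0)

lemma ev3_vars:
  "ev3 a b c [:[:[:0, 1:]:]:] = a" "ev3 a b c [:[:0, 1:]:] = b" "ev3 a b c [:0, 1:] = c"
  by (simp_all add: ev3_pCons ev3_0 ev2_pCons ev2_0 ev1_pCons ev1_0
      ring_morph_1[OF ring_morph_ev1] ring_morph_1[OF ring_morph_ev2])

lemma ev1_morph: "ring_morph h \<Longrightarrow> h (ev1 a p) = ev1 (h a) p"
  by (induction p) (simp_all add: ev1_0 ev1_pCons ring_morph_simps)

lemma ev2_morph: "ring_morph h \<Longrightarrow> h (ev2 a b p) = ev2 (h a) (h b) p"
  by (induction p) (simp_all add: ev2_0 ev2_pCons ring_morph_simps ev1_morph)

lemma ev1_in_subring: "subring R \<Longrightarrow> a \<in> R \<Longrightarrow> ev1 a p \<in> R"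
  by (induction p) (simp_all add: ev1_0 ev1_pCons subring_intros)

lemma ev2_in_subring: "subring R \<Longrightarrow> a \<in> R \<Longrightarrow> b \<in> R \<Longrightarrow> ev2 a b p \<in> R"
  by (induction p) (simp_all add: ev2_0 ev2_pCons subring_intros ev1_in_subring)

lemma ev3_in_subring: "subring R \<Longrightarrow> a \<in> R \<Longrightarrow> b \<in> R \<Longrightarrow> c \<in> R \<Longrightarrow> ev3 a b c p \<in> R"
  by (induction p) (simp_all add: ev3_0 ev3_pCons subring_intros ev2_in_subring)

lemma subring_generated_ev3:
  assumes "w \<in> subring_generated {a, b, c}"
  shows "\<exists>G. w = ev3 a b c G"
  using assms
proof induction
  case (base s)
  then show ?case
    using ev3_vars[of a b c] by (metis insertE singletonD)
next
  case one
  then show ?case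
    by (metis ev3_simps(2))
next
  case (diff u v)
  then show ?case
    by (metis ev3_simps(6))
next
  case (mult u v)
  then show ?case
    by (metis ev3_simps(4))
qed

section \<open>Specialization\<close>

text \<open>Under \<open>(a, b, c) \<mapsto> (a', b', c')\<close> the element \<open>w\<close> of \<open>\<rat>(a, b, c)\<close> goes to \<open>w'\<close>.\<close>

definition specialization :: "'a::comm_ring_1 \<Rightarrow> 'a \<Rightarrow> 'a \<Rightarrow> 'b::idom \<Rightarrow> 'b \<Rightarrow> 'b \<Rightarrow> 'a \<Rightarrow> 'b \<Rightarrow> bool" where
  "specialization a b c a' b' c' w w' \<longleftrightarrow>
     (\<exists>N D. w * ev3 a b c D = ev3 a b c N \<and> w' * ev3 a' b' c' D = ev3 a' b' c' N \<and> ev3 a' b' c' D \<noteq> 0)"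

context
  fixes a b c :: "'a::idom" and a' b' c' :: "'b::idom" and sp
  defines "sp \<equiv> specialization a b c a' b' c'"
begin

lemma spI: "sp (ev3 a b c G) (ev3 a' b' c' G)"
  unfolding sp_def specialization_def by (intro exI[of _ G] exI[of _ 1]) (simp add: ev3_simps)

lemma sp_vars: "sp a a'" "sp b b'" "sp c c'"
  using spI[of "[:[:[:0, 1:]:]:]"] spI[of "[:[:0, 1:]:]"] spI[of "[:0, 1:]"] by (simp_all add: ev3_vars)

lemma sp_of_int: "sp (of_int n) (of_int n)"
  using spI[of "of_int n"] by (simp add: ev3_simps)

lemma sp_0: "sp 0 0" and sp_1: "sp 1 1" and sp_numeral: "sp (numeral k) (numeral k)"
  using sp_of_int[of 0] sp_of_int[of 1] sp_of_int[of "numeral k"] by simp_all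

lemma sp_add: "sp u u' \<Longrightarrow> sp v v' \<Longrightarrow> sp (u + v) (u' + v')"
  and sp_diff: "sp u u' \<Longrightarrow> sp v v' \<Longrightarrow> sp (u - v) (u' - v')"
  and sp_mult: "sp u u' \<Longrightarrow> sp v v' \<Longrightarrow> sp (u * v) (u' * v')"
proof -
  assume "sp u u'" "sp v v'"
  then obtain N1 D1 N2 D2 where
    1: "u * ev3 a b c D1 = ev3 a b c N1" "u' * ev3 a' b' c' D1 = ev3 a' b' c' N1" "ev3 a' b' c' D1 \<noteq> 0" and
    2: "v * ev3 a b c D2 = ev3 a b c N2" "v' * ev3 a' b' c' D2 = ev3 a' b' c' N2" "ev3 a' b' c' D2 \<noteq> 0"
    unfolding sp_def specialization_def by blast
  show "sp (u + v) (u' + v')"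
    unfolding sp_def specialization_def using 1 2
    by (intro exI[of _ "N1 * D2 + N2 * D1"] exI[of _ "D1 * D2"])
      (simp add: ev3_simps algebra_simps flip: 1(1,2) 2(1,2))
  show "sp (u - v) (u' - v')"
    unfolding sp_def specialization_def using 1 2
    by (intro exI[of _ "N1 * D2 - N2 * D1"] exI[of _ "D1 * D2"])
      (simp add: ev3_simps algebra_simps flip: 1(1,2) 2(1,2))
  show "sp (u * v) (u' * v')"
    unfolding sp_def specialization_def using 1 2
    by (intro exI[of _ "N1 * N2"] exI[of _ "D1 * D2"])
      (simp add: ev3_simps algebra_simps flip: 1(1,2) 2(1,2))
qed

lemma sp_power: "sp u u' \<Longrightarrow> sp (u ^ n) (u' ^ n)"
  by (induction n) (simp_all add: sp_1 sp_mult)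

lemma sp_div:
  assumes "w * d = n" "w' * d' = n'" "sp n n'" "sp d d'" "d' \<noteq> 0"
  shows "sp w w'"
proof -
  obtain N1 D1 N2 D2 where
    1: "n * ev3 a b c D1 = ev3 a b c N1" "n' * ev3 a' b' c' D1 = ev3 a' b' c' N1" "ev3 a' b' c' D1 \<noteq> 0" and
    2: "d * ev3 a b c D2 = ev3 a b c N2" "d' * ev3 a' b' c' D2 = ev3 a' b' c' N2" "ev3 a' b' c' D2 \<noteq> 0"
    using assms(3,4) unfolding sp_def specialization_def by blast
  show ?thesis
    unfolding sp_def specialization_def using 1 2 assms(5)
    by (intro exI[of _ "N1 * D2"] exI[of _ "D1 * N2"])
      (simp add: ev3_simps mult_ac flip: 1(1,2) 2(1,2) assms(1,2))
qed

lemma sp_ev1: "sp u u' \<Longrightarrow> sp (ev1 u p) (ev1 u' p)"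
  by (induction p) (simp_all add: ev1_0 ev1_pCons sp_0 sp_add sp_mult sp_of_int)

lemma sp_ev2: "sp u u' \<Longrightarrow> sp v v' \<Longrightarrow> sp (ev2 u v p) (ev2 u' v' p)"
  by (induction p) (simp_all add: ev2_0 ev2_pCons sp_0 sp_add sp_mult sp_ev1)

lemma sp_ev3: "sp u u' \<Longrightarrow> sp v v' \<Longrightarrow> sp w w' \<Longrightarrow> sp (ev3 u v w p) (ev3 u' v' w' p)"
  by (induction p) (simp_all add: ev3_0 ev3_pCons sp_0 sp_add sp_mult sp_ev2)

lemma sp_sum: "(\<And>i. i \<in> I \<Longrightarrow> sp (f i) (f' i)) \<Longrightarrow> sp (sum f I) (sum f' I)"
  by (induction I rule: infinite_finite_induct) (simp_all add: sp_0 sp_add)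

text \<open>Specialization is only a relation, and in general w' depends on the fraction chosen for
  w. When a, b, c are algebraically independent, every fraction for 0 has the numerator N =
  0.\<close>

lemma sp_functional:
  assumes "\<And>G. ev3 a b c G = 0 \<Longrightarrow> G = 0" "sp 0 w'"
  shows "w' = 0"
proof -
  obtain N D where "0 * ev3 a b c D = ev3 a b c N" "w' * ev3 a' b' c' D = ev3 a' b' c' N" "ev3 a' b' c' D \<noteq> 0"
    using assms(2) unfolding sp_def specialization_def by blast
  moreover from this have "N = 0"
    using assms(1) by simp
  ultimately show ?thesis
    by (simp add: ev3_0)
qed

lemmas sp_intros = sp_vars sp_0 sp_1 sp_numeral sp_add sp_diff sp_mult sp_power

end

section \<open>Henselian residue maps\<close>

text \<open>Simple roots lift along the map. The property passes from a coefficient ring to its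
  power series, so the construction can be iterated for three variables.\<close>

definition henselian :: "('a::idom \<Rightarrow> 'k::field) \<Rightarrow> bool" where
  "henselian res \<longleftrightarrow> ring_morph res \<and>
     (\<forall>F r. poly (map_poly res F) r = 0 \<longrightarrow> poly (pderiv (map_poly res F)) r \<noteq> 0 \<longrightarrow>
        (\<exists>R. res R = r \<and> poly F R = 0))"

lemma henselianD:
  assumes "henselian res" "poly (map_poly res F) r = 0" "poly (pderiv (map_poly res F)) r \<noteq> 0"
  obtains R where "res R = r" "poly F R = 0"
  using assms unfolding henselian_def by blast

lemma henselian_id: "henselian (\<lambda>x. x)"
  by (simp add: henselian_def ring_morph_def)

lemma henselian_inverse:
  assumes "henselian res" "res u \<noteq> 0"
  shows "\<exists>e. e * u = 1"
proof -
  note res = ring_morph_simps[of res]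
  have h: "ring_morph res"
    using assms by (simp add: henselian_def)
  have "poly (map_poly res [:- 1, u:]) (inverse (res u)) = 0"
    using assms(2) by (simp add: map_poly_pCons res[OF h])
  moreover have "poly (pderiv (map_poly res [:- 1, u:])) (inverse (res u)) \<noteq> 0"
    using assms(2) by (simp add: map_poly_pCons res[OF h] pderiv_pCons)
  ultimately obtain R where "poly [:- 1, u:] R = 0"
    by (rule henselianD[OF assms(1)])
  then show ?thesis
    by (intro exI[of _ R]) simp
qed

lemma ring_morph_nth_0: "ring_morph (\<lambda>f. fps_nth f 0)"
  by (intro ring_morphI) simp_all

lemma map_poly_pderiv:
  assumes "ring_morph h"
  shows "map_poly h (pderiv p) = pderiv (map_poly h p)"
  by (rule poly_eqI) (simp add: coeff_map_poly coeff_pderiv ring_morph_simps[OF assms])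

lemma ring_morph_poly_comm: "ring_morph h \<Longrightarrow> h (poly p x) = poly (map_poly h p) (h x)"
  by (induction p) (simp_all add: map_poly_pCons ring_morph_simps)

text \<open>A simple root in the field lifts to a root in the coefficient ring of the polynomial of
  constant terms. There the derivative has nonzero residue, hence is a unit, and
  \<open>fps_hensel\<close> lifts the root to series.\<close>

lemma henselian_fps:
  fixes res :: "'a::idom \<Rightarrow> 'k::field"
  assumes "henselian res"
  shows "henselian (\<lambda>f. res (fps_nth f 0))"
proof -
  have h: "ring_morph res"
    using assms by (simp add: henselian_def)
  have "\<exists>R. res (fps_nth R 0) = r \<and> poly F R = 0"
    if F: "poly (map_poly (\<lambda>f. res (fps_nth f 0)) F) r = 0"
      "poly (pderiv (map_poly (\<lambda>f. res (fps_nth f 0)) F)) r \<noteq> 0" for F :: "'a fps poly" and r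
  proof -
    define F0 where "F0 = map_poly (\<lambda>f. fps_nth f 0) F"
    have F0: "map_poly (\<lambda>f. res (fps_nth f 0)) F = map_poly res F0"
      unfolding F0_def by (subst map_poly_map_poly) (simp_all add: o_def ring_morph_simps[OF h])
    obtain s where s: "res s = r" "poly F0 s = 0"
      using henselianD[OF assms F[unfolded F0]] .
    have "res (poly (pderiv F0) s) \<noteq> 0"
      using F(2) unfolding F0 by (simp add: ring_morph_poly_comm[OF h] map_poly_pderiv[OF h] s)
    then obtain e where e: "e * poly (pderiv F0) s = 1"
      using henselian_inverse[OF assms] by blast
    have "fps_nth (poly G (fps_const s)) 0 = poly (map_poly (\<lambda>f. fps_nth f 0) G) s" for G :: "'a fps poly"
      using ring_morph_poly_comm[OF ring_morph_nth_0, of G "fps_const s"] by simp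
    then have "\<exists>!S. fps_nth S 0 = fps_nth (fps_const s) 0 \<and> poly F S = 0"
      using s e by (intro fps_hensel[where e = e])
        (simp_all add: map_poly_pderiv[OF ring_morph_nth_0] flip: F0_def)
    then show ?thesis
      using s(1) by auto
  qed
  then show ?thesis
    using ring_morph_comp[OF ring_morph_nth_0 h] by (simp add: henselian_def)
qed

section \<open>Power series over the field with 277 elements\<close>

typedef gf = "{0..<277::int}"
  by (intro exI[of _ 0]) simp

lemma Rep_gf_mod: "Rep_gf a mod 277 = Rep_gf a"
  using Rep_gf[of a] by simp

lemma Rep_Abs_gf: "Rep_gf (Abs_gf (n mod 277)) = n mod 277"
  by (rule Abs_gf_inverse) simp

instantiation gf :: comm_ring_1
begin

definition "0 = Abs_gf (0 mod 277)"
definition "1 = Abs_gf (1 mod 277)"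
definition "a + b = Abs_gf ((Rep_gf a + Rep_gf b) mod 277)"
definition "a * b = Abs_gf ((Rep_gf a * Rep_gf b) mod 277)"
definition "a - b = Abs_gf ((Rep_gf a - Rep_gf b) mod 277)"
definition "- a = Abs_gf ((- Rep_gf a) mod 277)" for a :: gf

lemmas Rep_gf_simps = zero_gf_def[THEN arg_cong, of Rep_gf, unfolded Rep_Abs_gf]
  one_gf_def[THEN arg_cong, of Rep_gf, unfolded Rep_Abs_gf]
  plus_gf_def[THEN arg_cong, of Rep_gf, unfolded Rep_Abs_gf]
  times_gf_def[THEN arg_cong, of Rep_gf, unfolded Rep_Abs_gf]
  minus_gf_def[THEN arg_cong, of Rep_gf, unfolded Rep_Abs_gf]
  uminus_gf_def[THEN arg_cong, of Rep_gf, unfolded Rep_Abs_gf]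

instance
  by standard (simp_all add: Rep_gf_simps Rep_gf_mod mod_simps algebra_simps flip: Rep_gf_inject)

end

lemma prime_277: "prime (277::int)"
  by (simp add: prime_int_numeral_eq prime_nat_numeral_eq)

lemma ex_inverse_gf:
  assumes "a \<noteq> 0"
  shows "\<exists>b :: gf. a * b = 1"
proof -
  have "\<not> 277 dvd Rep_gf a"
    using assms Rep_gf_mod[of a] by (auto simp: Rep_gf_simps dvd_eq_mod_eq_0 simp flip: Rep_gf_inject)
  then have "coprime 277 (Rep_gf a)"
    using prime_imp_coprime[OF prime_277] by blast
  then obtain u v where uv: "u * 277 + v * Rep_gf a = 1"
    using bezout_int[of 277 "Rep_gf a"] by (auto simp: coprime_iff_gcd_eq_1)
  have "Rep_gf a * v = 1 + (- u) * 277"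
    using uv by (simp add: algebra_simps)
  then have "(Rep_gf a * v) mod 277 = 1"
    by (simp only: mod_mult_self1) simp
  then have "a * Abs_gf (v mod 277) = 1"
    by (simp add: Rep_gf_simps Rep_Abs_gf mod_simps flip: Rep_gf_inject)
  then show ?thesis
    by blast
qed

instantiation gf :: field
begin

definition inverse_gf_def: "inverse a = (if a = 0 then 0 else SOME b. a * b = 1)" for a :: gf
definition divide_gf_def: "a div b = a * inverse b" for a b :: gf

instance
proof
  fix a b :: gf
  show "inverse (0 :: gf) = 0"
    by (simp add: inverse_gf_def)
  show "a div b = a * inverse b"
    by (simp add: divide_gf_def)
  assume "a \<noteq> 0"
  then have "a * inverse a = 1"
    using someI_ex[OF ex_inverse_gf] by (simp add: inverse_gf_def)
  then show "inverse a * a = 1"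
    by (simp only: mult.commute)
qed

end

lemma gf_of_int_eq_0_iff: "(of_int n :: gf) = 0 \<longleftrightarrow> n mod 277 = 0"
proof -
  have "Rep_gf (of_int n) = n mod 277" for n
    by (induction n rule: int_induct[of _ 0]) (simp_all add: Rep_gf_simps mod_simps)
  then show ?thesis
    by (simp add: Rep_gf_simps flip: Rep_gf_inject)
qed

type_synonym spec_ring = "gf fps fps fps"

definition residue :: "spec_ring \<Rightarrow> gf" where
  "residue f = fps_nth (fps_nth (fps_nth f 0) 0) 0"

lemma henselian_residue: "henselian residue"
  using henselian_fps[OF henselian_fps[OF henselian_fps[OF henselian_id]]]
  unfolding residue_def[abs_def] .

lemma ring_morph_residue: "ring_morph residue"
  using henselian_residue by (simp add: henselian_def)

lemmas residue_simps = ring_morph_simps[OF ring_morph_residue]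

text \<open>With \<open>spec_x\<close> and \<open>spec_y\<close> this moves the point (171, 242,
  271) by three independent variables: a generic point over the prime field with that point as its
  residue.\<close>

definition spec_s :: spec_ring where
  "spec_s = fps_const (fps_const (171 + fps_X))"

definition spec_x :: spec_ring where
  "spec_x = fps_const (242 + fps_X)"

definition spec_y :: spec_ring where
  "spec_y = 271 + fps_X"

lemma residue_spec: "residue spec_s = 171" "residue spec_x = 242" "residue spec_y = 271"
  by (simp_all add: residue_def spec_s_def spec_x_def spec_y_def numeral_fps_const)

lemma poly_shifted_X:
  fixes p :: "'a::idom poly"
  assumes "poly (map_poly fps_const p) (fps_const c + fps_X) = 0"
  shows "p = 0"
proof -
  have "poly (map_poly fps_const p) (fps_const c + fps_X) = fps_of_poly (pcompose p [:c, 1:])" for p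
    by (induction p)
      (simp_all add: map_poly_pCons pcompose_pCons fps_of_poly_add fps_of_poly_mult fps_of_poly_pCons fps_of_poly_const mult.commute)
  with assms have "fps_of_poly (pcompose p [:c, 1:]) = fps_of_poly 0"
    by simp
  then have "pcompose p [:c, 1:] = 0"
    by (simp only: fps_of_poly_eq_iff)
  then show ?thesis
    by (simp add: pcompose_eq_0_iff)
qed

text \<open>The three series are algebraically independent over the prime field. Consequently a
  polynomial with some coefficient prime to 277 does not vanish at them.\<close>

lemma ev3_spec_eq_0:
  assumes "ev3 spec_s spec_x spec_y G = 0"
  shows "[:[:[:277:]:]:] dvd G"
proof -
  define s :: "gf fps" where "s = 171 + fps_X"
  define x :: "gf fps fps" where "x = fps_const 242 + fps_X"
  have 1: "p = 0" if "poly (map_poly of_int q) s = 0" "p = map_poly of_int q" for p :: "gf poly" and q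
  proof (rule poly_shifted_X[where c = 171])
    have "map_poly fps_const p = map_poly of_int q"
      unfolding that(2) by (subst map_poly_map_poly) (simp_all add: o_def fps_of_int)
    then show "poly (map_poly fps_const p) (fps_const 171 + fps_X) = 0"
      using that(1) by (simp add: s_def numeral_fps_const)
  qed
  have s1: "277 dvd coeff q i" if "ev1 s q = 0" for q i
  proof -
    have "map_poly of_int q = (0 :: gf poly)"
      using 1[of q] that by (simp add: ev1_def)
    from arg_cong[OF this, of "\<lambda>p. coeff p i"] have "(of_int (coeff q i) :: gf) = 0"
      by (simp add: coeff_map_poly)
    then show ?thesis
      by (simp add: gf_of_int_eq_0_iff dvd_eq_mod_eq_0)
  qed
  have s2: "[:277:] dvd coeff q i" if "ev2 (fps_const s) x q = 0" for q i
  proof -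
    have "map_poly (ev1 (fps_const s)) q = map_poly fps_const (map_poly (ev1 s) q)"
      by (subst map_poly_map_poly) (simp_all add: o_def ev1_0 ev1_morph[OF ring_morph_fps_const])
    then have "map_poly (ev1 s) q = 0"
      using that unfolding ev2_def x_def by (intro poly_shifted_X) simp
    from arg_cong[OF this, of "\<lambda>p. coeff p i"] have "ev1 s (coeff q i) = 0"
      by (simp add: coeff_map_poly ev1_0)
    then show ?thesis
      using s1 by (simp add: const_poly_dvd_iff)
  qed
  have "[:[:277:]:] dvd coeff G i" for i
  proof -
    have "map_poly (ev2 spec_s spec_x) G = map_poly fps_const (map_poly (ev2 (fps_const s) x) G)"
      by (subst map_poly_map_poly)
        (simp_all add: o_def ev2_0 ev2_morph[OF ring_morph_fps_const] spec_s_def spec_x_def s_def x_def numeral_fps_const)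
    then have "map_poly (ev2 (fps_const s) x) G = 0"
      using assms unfolding ev3_def spec_y_def by (intro poly_shifted_X[where c = 271]) (simp add: numeral_fps_const)
    from arg_cong[OF this, of "\<lambda>p. coeff p i"] have "ev2 (fps_const s) x (coeff G i) = 0"
      by (simp add: coeff_map_poly ev2_0)
    then show ?thesis
      using s2 by (simp add: const_poly_dvd_iff)
  qed
  then show ?thesis
    by (simp add: const_poly_dvd_iff)
qed

text \<open>The derivatives with respect to \<open>Z\<close>, \<open>U\<close>, \<open>V\<close> must not vanish either, so that a point over the prime field
  lifts to power series above \<^term>\<open>spec_s\<close>, \<^term>\<open>spec_x\<close>, \<^term>\<open>spec_y\<close> by Hensel's lemma. The last condition
  says that \<open>A\<close> is the value of \<open>S - S0 + (1 + y) R\<close>, free of denominators.\<close>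

definition spec_cond :: "int \<Rightarrow> int \<Rightarrow> int \<Rightarrow> int \<Rightarrow> int \<Rightarrow> int \<Rightarrow> int \<Rightarrow> int \<Rightarrow> int \<Rightarrow> int \<Rightarrow> int \<Rightarrow> int \<Rightarrow> int \<Rightarrow> int \<Rightarrow> bool" where
  "spec_cond Z U V A T D E W dS dR d0 nS nR n0 \<longleftrightarrow>
   ((T - 1) * (T + 3)^3 - 256 * T^3 * 171) mod 277 = 0 \<and>
   (8 * Z^7 + 48 * Z^5 + 72 * Z^3 - 6 * 256 * Z^5 * 171) mod 277 \<noteq> 0 \<and>
   (16 * T^2 * (U^2 - T) - 242 * (E * D)) mod 277 = 0 \<and>
   (16 * T^2 * (2 * U) - 242 * ((1 + T) * D + E * (2 * U + 8 * T - 2 * T * U))) mod 277 \<noteq> 0 \<and>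
   (1 - T + 3 * V + V * T - 271 * (V^2 * W)) mod 277 = 0 \<and>
   (3 + T - 271 * (2 * V * W + V^2 * (1 - T))) mod 277 \<noteq> 0 \<and>
   (256 * T^3) mod 277 \<noteq> 0 \<and> (E * D) mod 277 \<noteq> 0 \<and> (V^2 * W) mod 277 \<noteq> 0 \<and>
   dS mod 277 \<noteq> 0 \<and> dR mod 277 \<noteq> 0 \<and> d0 mod 277 \<noteq> 0 \<and>
   (A * (dS * dR * d0) - (nS * dR * d0 + (1 + 271) * nR * dS * d0 - n0 * dS * dR)) mod 277 = 0"

definition spec_point :: "int \<Rightarrow> int \<Rightarrow> int \<Rightarrow> int \<Rightarrow> int \<Rightarrow> bool" where
  "spec_point T Z U V A \<longleftrightarrow> T = Z^2 \<and> spec_cond Z U V A T (gessel_D T U) (U + U * T - 2 * T) (3 + V + T - V * T)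
     ((1 - T) * (T + 3)^3 * (U + Z) * gessel_D T U)
     ((T - 1) * (T + 3)^3 * (1 + V)^2 * (1 + Z + V - V * Z)^2)
     ((1 + Z) * (Z^2 + 3)^3)
     (16 * T * (U + U * T - 2 * T) * gessel_M T U Z)
     (16 * V * Z^3 * (3 + V + T - V * T) * gessel_N T V Z)
     (32 * Z^3 * (3 + 3 * Z - 3 * Z^2 + Z^3))"

text \<open>The fibre over (171, 242, 271), with entries (Z, U, V, A). The eight Z form four pairs
  of opposite sign; U and V depend on T = Z^2 only, with three values each.\<close>

definition spec_points :: "(int \<times> int \<times> int \<times> int) list" where
  "spec_points = [
    (18, 9, 19, 42), (18, 9, 58, 248), (18, 9, 177, 117), (18, 156, 19, 170), (18, 156, 58, 99), (18,
    156, 177, 245), (18, 169, 19, 225), (18, 169, 58, 154), (18, 169, 177, 23), (39, 180, 31, 199), (39,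
    180, 131, 148), (39, 180, 194, 237), (39, 227, 31, 88), (39, 227, 131, 37), (39, 227, 194, 126),
    (39, 264, 31, 167), (39, 264, 131, 116), (39, 264, 194, 205), (43, 24, 29, 230), (43, 24, 123, 19),
    (43, 24, 129, 22), (43, 40, 29, 110), (43, 40, 123, 176), (43, 40, 129, 179), (43, 96, 29, 243),
    (43, 96, 123, 32), (43, 96, 129, 35), (98, 89, 145, 180), (98, 89, 180, 31), (98, 89, 242, 38), (98,
    168, 145, 274), (98, 168, 180, 125), (98, 168, 242, 132), (98, 243, 145, 1), (98, 243, 180, 129),
    (98, 243, 242, 136), (179, 89, 145, 114), (179, 89, 180, 263), (179, 89, 242, 256), (179, 168, 145,
    20), (179, 168, 180, 169), (179, 168, 242, 162), (179, 243, 145, 16), (179, 243, 180, 165), (179,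
    243, 242, 158), (234, 24, 29, 64), (234, 24, 123, 275), (234, 24, 129, 272), (234, 40, 29, 184),
    (234, 40, 123, 118), (234, 40, 129, 115), (234, 96, 29, 51), (234, 96, 123, 262), (234, 96, 129,
    259), (238, 180, 31, 95), (238, 180, 131, 146), (238, 180, 194, 57), (238, 227, 31, 206), (238, 227,
    131, 257), (238, 227, 194, 168), (238, 264, 31, 127), (238, 264, 131, 178), (238, 264, 194, 89),
    (259, 9, 19, 252), (259, 9, 58, 46), (259, 9, 177, 177), (259, 156, 19, 124), (259, 156, 58, 195),
    (259, 156, 177, 49), (259, 169, 19, 69), (259, 169, 58, 140), (259, 169, 177, 271)]"

lemma spec_points: "list_all (\<lambda>(Z, U, V, A). spec_point (Z^2) Z U V A) spec_points"
  by code_simp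

lemma spec_points_distinct: "distinct (map (\<lambda>(Z, U, V, A). A) spec_points)" "length spec_points = 72"
  "list_all (\<lambda>(Z, U, V, A). 0 \<le> A \<and> A < 277) spec_points"
  by (simp_all add: spec_points_def)

text \<open>Written without division and with s in place of t^2, so that the equations make sense
  both over a field of characteristic 0 and in \<open>spec_ring\<close>.\<close>

definition gessel_curve :: "'a::comm_ring_1 \<Rightarrow> 'a \<Rightarrow> 'a \<Rightarrow> 'a \<Rightarrow> 'a \<Rightarrow> 'a \<Rightarrow> bool" where
  "gessel_curve s x y Z U V \<longleftrightarrow> (let T = Z^2 in
     256 * T^3 * s = (T - 1) * (T + 3)^3 \<and>
     16 * T^2 * (U^2 - T) = x * ((U + U * T - 2 * T) * gessel_D T U) \<and>
     1 - T + 3 * V + V * T = y * (V^2 * (3 + V + T - V * T)))"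

definition gessel_values :: "'a::comm_ring_1 \<Rightarrow> 'a \<Rightarrow> 'a \<Rightarrow> 'a \<Rightarrow> 'a \<Rightarrow> 'a \<Rightarrow> bool" where
  "gessel_values Z U V S R S0 \<longleftrightarrow> (let T = Z^2 in
     S * ((1 - T) * (T + 3)^3 * (U + Z) * gessel_D T U) = 16 * T * (U + U * T - 2 * T) * gessel_M T U Z \<and>
     R * ((T - 1) * (T + 3)^3 * (1 + V)^2 * (1 + Z + V - V * Z)^2)
       = 16 * V * Z^3 * (3 + V + T - V * T) * gessel_N T V Z \<and>
     S0 * ((1 + Z) * (Z^2 + 3)^3) = 32 * Z^3 * (3 + 3 * Z - 3 * Z^2 + Z^3))"

definition gessel_nondegenerate :: "'a::comm_ring_1 \<Rightarrow> 'a \<Rightarrow> 'a \<Rightarrow> bool" where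
  "gessel_nondegenerate Z U V \<longleftrightarrow> (let T = Z^2 in
     256 * T^3 \<noteq> 0 \<and> (U + U * T - 2 * T) * gessel_D T U \<noteq> 0 \<and> V^2 * (3 + V + T - V * T) \<noteq> 0 \<and>
     (1 - T) * (T + 3)^3 * (U + Z) * gessel_D T U \<noteq> 0 \<and>
     (T - 1) * (T + 3)^3 * (1 + V)^2 * (1 + Z + V - V * Z)^2 \<noteq> 0 \<and>
     (1 + Z) * (Z^2 + 3)^3 \<noteq> 0)"

lemma residue_gessel:
  "residue (gessel_M a b c) = gessel_M (residue a) (residue b) (residue c)"
  "residue (gessel_N a b c) = gessel_N (residue a) (residue b) (residue c)"
  "residue (gessel_D a b) = gessel_D (residue a) (residue b)"
  by (rule ring_morph_gessel[OF ring_morph_residue])+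

lemma of_int_gessel:
  "(of_int (gessel_M a b c) :: 'a::comm_ring_1) = gessel_M (of_int a) (of_int b) (of_int c)"
  "(of_int (gessel_N a b c) :: 'a) = gessel_N (of_int a) (of_int b) (of_int c)"
  "(of_int (gessel_D a b) :: 'a) = gessel_D (of_int a) (of_int b)"
  by (rule ring_morph_gessel[OF ring_morph_of_int'])+

text \<open>Z is lifted first; the equations for U and V have coefficients that contain the lifted
  Z, but no further unknown. The denominators of S, R, S0 have nonzero residues and hence are
  units.\<close>

lemma spec_point_lift:
  assumes "spec_point (Z0^2) Z0 U0 V0 A0"
  shows "\<exists>Z U V S R S0. gessel_curve spec_s spec_x spec_y Z U V \<and> gessel_values Z U V S R S0 \<and>
    gessel_nondegenerate Z U V \<and> residue (S - S0 + (1 + spec_y) * R) = of_int A0 \<and> residue Z = of_int Z0"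
proof -
  have conv: "(n mod 277 = 0) = ((of_int n :: gf) = 0)" for n
    by (simp add: gf_of_int_eq_0_iff)
  define z u v a :: gf where zuva: "z = of_int Z0" "u = of_int U0" "v = of_int V0" "a = of_int A0"
  define T0 where "T0 = z^2"
  have cond: "(T0 - 1) * (T0 + 3)^3 - 256 * T0^3 * 171 = 0"
    "8 * z^7 + 48 * z^5 + 72 * z^3 - 6 * 256 * z^5 * 171 \<noteq> 0"
    "16 * T0^2 * (u^2 - T0) - 242 * ((u + u * T0 - 2 * T0) * gessel_D T0 u) = 0"
    "16 * T0^2 * (2 * u) - 242 * ((1 + T0) * gessel_D T0 u + (u + u * T0 - 2 * T0) * (2 * u + 8 * T0 - 2 * T0 * u)) \<noteq> 0"
    "1 - T0 + 3 * v + v * T0 - 271 * (v^2 * (3 + v + T0 - v * T0)) = 0"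
    "3 + T0 - 271 * (2 * v * (3 + v + T0 - v * T0) + v^2 * (1 - T0)) \<noteq> 0"
    "256 * T0^3 \<noteq> 0" "(u + u * T0 - 2 * T0) * gessel_D T0 u \<noteq> 0" "v^2 * (3 + v + T0 - v * T0) \<noteq> 0"
    "(1 - T0) * (T0 + 3)^3 * (u + z) * gessel_D T0 u \<noteq> 0"
    "(T0 - 1) * (T0 + 3)^3 * (1 + v)^2 * (1 + z + v - v * z)^2 \<noteq> 0"
    "(1 + z) * (z^2 + 3)^3 \<noteq> 0"
    "a * (((1 - T0) * (T0 + 3)^3 * (u + z) * gessel_D T0 u) * ((T0 - 1) * (T0 + 3)^3 * (1 + v)^2 * (1 + z + v - v * z)^2) * ((1 + z) * (z^2 + 3)^3))
      - ((16 * T0 * (u + u * T0 - 2 * T0) * gessel_M T0 u z) * ((T0 - 1) * (T0 + 3)^3 * (1 + v)^2 * (1 + z + v - v * z)^2) * ((1 + z) * (z^2 + 3)^3)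
      + (1 + 271) * (16 * v * z^3 * (3 + v + T0 - v * T0) * gessel_N T0 v z) * ((1 - T0) * (T0 + 3)^3 * (u + z) * gessel_D T0 u) * ((1 + z) * (z^2 + 3)^3)
      - (32 * z^3 * (3 + 3 * z - 3 * z^2 + z^3)) * ((1 - T0) * (T0 + 3)^3 * (u + z) * gessel_D T0 u) * ((T0 - 1) * (T0 + 3)^3 * (1 + v)^2 * (1 + z + v - v * z)^2)) = 0"
    using assms unfolding spec_point_def spec_cond_def conv
    unfolding of_int_add of_int_mult of_int_diff of_int_power of_int_numeral of_int_1 of_int_gessel zuva[symmetric]
      T0_def[symmetric] by blast+
  note map_simps = map_poly_pCons residue_simps residue_spec residue_gessel pderiv_pCons
  \<comment> \<open>The polynomial is (Z^2 - 1) (Z^2 + 3)^3 - 256 s Z^6.\<close>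
  obtain Z where Z: "residue Z = z" "poly [:- 27, 0, 0, 0, 18, 0, 8 - 256 * spec_s, 0, 1:] Z = 0"
  proof (rule henselianD[OF henselian_residue])
    show "poly (map_poly residue [:- 27, 0, 0, 0, 18, 0, 8 - 256 * spec_s, 0, 1:]) z = 0"
    proof -
      have "poly (map_poly residue [:- 27, 0, 0, 0, 18, 0, 8 - 256 * spec_s, 0, 1:]) z =
        (T0 - 1) * (T0 + 3)^3 - 256 * T0^3 * 171"
        unfolding T0_def by (simp add: map_simps power_numeral_reduce algebra_simps)
      then show ?thesis
        using cond(1) by simp
    qed
    show "poly (pderiv (map_poly residue [:- 27, 0, 0, 0, 18, 0, 8 - 256 * spec_s, 0, 1:])) z \<noteq> 0"
    proof -
      have "poly (pderiv (map_poly residue [:- 27, 0, 0, 0, 18, 0, 8 - 256 * spec_s, 0, 1:])) z =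
        8 * z^7 + 48 * z^5 + 72 * z^3 - 6 * 256 * z^5 * 171"
        by (simp add: map_simps power_numeral_reduce algebra_simps)
      then show ?thesis
        using cond(2) by simp
    qed
  qed
  define T where "T = Z^2"
  have T: "residue T = T0"
    by (simp add: T_def T0_def residue_simps Z)
  have ZT: "256 * T^3 * spec_s = (T - 1) * (T + 3)^3"
  proof -
    have "poly [:- 27, 0, 0, 0, 18, 0, 8 - 256 * spec_s, 0, 1:] Z = (T - 1) * (T + 3)^3 - 256 * T^3 * spec_s"
      unfolding T_def by (simp add: power_numeral_reduce algebra_simps)
    then show ?thesis
      using Z(2) by simp
  qed
  define FU where "FU = smult (16 * T^2) [:- T, 0, 1:] - smult spec_x ([:- 2 * T, 1 + T:] * [:T^2 - 9 * T, 8 * T, 1 - T:])"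
  have FU: "poly FU w = 16 * T^2 * (w^2 - T) - spec_x * ((w + w * T - 2 * T) * gessel_D T w)" for w
    unfolding FU_def gessel_D_def by (simp add: power_numeral_reduce algebra_simps)
  have "map_poly residue FU = smult (16 * T0^2) [:- T0, 0, 1:] - smult 242 ([:- 2 * T0, 1 + T0:] * [:T0^2 - 9 * T0, 8 * T0, 1 - T0:])"
    unfolding FU_def by (simp add: map_simps T smult_add_right)
  note FU0 = this
  obtain U where U: "residue U = u" "poly FU U = 0"
  proof (rule henselianD[OF henselian_residue])
    have "poly (map_poly residue FU) u = 16 * T0^2 * (u^2 - T0) - 242 * ((u + u * T0 - 2 * T0) * gessel_D T0 u)"
      unfolding FU0 gessel_D_def by (simp add: power_numeral_reduce algebra_simps)
    then show "poly (map_poly residue FU) u = 0"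
      using cond(3) by simp
    have "poly (pderiv (map_poly residue FU)) u =
      16 * T0^2 * (2 * u) - 242 * ((1 + T0) * gessel_D T0 u + (u + u * T0 - 2 * T0) * (2 * u + 8 * T0 - 2 * T0 * u))"
      unfolding FU0 gessel_D_def by (simp add: pderiv_pCons power_numeral_reduce algebra_simps)
    then show "poly (pderiv (map_poly residue FU)) u \<noteq> 0"
      using cond(4) by simp
  qed
  define FV where "FV = [:1 - T, 3 + T, - (spec_y * (3 + T)), - (spec_y * (1 - T)):]"
  have FV: "poly FV w = 1 - T + 3 * w + w * T - spec_y * (w^2 * (3 + w + T - w * T))" for w
    unfolding FV_def by (simp add: power_numeral_reduce algebra_simps)
  have FV0: "map_poly residue FV = [:1 - T0, 3 + T0, - (271 * (3 + T0)), - (271 * (1 - T0)):]"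
    unfolding FV_def by (simp add: map_simps T)
  obtain V where V: "residue V = v" "poly FV V = 0"
  proof (rule henselianD[OF henselian_residue])
    have "poly (map_poly residue FV) v = 1 - T0 + 3 * v + v * T0 - 271 * (v^2 * (3 + v + T0 - v * T0))"
      unfolding FV0 by (simp add: power_numeral_reduce algebra_simps)
    then show "poly (map_poly residue FV) v = 0"
      using cond(5) by simp
    have "poly (pderiv (map_poly residue FV)) v = 3 + T0 - 271 * (2 * v * (3 + v + T0 - v * T0) + v^2 * (1 - T0))"
      unfolding FV0 by (simp add: pderiv_pCons power_numeral_reduce algebra_simps)
    then show "poly (pderiv (map_poly residue FV)) v \<noteq> 0"
      using cond(6) by simp
  qed
  have curve: "gessel_curve spec_s spec_x spec_y Z U V"
    using ZT U(2) V(2) unfolding FU FV by (simp add: gessel_curve_def Let_def T_def)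
  define dS where "dS = (1 - T) * (T + 3)^3 * (U + Z) * gessel_D T U"
  define dR where "dR = (T - 1) * (T + 3)^3 * (1 + V)^2 * (1 + Z + V - V * Z)^2"
  define d0 where "d0 = (1 + Z) * (Z^2 + 3)^3"
  define nS where "nS = 16 * T * (U + U * T - 2 * T) * gessel_M T U Z"
  define nR where "nR = 16 * V * Z^3 * (3 + V + T - V * T) * gessel_N T V Z"
  define n0 where "n0 = 32 * Z^3 * (3 + 3 * Z - 3 * Z^2 + Z^3)"
  have res: "residue dS = (1 - T0) * (T0 + 3)^3 * (u + z) * gessel_D T0 u"
    "residue dR = (T0 - 1) * (T0 + 3)^3 * (1 + v)^2 * (1 + z + v - v * z)^2"
    "residue d0 = (1 + z) * (z^2 + 3)^3"
    "residue nS = 16 * T0 * (u + u * T0 - 2 * T0) * gessel_M T0 u z"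
    "residue nR = 16 * v * z^3 * (3 + v + T0 - v * T0) * gessel_N T0 v z"
    "residue n0 = 32 * z^3 * (3 + 3 * z - 3 * z^2 + z^3)"
    by (simp_all only: dS_def dR_def d0_def nS_def nR_def n0_def residue_simps residue_gessel T Z U V)
  obtain eS where eS: "eS * dS = 1"
    using henselian_inverse[OF henselian_residue] cond(10) unfolding res(1)[symmetric] by blast
  obtain eR where eR: "eR * dR = 1"
    using henselian_inverse[OF henselian_residue] cond(11) unfolding res(2)[symmetric] by blast
  obtain e0 where e0: "e0 * d0 = 1"
    using henselian_inverse[OF henselian_residue] cond(12) unfolding res(3)[symmetric] by blast
  define S where "S = nS * eS"
  define R where "R = nR * eR"
  define S0 where "S0 = n0 * e0"
  have SR: "S * dS = nS" "R * dR = nR" "S0 * d0 = n0"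
    unfolding S_def R_def S0_def by (simp_all add: mult.assoc eS eR e0)
  have "gessel_values Z U V S R S0"
    using SR unfolding gessel_values_def Let_def T_def dS_def dR_def d0_def nS_def nR_def n0_def by simp
  moreover have nz: "f \<noteq> 0" if "residue f \<noteq> 0" for f
    using that by (auto simp: residue_simps)
  have "gessel_nondegenerate Z U V"
    unfolding gessel_nondegenerate_def Let_def T_def[symmetric]
    by (intro conjI nz; simp only: residue_simps residue_gessel T Z U V) (use cond(7-12) in simp_all)
  moreover have "residue (S - S0 + (1 + spec_y) * R) = of_int A0"
  proof -
    have "(S - S0 + (1 + spec_y) * R) * (dS * dR * d0) =
      (S * dS) * dR * d0 + (1 + spec_y) * (R * dR) * dS * d0 - (S0 * d0) * dS * dR"
      by (simp add: algebra_simps)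
    from arg_cong[OF this[unfolded SR], of residue]
    have "residue (S - S0 + (1 + spec_y) * R) * (residue dS * residue dR * residue d0) =
      residue nS * residue dR * residue d0 + (1 + 271) * residue nR * residue dS * residue d0 - residue n0 * residue dS * residue dR"
      unfolding residue_simps residue_spec .
    also have "\<dots> = a * (residue dS * residue dR * residue d0)"
      using cond(13) unfolding res by simp
    finally show ?thesis
      using cond(10-12) unfolding res(1-3)[symmetric] zuva(4) by simp
  qed
  ultimately show ?thesis
    using curve Z(1) unfolding zuva(1) by blast
qed

section \<open>The curve of (Z, U, V) over a field of characteristic 0\<close>

lemma fin_ext_mono:
  assumes "fin_ext F E n" "n \<le> m"
  shows "fin_ext F E m"
proof -
  obtain b where b: "\<forall>x\<in>E. \<exists>c. (\<forall>i<n. c i \<in> F) \<and> x = (\<Sum>i<n. c i * b i)"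
    using assms(1) by (auto simp: fin_ext_def)
  have F: "subfield F"
    using assms(1) by (simp add: fin_ext_def)
  have "\<exists>c. (\<forall>i<m. c i \<in> F) \<and> x = (\<Sum>i<m. c i * b i)" if "x \<in> E" for x
  proof -
    from bspec[OF b that] obtain c where c: "\<forall>i<n. c i \<in> F" "x = (\<Sum>i<n. c i * b i)"
      by (elim exE conjE)
    have "(\<Sum>i<m. (if i < n then c i else 0) * b i) = (\<Sum>i<n. c i * b i)"
      using assms(2) by (intro sum.mono_neutral_cong_right) auto
    then show ?thesis
      using c subring_zero[OF subfield_imp_subring[OF F]]
      by (intro exI[of _ "\<lambda>i. if i < n then c i else 0"]) auto
  qed
  then show ?thesis
    using assms(1) unfolding fin_ext_def by blast
qed

lemma fin_ext_adjoin_le: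
  assumes "fin_ext F E n" "annihilates_over E v p" "degree p \<le> d"
  shows "\<exists>E'. fin_ext F E' (n * d) \<and> E \<subseteq> E' \<and> v \<in> E'"
  using fin_ext_adjoin[OF assms(1,2)] fin_ext_mono mult_le_mono2[OF assms(3), of n] by meson

text \<open>x and y are field elements and need not be variables: S stands for Q(xt, 0), and the
  choice x / t for x yields Q(x, 0).\<close>

locale gessel_field =
  fixes t x y Z U V S R S0 :: "'a::field_char_0"
  assumes curve: "gessel_curve (t^2) x y Z U V"
    and vals: "gessel_values Z U V S R S0"
    and nondegenerate: "gessel_nondegenerate Z U V"
    and x_nonzero: "x \<noteq> 0"
begin

abbreviation "T \<equiv> Z^2"

lemma T_eq: "256 * T^3 * t^2 = (T - 1) * (T + 3)^3"
  and U_eq: "16 * T^2 * (U^2 - T) = x * ((U + U * T - 2 * T) * gessel_D T U)"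
  and V_eq: "1 - T + 3 * V + V * T = y * (V^2 * (3 + V + T - V * T))"
  using curve by (simp_all add: gessel_curve_def Let_def)

lemma nonzero: "256 * T^3 \<noteq> 0" "(U + U * T - 2 * T) * gessel_D T U \<noteq> 0" "V^2 * (3 + V + T - V * T) \<noteq> 0"
    "(1 - T) * (T + 3)^3 * (U + Z) * gessel_D T U \<noteq> 0"
    "(T - 1) * (T + 3)^3 * (1 + V)^2 * (1 + Z + V - V * Z)^2 \<noteq> 0"
    "(1 + Z) * (Z^2 + 3)^3 \<noteq> 0"
  using nondegenerate unfolding gessel_nondegenerate_def Let_def by blast+

lemma T_nonzero: "Z \<noteq> 0" "1 - T \<noteq> 0"
  using nonzero(1,4) by auto

lemma adjoin_Z:
  assumes E: "fin_ext F E n" and "t \<in> E"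
  shows "\<exists>E'. fin_ext F E' (n * 8) \<and> E \<subseteq> E' \<and> Z \<in> E'"
proof (rule fin_ext_adjoin_le[OF E])
  have sub: "subring E"
    using E by (simp add: fin_ext_def)
  let ?p = "[:- 27, 0, 0, 0, 18, 0, 8 - 256 * t^2, 0, 1:]"
  have "poly ?p Z = (T - 1) * (T + 3)^3 - 256 * T^3 * t^2"
    by (simp add: power_numeral_reduce algebra_simps)
  then show "annihilates_over E Z ?p"
    using assms(2) T_eq unfolding annihilates_over_def
    by (auto intro!: subring_poly_pCons[OF sub] subring_intros[OF sub])
qed simp

lemma adjoin_U:
  assumes E: "fin_ext F E n" and "Z \<in> E" "x \<in> E"
  shows "\<exists>E'. fin_ext F E' (n * 3) \<and> E \<subseteq> E' \<and> U \<in> E'"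
proof (rule fin_ext_adjoin_le[OF E])
  have sub: "subring E"
    using E by (simp add: fin_ext_def)
  let ?p = "[:2 * T * x * (T^2 - 9 * T) - 16 * T^3, x * (16 * T^2 - (1 + T) * (T^2 - 9 * T)),
     16 * T^2 - x * (8 * T * (1 + T) - 2 * T * (1 - T)), - (x * (1 + T) * (1 - T)):]"
  have p: "poly ?p w = 16 * T^2 * (w^2 - T) - x * ((w + w * T - 2 * T) * gessel_D T w)" for w
    unfolding gessel_D_def by (simp add: power_numeral_reduce algebra_simps)
  \<comment> \<open>At w = Z the term with w^2 - T vanishes. This one value shows that the
    polynomial is nonzero.\<close>
  have "poly ?p Z = - (8 * x * Z^3 * (Z - 1)^3)"
    unfolding p gessel_D_def by (simp add: power_numeral_reduce algebra_simps)
  moreover have "Z - 1 \<noteq> 0"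
    using T_nonzero by auto
  ultimately have "poly ?p Z \<noteq> 0"
    using T_nonzero x_nonzero by simp
  then have "?p \<noteq> 0"
    by (metis poly_0)
  moreover have "poly ?p U = 0"
    using U_eq unfolding p by simp
  moreover have "coeff ?p i \<in> E" for i
    using assms(2,3) by (intro subring_poly_pCons[OF sub] subring_intros[OF sub]) (auto intro: subring_zero[OF sub])
  ultimately show "annihilates_over E U ?p"
    unfolding annihilates_over_def by blast
  show "degree ?p \<le> 3"
    by (simp add: degree_pCons_eq_if)
qed

lemma adjoin_V:
  assumes E: "fin_ext F E n" and "Z \<in> E" "y \<in> E"
  shows "\<exists>E'. fin_ext F E' (n * 3) \<and> E \<subseteq> E' \<and> V \<in> E'"
proof (rule fin_ext_adjoin_le[OF E])
  have sub: "subring E"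
    using E by (simp add: fin_ext_def)
  let ?p = "[:1 - T, 3 + T, - (y * (3 + T)), - (y * (1 - T)):]"
  have p: "poly ?p V = 1 - T + 3 * V + V * T - y * (V^2 * (3 + V + T - V * T))"
    by (simp add: power_numeral_reduce algebra_simps)
  have "?p \<noteq> 0"
    using T_nonzero by simp
  moreover have "poly ?p V = 0"
    unfolding p V_eq by simp
  moreover have "coeff ?p i \<in> E" for i
    using assms(2,3) by (intro subring_poly_pCons[OF sub] subring_intros[OF sub]) (auto intro: subring_zero[OF sub])
  ultimately show "annihilates_over E V ?p"
    unfolding annihilates_over_def by blast
  show "degree ?p \<le> 3"
    by (simp add: degree_pCons_eq_if)
qed

text \<open>The equations are linear in t^2, x, y, S, R and S0, so each of these is a rational
  function of Z, U, V. Only t itself is missing.\<close>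

lemma in_subfield:
  assumes E: "subfield E" and Z: "Z \<in> E"
  shows "t^2 \<in> E" "S0 \<in> E" "U \<in> E \<Longrightarrow> x \<in> E" "U \<in> E \<Longrightarrow> S \<in> E" "V \<in> E \<Longrightarrow> y \<in> E" "V \<in> E \<Longrightarrow> R \<in> E"
proof -
  note [intro] = subring_intros[OF subfield_imp_subring[OF E]] subfield_divide[OF E] Z
  have eq: "a = c / b" if "a * b = c" "b \<noteq> 0" for a b c :: 'a
    using that by auto
  have "t^2 = (T - 1) * (T + 3)^3 / (256 * T^3)"
    by (rule eq[OF _ nonzero(1)]) (simp add: T_eq[symmetric] mult_ac)
  also have "\<dots> \<in> E" by blast
  finally show "t^2 \<in> E" .
  have "S0 = 32 * Z^3 * (3 + 3 * Z - 3 * Z^2 + Z^3) / ((1 + Z) * (Z^2 + 3)^3)"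
    using vals unfolding gessel_values_def Let_def by (intro eq nonzero) blast
  also have "\<dots> \<in> E" by blast
  finally show "S0 \<in> E" .
  show "x \<in> E" if [intro]: "U \<in> E"
  proof -
    have "x = 16 * T^2 * (U^2 - T) / ((U + U * T - 2 * T) * gessel_D T U)"
      by (rule eq[OF U_eq[symmetric] nonzero(2)])
    also have "\<dots> \<in> E" unfolding gessel_D_def by blast
    finally show ?thesis .
  qed
  show "S \<in> E" if [intro]: "U \<in> E"
  proof -
    have "S = 16 * T * (U + U * T - 2 * T) * gessel_M T U Z / ((1 - T) * (T + 3)^3 * (U + Z) * gessel_D T U)"
      using vals unfolding gessel_values_def Let_def by (intro eq nonzero) blast
    also have "\<dots> \<in> E" unfolding gessel_D_def gessel_M_def by blast
    finally show ?thesis .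
  qed
  show "y \<in> E" if [intro]: "V \<in> E"
  proof -
    have "y = (1 - T + 3 * V + V * T) / (V^2 * (3 + V + T - V * T))"
      by (rule eq[OF V_eq[symmetric] nonzero(3)])
    also have "\<dots> \<in> E" by blast
    finally show ?thesis .
  qed
  show "R \<in> E" if [intro]: "V \<in> E"
  proof -
    have "R = 16 * V * Z^3 * (3 + V + T - V * T) * gessel_N T V Z / ((T - 1) * (T + 3)^3 * (1 + V)^2 * (1 + Z + V - V * Z)^2)"
      using vals unfolding gessel_values_def Let_def by (intro eq nonzero) blast
    also have "\<dots> \<in> E" unfolding gessel_N_def by blast
    finally show ?thesis .
  qed
qed

end

locale gessel_generic = gessel_field +
  assumes t_transcendental: "\<not> annihilates_over (subfield_generated {}) t p"
    and x_transcendental: "\<not> annihilates_over (subfield_generated {t}) x p"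
    and y_transcendental: "\<not> annihilates_over (subfield_generated {t, x}) y p"
begin

lemma generated_subset: "fin_ext (subfield_generated A) E n \<Longrightarrow> a \<in> A \<Longrightarrow> a \<in> E"
  by (auto simp: fin_ext_def intro: subfield_generated.base)

text \<open>If Z were algebraic over \<rat>, then so would be t^2 and t. In the same way U over
  \<rat>(Z) is traced back to x, and V over \<rat>(Z, U) to y, because x and y are rational in Z, U,
  V.\<close>

lemma Z_transcendental: "\<not> annihilates_over (subfield_generated {}) Z p"
proof
  let ?F = "subfield_generated {} :: 'a set"
  assume "annihilates_over ?F Z p"
  then obtain E n where E: "fin_ext ?F E n" "Z \<in> E"
    using fin_ext_adjoin[OF fin_ext_refl[OF subfield_subfield_generated]] by blast
  have "t^2 \<in> E"
    using in_subfield(1)[OF fin_ext_subfield[OF E(1)] E(2)] .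
  moreover have sub: "subring E"
    using E by (simp add: fin_ext_def)
  ultimately have "annihilates_over E t [:- (t^2), 0, 1:]"
    unfolding annihilates_over_def
    by (auto intro!: subring_poly_pCons[OF sub] subring_intros[OF sub] simp: power2_eq_square)
  then obtain E' m where "fin_ext ?F E' m" "t \<in> E'"
    using fin_ext_adjoin[OF E(1)] by blast
  then show False
    using fin_ext_annihilator t_transcendental by blast
qed

lemma U_transcendental: "\<not> annihilates_over (subfield_generated {Z}) U p"
proof
  let ?F = "subfield_generated {t}"
  assume p: "annihilates_over (subfield_generated {Z}) U p"
  have F: "fin_ext ?F ?F 1"
    by (rule fin_ext_refl[OF subfield_subfield_generated])
  obtain E n where E: "fin_ext ?F E n" "Z \<in> E"
    using adjoin_Z[OF F generated_subset[OF F]] by blast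
  have "subfield_generated {Z} \<subseteq> E"
    using E(2) by (intro subfield_generated_subset fin_ext_subfield[OF E(1)]) simp
  then obtain E' m where E': "fin_ext ?F E' m" "E \<subseteq> E'" "U \<in> E'"
    using fin_ext_adjoin[OF E(1) annihilates_over_mono[OF _ p]] by blast
  then have "x \<in> E'"
    using in_subfield(3)[OF fin_ext_subfield[OF E'(1)]] E(2) by blast
  then show False
    using fin_ext_annihilator[OF E'(1)] x_transcendental by blast
qed

lemma V_transcendental: "\<not> annihilates_over (subfield_generated {Z, U}) V p"
proof
  let ?F = "subfield_generated {t, x}"
  assume p: "annihilates_over (subfield_generated {Z, U}) V p"
  have F: "fin_ext ?F ?F 1"
    by (rule fin_ext_refl[OF subfield_subfield_generated])
  obtain E n where E: "fin_ext ?F E n" "Z \<in> E"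
    using adjoin_Z[OF F generated_subset[OF F]] by blast
  obtain E1 n1 where E1: "fin_ext ?F E1 n1" "E \<subseteq> E1" "U \<in> E1"
    using adjoin_U[OF E(1,2) generated_subset[OF E(1)]] by blast
  have "subfield_generated {Z, U} \<subseteq> E1"
    using E(2) E1 by (intro subfield_generated_subset fin_ext_subfield[OF E1(1)]) auto
  then obtain E' m where E': "fin_ext ?F E' m" "E1 \<subseteq> E'" "V \<in> E'"
    using fin_ext_adjoin[OF E1(1) annihilates_over_mono[OF _ p]] by blast
  then have "y \<in> E'"
    using in_subfield(5)[OF fin_ext_subfield[OF E'(1)]] E(2) E1(2) by blast
  then show False
    using fin_ext_annihilator[OF E'(1)] y_transcendental by blast
qed

lemma ev1_inj: "ev1 Z p = 0 \<Longrightarrow> p = 0"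
proof (rule ccontr)
  assume "ev1 Z p = 0" "p \<noteq> 0"
  then have "annihilates_over (subfield_generated {}) Z (map_poly of_int p)"
    by (auto simp: annihilates_over_def ev1_def poly_eq_iff coeff_map_poly
        intro!: subring_of_int subfield_imp_subring subfield_subfield_generated)
  then show False
    using Z_transcendental by blast
qed

lemma ev2_inj: "ev2 Z U p = 0 \<Longrightarrow> p = 0"
proof (rule ccontr)
  assume p: "ev2 Z U p = 0" "p \<noteq> 0"
  then obtain i where "coeff p i \<noteq> 0"
    by (auto simp: poly_eq_iff)
  then have "coeff (map_poly (ev1 Z) p) i \<noteq> 0"
    using ev1_inj by (auto simp: coeff_map_poly ev1_0)
  then have "map_poly (ev1 Z) p \<noteq> 0"
    by (metis coeff_0)
  moreover have "ev1 Z q \<in> subfield_generated {Z}" for q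
    by (intro ev1_in_subring subfield_imp_subring subfield_subfield_generated subfield_generated.base) simp
  ultimately have "annihilates_over (subfield_generated {Z}) U (map_poly (ev1 Z) p)"
    using p by (auto simp: annihilates_over_def ev2_def coeff_map_poly ev1_0)
  then show False
    using U_transcendental by blast
qed

text \<open>Z, U, V are algebraically independent, so specialization of elements of \<rat>(Z, U, V)
  is well defined.\<close>

lemma ev3_inj: "ev3 Z U V p = 0 \<Longrightarrow> p = 0"
proof (rule ccontr)
  assume p: "ev3 Z U V p = 0" "p \<noteq> 0"
  then obtain i where "coeff p i \<noteq> 0"
    by (auto simp: poly_eq_iff)
  then have "coeff (map_poly (ev2 Z U) p) i \<noteq> 0"
    using ev2_inj by (auto simp: coeff_map_poly ev2_0)
  then have "map_poly (ev2 Z U) p \<noteq> 0"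
    by (metis coeff_0)
  moreover have "ev2 Z U q \<in> subfield_generated {Z, U}" for q
    by (intro ev2_in_subring subfield_imp_subring subfield_subfield_generated subfield_generated.base) simp_all
  ultimately have "annihilates_over (subfield_generated {Z, U}) V (map_poly (ev2 Z U) p)"
    using p by (auto simp: annihilates_over_def ev3_def coeff_map_poly ev2_0)
  then show False
    using V_transcendental by blast
qed

text \<open>Because \<open>t\<^sup>2\<close> is a rational function of \<open>Z\<close> with a simple zero at \<open>Z = 1\<close>.\<close>

lemma t_notin: "t \<notin> subfield_generated {Z, U, V}"
proof
  assume "t \<in> subfield_generated {Z, U, V}"
  then obtain N D where ND: "ev3 Z U V D \<noteq> 0" "t = ev3 Z U V N / ev3 Z U V D"
    using subfield_generated_fraction subring_generated_ev3 by metis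
  define X :: "int poly" where "X = [:0, 1:]"
  define p q where pq: "p = (X^2 - 1) * (X^2 + 3)^3" "q = 256 * X^6"
  have const: "ring_morph (\<lambda>p :: int poly. [:[:p:]:])"
    by (intro ring_morphI) (simp_all add: one_pCons)
  have ev_const: "ev3 Z U V [:[:p:]:] = ev1 Z p" for p
    by (simp add: ev3_pCons ev3_0 ev2_pCons ev2_0)
  have ev1_X: "ev1 Z X = Z"
    by (simp add: X_def ev1_pCons ev1_0 ring_morph_1[OF ring_morph_ev1])
  have "(T - 1) * (T + 3)^3 * ev3 Z U V D^2 = 256 * T^3 * ev3 Z U V N^2"
    using ND unfolding T_eq[symmetric] by (simp add: power_divide)
  moreover have "ev3 Z U V ([:[:p:]:] * D^2 - [:[:q:]:] * N^2) = ev1 Z p * ev3 Z U V D^2 - ev1 Z q * ev3 Z U V N^2"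
    by (simp only: ev3_simps ev_const)
  moreover have "ev1 Z p = (T - 1) * (T + 3)^3" "ev1 Z q = 256 * T^3"
    by (simp_all add: pq ring_morph_simps[OF ring_morph_ev1] ev1_X)
  ultimately have "ev3 Z U V ([:[:p:]:] * D^2 - [:[:q:]:] * N^2) = 0"
    by simp
  then have eq: "[:[:p:]:] * D^2 = [:[:q:]:] * N^2"
    using ev3_inj by fastforce
  \<comment> \<open>Leading coefficients with respect to V and U turn the identity into p d^2 = q
    n^2 in \<int>[Z]. At Z = 1 the left side has odd order, as p has a simple zero there, and the
    right side has even order.\<close>
  define n d where "n = lead_coeff (lead_coeff N)" and "d = lead_coeff (lead_coeff D)"
  have lc: "lead_coeff (lead_coeff ([:[:p:]:] * P^2)) = p * lead_coeff (lead_coeff P)^2" for p :: "int poly" and P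
    by (simp add: lead_coeff_mult lead_coeff_power lead_coeff_smult)
  have pq_eq: "p * d^2 = q * n^2"
    using arg_cong[OF eq, of "\<lambda>P. lead_coeff (lead_coeff P)"] unfolding lc n_def d_def .
  have d: "d \<noteq> 0"
    using ND(1) by (auto simp: d_def ev3_0)
  have p_eq: "p = [:- 1, 1:]^1 * ([:1, 1:] * (X^2 + 3)^3)"
  proof -
    have e: "[:- 1, 1:] = X - 1" "[:1, 1:] = X + 1"
      by (simp_all add: X_def one_pCons)
    show ?thesis
      unfolding pq(1) e by (simp add: algebra_simps power2_eq_square)
  qed
  have p1: "poly ([:1, 1:] * (X^2 + 3)^3) 1 \<noteq> 0" and q1: "poly q 1 \<noteq> 0"
    by (simp_all add: X_def pq)
  have pq0: "p \<noteq> 0" "q \<noteq> 0"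
  proof -
    have "[:1, 1:] * (X^2 + 3)^3 \<noteq> 0"
      using p1 by (metis poly_0)
    moreover have "[:- 1, 1:]^1 \<noteq> (0 :: int poly)"
      by simp
    ultimately show "p \<noteq> 0"
      unfolding p_eq using no_zero_divisors by blast
    show "q \<noteq> 0"
      using q1 by (metis poly_0)
  qed
  then have n: "n \<noteq> 0"
    using pq_eq d by auto
  have "order 1 p = 1 + 0"
    unfolding p_eq using pq0(1)[unfolded p_eq] order_0I[OF p1] order_power_n_n[of 1 1]
    by (subst order_mult) simp_all
  moreover have "order 1 q = 0"
    using q1 by (rule order_0I)
  moreover have "order 1 (r^2) = 2 * order 1 r" if "r \<noteq> 0" for r :: "int poly"
    using that by (simp add: power2_eq_square order_mult)
  moreover have "order 1 (p * d^2) = order 1 p + order 1 (d^2)" "order 1 (q * n^2) = order 1 q + order 1 (n^2)"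
    using pq0 n d by (simp_all add: order_mult)
  ultimately have "1 + 2 * order 1 d = 2 * order 1 n"
    using pq_eq n d by simp
  then show False
    by presburger
qed

text \<open>t^2 can be specialized and t cannot. The two parts collect the even and the odd powers
  of t.\<close>

lemma subring_generated_even_odd:
  assumes "w \<in> subring_generated {t, x, y}"
  shows "\<exists>G H. w = ev3 (t^2) x y G + t * ev3 (t^2) x y H"
  using assms
proof induction
  case (base s)
  have "t = ev3 (t^2) x y 0 + t * ev3 (t^2) x y 1"
    by (simp add: ev3_simps)
  moreover have "x = ev3 (t^2) x y [:[:0, 1:]:] + t * ev3 (t^2) x y 0" "y = ev3 (t^2) x y [:0, 1:] + t * ev3 (t^2) x y 0"
    by (simp_all add: ev3_vars ev3_0)
  ultimately show ?case
    using base by (metis insertE singletonD)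
next
  case one
  have "1 = ev3 (t^2) x y 1 + t * ev3 (t^2) x y 0"
    by (simp add: ev3_simps)
  then show ?case
    by blast
next
  case (diff u v)
  then obtain G H G' H' where "u = ev3 (t^2) x y G + t * ev3 (t^2) x y H" "v = ev3 (t^2) x y G' + t * ev3 (t^2) x y H'"
    by blast
  then have "u - v = ev3 (t^2) x y (G - G') + t * ev3 (t^2) x y (H - H')"
    by (simp add: ev3_simps algebra_simps)
  then show ?case
    by blast
next
  case (mult u v)
  then obtain G H G' H' where "u = ev3 (t^2) x y G + t * ev3 (t^2) x y H" "v = ev3 (t^2) x y G' + t * ev3 (t^2) x y H'"
    by blast
  then have "u * v = ev3 (t^2) x y (G * G' + [:[:[:0, 1:]:]:] * H * H') + t * ev3 (t^2) x y (G * H' + H * G')"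
    by (simp only: ev3_simps ev3_vars) (simp add: algebra_simps power2_eq_square)
  then show ?case
    by blast
qed

end

text \<open>The highest common power of 277 is taken out, since otherwise the reduced relation could
  be zero. It exists because \<open>G i0\<close> is nonzero and 277 is not a unit.\<close>

lemma primitive_family:
  fixes G :: "nat \<Rightarrow> int poly poly poly"
  assumes "i0 \<le> n" "G i0 \<noteq> 0"
  shows "\<exists>G' N. (\<forall>i\<le>n. G i = [:[:[:277:]:]:]^N * G' i) \<and> (\<exists>i\<le>n. \<not> [:[:[:277:]:]:] dvd G' i)"
proof -
  let ?q = "[:[:[:277:]:]:] :: int poly poly poly"
  have q_unit: "\<not> is_unit ?q"
    by (simp add: is_unit_const_poly_iff)
  define A where "A = {N. \<forall>i\<le>n. ?q^N dvd G i}"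
  have "A \<subseteq> {N. ?q^N dvd G i0}"
    using assms(1) by (auto simp: A_def)
  then have fin: "finite A"
    using finite_divisor_powers[OF assms(2) q_unit] by (rule finite_subset)
  have "0 \<in> A"
    by (simp add: A_def)
  define N where "N = Max A"
  have N: "N \<in> A" "Suc N \<notin> A"
    using Max_in[OF fin] Max_ge[OF fin, of "Suc N"] \<open>0 \<in> A\<close> unfolding N_def by auto
  have "\<forall>i. \<exists>g. i \<le> n \<longrightarrow> G i = ?q^N * g"
    using N(1) by (auto simp: A_def elim: dvdE)
  then obtain G' where G': "\<And>i. i \<le> n \<Longrightarrow> G i = ?q^N * G' i"
    by metis
  have "\<exists>i\<le>n. \<not> ?q dvd G' i"
  proof (rule ccontr)
    assume "\<not> (\<exists>i\<le>n. \<not> ?q dvd G' i)"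
    then have "?q ^ N * ?q dvd G i" if "i \<le> n" for i
      using that unfolding G'[OF that] by (intro mult_dvd_mono) auto
    then have "Suc N \<in> A"
      by (auto simp: A_def mult.commute)
    with N(2) show False
      by blast
  qed
  with G' show ?thesis
    by blast
qed

lemma specialization_gessel:
  fixes a b c u v w :: "'a::idom"
  assumes "specialization a b c a' b' c' u u'" "specialization a b c a' b' c' v v'"
  shows "specialization a b c a' b' c' (gessel_D u v) (gessel_D u' v')"
    and "specialization a b c a' b' c' w w' \<Longrightarrow>
      specialization a b c a' b' c' (gessel_M u v w) (gessel_M u' v' w')"
    and "specialization a b c a' b' c' w w' \<Longrightarrow>
      specialization a b c a' b' c' (gessel_N u v w) (gessel_N u' v' w')"
  unfolding gessel_M_def gessel_N_def gessel_D_def by (intro sp_intros assms | assumption)+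

text \<open>Pairs of Z and the value of Q(0, 0) there. Each Z is looked up in
  \<open>spec_points\<close>, because lifting takes a whole point (Z, U, V).\<close>

definition spec_values :: "(int \<times> int) list" where
  "spec_values = [(18, 60), (39, 116), (43, 240), (98, 241), (179, 232), (234, 233), (238, 80), (259, 136)]"

lemma spec_values: "list_all (\<lambda>(Z0, a). 0 \<le> a \<and> a < 277 \<and> list_ex (\<lambda>(Z, U, V, A). Z = Z0) spec_points \<and>
      (a * ((1 + Z0) * (Z0^2 + 3)^3) - 32 * Z0^3 * (3 + 3 * Z0 - 3 * Z0^2 + Z0^3)) mod 277 = 0 \<and>
      ((1 + Z0) * (Z0^2 + 3)^3) mod 277 \<noteq> 0) spec_values"
  by code_simp

context gessel_generic
begin

text \<open>Both sides satisfy the same linear equations for these elements, and the coefficients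
  that have to be divided by are nonzero at the special point.\<close>

lemma specialization_curve:
  assumes "gessel_curve s' x' y' Z' U' V'" "gessel_nondegenerate Z' U' V'" "gessel_values Z' U' V' S' R' S0'"
  shows "specialization Z U V Z' U' V' (t^2) s'" "specialization Z U V Z' U' V' x x'" "specialization Z U V Z' U' V' y y'"
    "specialization Z U V Z' U' V' S S'" "specialization Z U V Z' U' V' R R'" "specialization Z U V Z' U' V' S0 S0'"
proof -
  note nd = assms(2)[unfolded gessel_nondegenerate_def Let_def]
  note cv = assms(1)[unfolded gessel_curve_def Let_def]
  note va = assms(3)[unfolded gessel_values_def Let_def]
  note va' = vals[unfolded gessel_values_def Let_def]
  note c2 = conjunct2
  show "specialization Z U V Z' U' V' (t^2) s'"
    by (rule sp_div[OF trans[OF mult.commute T_eq] trans[OF mult.commute cv[THEN conjunct1]] _ _ nd[THEN conjunct1]])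
      (intro sp_intros)+
  show "specialization Z U V Z' U' V' x x'"
    by (rule sp_div[OF U_eq[symmetric] cv[THEN c2, THEN conjunct1, symmetric] _ _ nd[THEN c2, THEN conjunct1]])
      (intro sp_intros specialization_gessel)+
  show "specialization Z U V Z' U' V' y y'"
    by (rule sp_div[OF V_eq[symmetric] cv[THEN c2, THEN c2, symmetric] _ _ nd[THEN c2, THEN c2, THEN conjunct1]])
      (intro sp_intros specialization_gessel)+
  show "specialization Z U V Z' U' V' S S'"
    by (rule sp_div[OF va'[THEN conjunct1] va[THEN conjunct1] _ _ nd[THEN c2, THEN c2, THEN c2, THEN conjunct1]])
      (intro sp_intros specialization_gessel)+
  show "specialization Z U V Z' U' V' R R'"
    by (rule sp_div[OF va'[THEN c2, THEN conjunct1] va[THEN c2, THEN conjunct1] _ _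
          nd[THEN c2, THEN c2, THEN c2, THEN c2, THEN conjunct1]])
      (intro sp_intros specialization_gessel)+
  show "specialization Z U V Z' U' V' S0 S0'"
    by (rule sp_div[OF va'[THEN c2, THEN c2] va[THEN c2, THEN c2] _ _ nd[THEN c2, THEN c2, THEN c2, THEN c2, THEN c2]])
      (intro sp_intros specialization_gessel)+
qed

text \<open>A relation for A is cleared of denominators, split by the parity in t, made primitive at
  277 and moved to the generic point over the prime field. It becomes a nonzero polynomial of no
  larger degree that vanishes on W.\<close>

lemma degree_lower_bound:
  assumes r: "annihilates_over (subfield_generated {t, x, y}) A r" and A: "A \<in> subfield_generated {Z, U, V}"
    and vals: "finite W" "\<And>a. a \<in> W \<Longrightarrow> \<exists>Z' U' V' S' R' S0'. gessel_curve spec_s spec_x spec_y Z' U' V' \<and>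
      gessel_nondegenerate Z' U' V' \<and> gessel_values Z' U' V' S' R' S0' \<and> specialization Z U V Z' U' V' A a"
  shows "card W \<le> degree r"
proof -
  let ?E = "ev3 (t^2) x y"
  obtain p where p: "degree p = degree r" "p \<noteq> 0" "\<And>i. coeff p i \<in> subring_generated {t, x, y}" "poly p A = 0"
    using annihilates_over_clear[OF r] by blast
  let ?n = "degree r"
  have "\<forall>i. \<exists>G H. coeff p i = ?E G + t * ?E H"
    using subring_generated_even_odd[OF p(3)] by blast
  then obtain G H where GH: "\<And>i. coeff p i = ?E (G i) + t * ?E (H i)"
    by metis
  define \<alpha> where "\<alpha> = (\<Sum>i\<le>?n. ?E (G i) * A ^ i)"
  define \<beta> where "\<beta> = (\<Sum>i\<le>?n. ?E (H i) * A ^ i)"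
  have "0 = (\<Sum>i\<le>?n. coeff p i * A ^ i)"
    using p(4) by (simp add: poly_altdef p(1))
  also have "\<dots> = \<alpha> + t * \<beta>"
    by (simp add: \<alpha>_def \<beta>_def GH sum.distrib sum_distrib_left algebra_simps)
  finally have ab: "\<alpha> + t * \<beta> = 0"
    by simp
  let ?L = "subfield_generated {Z, U, V}"
  have L: "subfield ?L"
    by (rule subfield_subfield_generated)
  have ZUV: "Z \<in> ?L" "U \<in> ?L" "V \<in> ?L"
    by (auto intro: subfield_generated.base)
  have "?E K \<in> ?L" for K
    using in_subfield(1,3,5)[OF L ZUV(1)] ZUV by (intro ev3_in_subring subfield_imp_subring L)
  then have "\<alpha> \<in> ?L" "\<beta> \<in> ?L"
    unfolding \<alpha>_def \<beta>_def using A
    by (auto intro!: subring_sum subring_mult subring_power subfield_imp_subring[OF L])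
  have "\<beta> = 0"
  proof (rule ccontr)
    assume "\<beta> \<noteq> 0"
    then have "t = - \<alpha> / \<beta>"
      using ab by (simp add: field_simps eq_neg_iff_add_eq_0)
    also have "\<dots> \<in> ?L"
      using \<open>\<alpha> \<in> ?L\<close> \<open>\<beta> \<in> ?L\<close> by (intro subfield_divide[OF L] subring_uminus[OF subfield_imp_subring[OF L]])
    finally show False
      using t_notin by blast
  qed
  with ab have "\<alpha> = 0"
    by simp
  have "coeff p ?n \<noteq> 0"
    using p(1,2) by (metis leading_coeff_0_iff)
  then have "G ?n \<noteq> 0 \<or> H ?n \<noteq> 0"
    unfolding GH by (auto simp: ev3_0)
  \<comment> \<open>One of the two parts contains the leading coefficient and is a nontrivial
    relation over \<int>[t^2, x, y].\<close>
  then obtain K where K: "K ?n \<noteq> 0" "(\<Sum>i\<le>?n. ?E (K i) * A ^ i) = 0"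
    using \<open>\<alpha> = 0\<close> \<open>\<beta> = 0\<close> unfolding \<alpha>_def \<beta>_def by blast
  obtain K' N where K': "\<And>i. i \<le> ?n \<Longrightarrow> K i = [:[:[:277:]:]:]^N * K' i" "\<exists>i\<le>?n. \<not> [:[:[:277:]:]:] dvd K' i"
    using primitive_family[of ?n ?n K] K(1) by blast
  have q: "?E [:[:[:277:]:]:] = 277"
    by (simp add: ev3_pCons ev3_0 ev2_pCons ev2_0 ev1_pCons ev1_0)
  have "0 = (\<Sum>i\<le>?n. 277 ^ N * (?E (K' i) * A ^ i))"
    unfolding K(2)[symmetric] using K'(1) by (intro sum.cong refl) (simp add: ev3_simps q)
  then have K'_sum: "(\<Sum>i\<le>?n. ?E (K' i) * A ^ i) = 0"
    by (simp flip: sum_distrib_left)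
  define P where "P = (\<Sum>i\<le>?n. monom (ev3 spec_s spec_x spec_y (K' i)) i)"
  have P_coeff: "coeff P i = (if i \<le> ?n then ev3 spec_s spec_x spec_y (K' i) else 0)" for i
    by (simp add: P_def coeff_sum)
  \<comment> \<open>Some coefficient is not divisible by 277, and such a coefficient does not vanish
    at the generic point.\<close>
  have "P \<noteq> 0"
  proof -
    obtain i where "i \<le> ?n" "\<not> [:[:[:277:]:]:] dvd K' i"
      using K'(2) by blast
    then have "coeff P i \<noteq> 0"
      using ev3_spec_eq_0 by (auto simp: P_coeff)
    then show ?thesis
      by auto
  qed
  have "poly P a = 0" if "a \<in> W" for a
  proof -
    obtain Z' U' V' S' R' S0' where
      1: "gessel_curve spec_s spec_x spec_y Z' U' V'" "gessel_nondegenerate Z' U' V'" "gessel_values Z' U' V' S' R' S0'"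
      and sp: "specialization Z U V Z' U' V' A a"
      using vals(2)[OF \<open>a \<in> W\<close>] by blast
    have "specialization Z U V Z' U' V' (\<Sum>i\<le>?n. ?E (K' i) * A ^ i) (\<Sum>i\<le>?n. ev3 spec_s spec_x spec_y (K' i) * a ^ i)"
      by (intro sp_sum sp_mult sp_power sp_ev3 sp specialization_curve[OF 1])
    from this[unfolded K'_sum] have "(\<Sum>i\<le>?n. ev3 spec_s spec_x spec_y (K' i) * a ^ i) = 0"
      by (rule sp_functional[rotated]) (rule ev3_inj)
    then show ?thesis
      by (simp add: P_def poly_sum poly_monom)
  qed
  then have "W \<subseteq> {a. poly P a = 0}"
    by blast
  then have "card W \<le> card {a. poly P a = 0}"
    by (intro card_mono poly_roots_finite[OF \<open>P \<noteq> 0\<close>])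
  also have "\<dots> \<le> degree P"
    using \<open>P \<noteq> 0\<close> by (rule card_poly_roots_bound)
  also have "\<dots> \<le> ?n"
    by (rule degree_le) (simp add: P_coeff)
  finally show ?thesis .
qed

text \<open>Different integers between 0 and 276 differ modulo 277, so their lifts differ as
  well.\<close>

lemma distinct_residues:
  assumes "distinct xs" "\<And>a. a \<in> set xs \<Longrightarrow> 0 \<le> a \<and> a < (277::int)"
    and "\<And>a. a \<in> set xs \<Longrightarrow> \<exists>w. residue w = of_int a \<and> P w"
  shows "\<exists>W. finite W \<and> card W = length xs \<and> (\<forall>w\<in>W. P w)"
proof -
  obtain f where f: "\<And>a. a \<in> set xs \<Longrightarrow> residue (f a) = of_int a \<and> P (f a)"
    using assms(3) by metis
  have "inj_on f (set xs)"
  proof (rule inj_onI)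
    fix a b assume ab: "a \<in> set xs" "b \<in> set xs" "f a = f b"
    then have "(of_int a :: gf) = of_int b"
      using f by metis
    then have "(of_int (a - b) :: gf) = 0"
      by simp
    then have "277 dvd a - b"
      unfolding gf_of_int_eq_0_iff by (simp add: dvd_eq_mod_eq_0)
    moreover have "\<bar>a - b\<bar> < 277"
      using assms(2)[OF ab(1)] assms(2)[OF ab(2)] by auto
    ultimately show "a = b"
      using dvd_imp_le_int[of "a - b" 277] by fastforce
  qed
  then show ?thesis
    using f assms(1) by (intro exI[of _ "f ` set xs"]) (auto simp: card_image distinct_card)
qed

lemma degree_A:
  assumes "annihilates_over (subfield_generated {t, x, y}) (S - S0 + (1 + y) * R) r"
  shows "72 \<le> degree r"
proof -
  let ?P = "\<lambda>a. \<exists>Z' U' V' S' R' S0'. gessel_curve spec_s spec_x spec_y Z' U' V' \<and>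
      gessel_nondegenerate Z' U' V' \<and> gessel_values Z' U' V' S' R' S0' \<and>
      specialization Z U V Z' U' V' (S - S0 + (1 + y) * R) a"
  have "\<exists>W. finite W \<and> card W = length (map (\<lambda>(Z, U, V, A). A) spec_points) \<and> (\<forall>w\<in>W. ?P w)"
  proof (rule distinct_residues)
    fix a assume "a \<in> set (map (\<lambda>(Z, U, V, A). A) spec_points)"
    then obtain Z0 U0 V0 where p: "(Z0, U0, V0, a) \<in> set spec_points"
      by auto
    show "0 \<le> a \<and> a < 277"
      using spec_points_distinct(3) p by (force simp: list_all_iff)
    have "spec_point (Z0^2) Z0 U0 V0 a"
      using spec_points p by (force simp: list_all_iff)
    from spec_point_lift[OF this] obtain Z' U' V' S' R' S0' where
      1: "gessel_curve spec_s spec_x spec_y Z' U' V'" "gessel_values Z' U' V' S' R' S0'" "gessel_nondegenerate Z' U' V'"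
      "residue (S' - S0' + (1 + spec_y) * R') = of_int a"
      by blast
    have "specialization Z U V Z' U' V' (S - S0 + (1 + y) * R) (S' - S0' + (1 + spec_y) * R')"
      by (intro sp_intros specialization_curve[OF 1(1,3,2)])
    with 1 show "\<exists>w. residue w = of_int a \<and> ?P w"
      by blast
  qed (rule spec_points_distinct)
  then obtain W where W: "finite W" "card W = 72" "\<forall>w\<in>W. ?P w"
    by (auto simp: spec_points_distinct(2))
  have L: "subfield (subfield_generated {Z, U, V})"
    by (rule subfield_subfield_generated)
  have ZUV: "Z \<in> subfield_generated {Z, U, V}" "U \<in> subfield_generated {Z, U, V}" "V \<in> subfield_generated {Z, U, V}"
    by (auto intro: subfield_generated.base)
  have "S - S0 + (1 + y) * R \<in> subfield_generated {Z, U, V}"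
    using in_subfield(2,4-6)[OF L ZUV(1)] ZUV by (intro subring_intros[OF subfield_imp_subring[OF L]])
  from degree_lower_bound[OF assms this W(1)] W(2,3) show ?thesis
    by simp
qed

lemma degree_S0:
  assumes "annihilates_over (subfield_generated {t, x, y}) S0 r"
  shows "8 \<le> degree r"
proof -
  let ?P = "\<lambda>a. \<exists>Z' U' V' S' R' S0'. gessel_curve spec_s spec_x spec_y Z' U' V' \<and>
      gessel_nondegenerate Z' U' V' \<and> gessel_values Z' U' V' S' R' S0' \<and> specialization Z U V Z' U' V' S0 a"
  have "\<exists>W. finite W \<and> card W = length (map snd spec_values) \<and> (\<forall>w\<in>W. ?P w)"
  proof (rule distinct_residues)
    fix a assume "a \<in> set (map snd spec_values)"
    then obtain Z0 where p: "(Z0, a) \<in> set spec_values"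
      by auto
    from bspec[OF spec_values[unfolded list_all_iff] p] have "0 \<le> a \<and> a < 277 \<and> list_ex (\<lambda>(Z, U, V, A). Z = Z0) spec_points \<and>
      (a * ((1 + Z0) * (Z0^2 + 3)^3) - 32 * Z0^3 * (3 + 3 * Z0 - 3 * Z0^2 + Z0^3)) mod 277 = 0 \<and>
      ((1 + Z0) * (Z0^2 + 3)^3) mod 277 \<noteq> 0"
      unfolding prod.case .
    note c = this
    have a: "0 \<le> a \<and> a < 277" and Z0: "list_ex (\<lambda>(Z, U, V, A). Z = Z0) spec_points"
      and val: "(a * ((1 + Z0) * (Z0^2 + 3)^3) - 32 * Z0^3 * (3 + 3 * Z0 - 3 * Z0^2 + Z0^3)) mod 277 = 0"
      and nz: "((1 + Z0) * (Z0^2 + 3)^3) mod 277 \<noteq> 0"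
      using conjI[OF c[THEN conjunct1] c[THEN conjunct2, THEN conjunct1]] c[THEN conjunct2, THEN conjunct2, THEN conjunct1]
        c[THEN conjunct2, THEN conjunct2, THEN conjunct2, THEN conjunct1]
        c[THEN conjunct2, THEN conjunct2, THEN conjunct2, THEN conjunct2]
      by - assumption+
    from a show "0 \<le> a \<and> a < 277" .
    obtain U0 V0 A0 where "(Z0, U0, V0, A0) \<in> set spec_points"
      using Z0 by (auto simp: list_ex_iff)
    then have "spec_point (Z0^2) Z0 U0 V0 A0"
      using spec_points by (force simp: list_all_iff)
    from spec_point_lift[OF this] obtain Z' U' V' S' R' S0' where
      1: "gessel_curve spec_s spec_x spec_y Z' U' V'" "gessel_values Z' U' V' S' R' S0'" "gessel_nondegenerate Z' U' V'"
      "residue Z' = of_int Z0"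
      by blast
    have "S0' * ((1 + Z') * (Z'^2 + 3)^3) = 32 * Z'^3 * (3 + 3 * Z' - 3 * Z'^2 + Z'^3)"
      using 1(2) by (simp add: gessel_values_def Let_def)
    from arg_cong[OF this, of residue]
    have "residue S0' * of_int ((1 + Z0) * (Z0^2 + 3)^3) = of_int (32 * Z0^3 * (3 + 3 * Z0 - 3 * Z0^2 + Z0^3))"
      by (simp add: residue_simps 1(4))
    also have "\<dots> = of_int a * of_int ((1 + Z0) * (Z0^2 + 3)^3)"
    proof -
      have "(of_int (a * ((1 + Z0) * (Z0^2 + 3)^3) - 32 * Z0^3 * (3 + 3 * Z0 - 3 * Z0^2 + Z0^3)) :: gf) = 0"
        unfolding gf_of_int_eq_0_iff by (rule val)
      then show ?thesis
        unfolding of_int_diff of_int_mult[of a] by (simp only: right_minus_eq)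
    qed
    finally have "residue S0' = of_int a"
      using nz unfolding gf_of_int_eq_0_iff[symmetric] by (metis mult_right_cancel)
    moreover have "specialization Z U V Z' U' V' S0 S0'"
      by (rule specialization_curve[OF 1(1,3,2)])
    ultimately show "\<exists>w. residue w = of_int a \<and> ?P w"
      using 1 by blast
  qed (simp add: spec_values_def)
  then obtain W where W: "finite W" "card W = 8" "\<forall>w\<in>W. ?P w"
    by (auto simp: spec_values_def)
  have "S0 \<in> subfield_generated {Z, U, V}"
    by (intro in_subfield(2) subfield_subfield_generated subfield_generated.base) simp
  from degree_lower_bound[OF assms this W(1)] W(2,3) show ?thesis
    by simp
qed

text \<open>If \<open>S\<close> or \<open>R\<close> had degree at most two, then \<open>S - S0 + (1 + y) R\<close> would have degree at most
  \<open>8 \<cdot> 2 \<cdot> 3\<close>.\<close>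

lemma degree_S:
  assumes r: "annihilates_over (subfield_generated {Z, x}) S r"
  shows "3 \<le> degree r"
proof (rule ccontr)
  assume "\<not> 3 \<le> degree r"
  then have deg: "degree r \<le> 2"
    by simp
  let ?F = "subfield_generated {t, x, y}"
  have F: "fin_ext ?F ?F 1"
    by (rule fin_ext_refl[OF subfield_subfield_generated])
  obtain E where E: "fin_ext ?F E 8" "Z \<in> E"
    using adjoin_Z[OF F generated_subset[OF F]] by auto
  have "subfield_generated {Z, x} \<subseteq> E"
    using E generated_subset[OF E(1)] by (intro subfield_generated_subset fin_ext_subfield[OF E(1)]) auto
  then obtain E1 where E1: "fin_ext ?F E1 (8 * 2)" "E \<subseteq> E1" "S \<in> E1"
    using fin_ext_adjoin_le[OF E(1) annihilates_over_mono[OF _ r] deg] by blast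
  obtain E2 where E2: "fin_ext ?F E2 (8 * 2 * 3)" "E1 \<subseteq> E2" "V \<in> E2"
    using adjoin_V[OF E1(1)] E E1(2) generated_subset[OF E1(1)] by blast
  have sub: "subring E2" and Z: "Z \<in> E2"
    using E2 E1 E by (auto simp: fin_ext_def)
  have "S - S0 + (1 + y) * R \<in> E2"
    using in_subfield(2,5,6)[OF fin_ext_subfield[OF E2(1)] Z] E1(3) E2(2,3)
    by (intro subring_intros[OF sub]) auto
  then show False
    using fin_ext_annihilator[OF E2(1)] degree_A by fastforce
qed

lemma degree_R:
  assumes r: "annihilates_over (subfield_generated {Z, y}) R r"
  shows "3 \<le> degree r"
proof (rule ccontr)
  assume "\<not> 3 \<le> degree r"
  then have deg: "degree r \<le> 2"
    by simp
  let ?F = "subfield_generated {t, x, y}"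
  have F: "fin_ext ?F ?F 1"
    by (rule fin_ext_refl[OF subfield_subfield_generated])
  obtain E where E: "fin_ext ?F E 8" "Z \<in> E"
    using adjoin_Z[OF F generated_subset[OF F]] by auto
  have "subfield_generated {Z, y} \<subseteq> E"
    using E generated_subset[OF E(1)] by (intro subfield_generated_subset fin_ext_subfield[OF E(1)]) auto
  then obtain E1 where E1: "fin_ext ?F E1 (8 * 2)" "E \<subseteq> E1" "R \<in> E1"
    using fin_ext_adjoin_le[OF E(1) annihilates_over_mono[OF _ r] deg] by blast
  obtain E2 where E2: "fin_ext ?F E2 (8 * 2 * 3)" "E1 \<subseteq> E2" "U \<in> E2"
    using adjoin_U[OF E1(1)] E E1(2) generated_subset[OF E1(1)] by blast
  have sub: "subring E2" and Z: "Z \<in> E2" and y: "y \<in> E2"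
    using E2 E1 E generated_subset[OF E2(1)] by (auto simp: fin_ext_def)
  have "S - S0 + (1 + y) * R \<in> E2"
    using in_subfield(2,4)[OF fin_ext_subfield[OF E2(1)] Z] E1(3) E2(2,3) y
    by (intro subring_intros[OF sub]) auto
  then show False
    using fin_ext_annihilator[OF E2(1)] degree_A by fastforce
qed

end

section \<open>Laurent series fields\<close>

lemma ring_morph_fps_to_fls: "ring_morph fps_to_fls"
  by (intro ring_morphI) (simp_all add: fls_times_fps_to_fls)

lemmas fps_to_fls_simps = ring_morph_simps[OF ring_morph_fps_to_fls]

lemma fps_to_fls_X: "fps_to_fls fps_X = fls_X"
  by (intro fls_eqI) (auto simp: fps_X_def)

lemma fps_to_fls_const: "fps_to_fls (fps_const c) = fls_const c"
  by (intro fls_eqI) auto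

lemma subring_generated_image:
  assumes "ring_morph h" "u \<in> subring_generated (h ` A)"
  shows "\<exists>v\<in>subring_generated A. u = h v"
  using assms(2)
proof induction
  case (base s)
  then show ?case
    by (auto intro: subring_generated.base)
next
  case one
  show ?case
    by (intro bexI[of _ 1]) (auto simp: ring_morph_1[OF assms(1)] intro: subring_generated.intros)
next
  case (diff u v)
  then obtain u' v' where "u' \<in> subring_generated A" "v' \<in> subring_generated A" "u = h u'" "v = h v'"
    by blast
  then show ?case
    by (intro bexI[of _ "u' - v'"]) (auto simp: ring_morph_diff[OF assms(1)] intro: subring_generated.intros)
next
  case (mult u v)
  then obtain u' v' where "u' \<in> subring_generated A" "v' \<in> subring_generated A" "u = h u'" "v = h v'"
    by blast
  then show ?case
    by (intro bexI[of _ "u' * v'"]) (auto simp: ring_morph_mult[OF assms(1)] intro: subring_generated.intros)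
qed

lemma subring_generated_morph:
  assumes "ring_morph h" "u \<in> subring_generated A"
  shows "h u \<in> subring_generated (h ` A)"
  using assms(2) by induction (auto simp: ring_morph_simps[OF assms(1)] intro: subring_generated.intros)

lemma subring_generated_subfield_generated: "subring_generated A \<subseteq> subfield_generated A"
proof
  fix u assume "u \<in> subring_generated A"
  then show "u \<in> subfield_generated A"
    by induction (auto intro: subfield_generated.intros)
qed

text \<open>The lower bounds are proved over \<rat>(x, y)((t)), whereas the series of parts (2) to
  (4) have fewer variables. H acts on power series only, so the relation is first cleared of
  denominators; injectivity of H keeps the degree.\<close>

lemma annihilates_over_transfer:
  fixes H :: "'a::field fps \<Rightarrow> 'b::field fps"
  assumes H: "ring_morph H" "\<And>f. H f = 0 \<Longrightarrow> f = 0"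
    and r: "annihilates_over (subfield_generated (fps_to_fls ` A)) (fps_to_fls a) r"
  shows "\<exists>r'. annihilates_over (subfield_generated (fps_to_fls ` H ` A)) (fps_to_fls (H a)) r' \<and> degree r' = degree r"
proof -
  obtain p where p: "degree p = degree r" "p \<noteq> 0" "\<And>i. coeff p i \<in> subring_generated (fps_to_fls ` A)"
    "poly p (fps_to_fls a) = 0"
    using annihilates_over_clear[OF r] by blast
  have "\<forall>i. \<exists>c\<in>subring_generated A. coeff p i = fps_to_fls c"
    using subring_generated_image[OF ring_morph_fps_to_fls p(3)] by blast
  then obtain c where c: "\<And>i. c i \<in> subring_generated A" "\<And>i. coeff p i = fps_to_fls (c i)"
    by metis
  let ?n = "degree r"
  define q where "q = (\<Sum>i\<le>?n. monom (fps_to_fls (H (c i))) i)"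
  have q: "coeff q i = (if i \<le> ?n then fps_to_fls (H (c i)) else 0)" for i
    by (simp add: q_def coeff_sum)
  have "fps_to_fls (\<Sum>i\<le>?n. c i * a ^ i) = (\<Sum>i\<le>?n. coeff p i * fps_to_fls a ^ i)"
    by (simp add: c(2) ring_morph_sum[OF ring_morph_fps_to_fls] fps_to_fls_simps)
  also have "\<dots> = 0"
    using p(4) by (simp add: poly_altdef p(1))
  finally have sum: "(\<Sum>i\<le>?n. c i * a ^ i) = 0"
    by simp
  have "poly q (fps_to_fls (H a)) = fps_to_fls (H (\<Sum>i\<le>?n. c i * a ^ i))"
    by (simp add: q_def poly_sum poly_monom ring_morph_sum[OF ring_morph_fps_to_fls] fps_to_fls_simps
        ring_morph_sum[OF H(1)] ring_morph_simps[OF H(1)])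
  then have "poly q (fps_to_fls (H a)) = 0"
    unfolding sum by (simp add: ring_morph_0[OF H(1)])
  moreover have "coeff p ?n \<noteq> 0"
    using p(1,2) by (metis leading_coeff_0_iff)
  then have qn: "coeff q ?n \<noteq> 0"
    using H(2) by (auto simp: q c(2))
  moreover have "coeff q i \<in> subfield_generated (fps_to_fls ` H ` A)" for i
    using subring_generated_morph[OF ring_morph_fps_to_fls subring_generated_morph[OF H(1) c(1)]]
      subring_generated_subfield_generated
      subring_zero[OF subfield_imp_subring[OF subfield_subfield_generated]]
    by (auto simp: q)
  moreover have "degree q = ?n"
    using qn by (intro antisym degree_le le_degree) (auto simp: q)
  ultimately show ?thesis
    by (intro exI[of _ q]) (auto simp: annihilates_over_def)
qed

text \<open>In a relation whose coefficients are series over k, the coefficients of each power of t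
  form a polynomial over k that annihilates c, and so they all vanish.\<close>

lemma const_transcendental:
  fixes c :: "'a::field"
  assumes k: "\<And>q. q \<noteq> 0 \<Longrightarrow> (\<And>i. coeff q i \<in> k) \<Longrightarrow> poly q c \<noteq> 0"
    and A: "\<And>u. u \<in> subring_generated A \<Longrightarrow> \<exists>f. u = fps_to_fls f \<and> (\<forall>n. fps_nth f n \<in> k)"
  shows "\<not> annihilates_over (subfield_generated A) (fls_const c) p"
proof
  assume "annihilates_over (subfield_generated A) (fls_const c) p"
  then obtain r where r: "r \<noteq> 0" "\<And>i. coeff r i \<in> subring_generated A" "poly r (fls_const c) = 0"
    using annihilates_over_clear by blast
  have "\<forall>i. \<exists>f. coeff r i = fps_to_fls f \<and> (\<forall>n. fps_nth f n \<in> k)"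
    using A r(2) by blast
  then obtain f where f: "\<And>i. coeff r i = fps_to_fls (f i)" "\<And>i n. fps_nth (f i) n \<in> k"
    by metis
  have "fps_to_fls (\<Sum>i\<le>degree r. f i * fps_const c ^ i) = poly r (fls_const c)"
    by (simp add: poly_altdef f(1) ring_morph_sum[OF ring_morph_fps_to_fls] fps_to_fls_simps fps_to_fls_const fls_const_power)
  then have sum: "(\<Sum>i\<le>degree r. f i * fps_const c ^ i) = 0"
    by (simp add: r(3))
  have "0 \<in> k"
    using f(1)[of "Suc (degree r)"] f(2)[of "Suc (degree r)" 0] by (simp add: coeff_eq_0)
  have "fps_nth (f (degree r)) n = 0" for n
  proof (rule ccontr)
    assume nz: "fps_nth (f (degree r)) n \<noteq> 0"
    define q where "q = (\<Sum>i\<le>degree r. monom (fps_nth (f i) n) i)"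
    have q: "coeff q i = (if i \<le> degree r then fps_nth (f i) n else 0)" for i
      by (simp add: q_def coeff_sum)
    have "poly q c = fps_nth (\<Sum>i\<le>degree r. f i * fps_const c ^ i) n"
      by (simp add: q_def poly_sum poly_monom fps_sum_nth fps_const_power)
    then have "poly q c = 0"
      unfolding sum by simp
    moreover have "q \<noteq> 0"
      using q[of "degree r"] nz by auto
    moreover have "coeff q i \<in> k" for i
      using f(2) \<open>0 \<in> k\<close> by (simp add: q)
    ultimately show False
      using k by blast
  qed
  then have "f (degree r) = 0"
    by (intro fps_ext) simp
  then have "lead_coeff r = 0"
    by (simp add: f(1))
  with r(1) show False
    by simp
qed

text \<open>The ring generated by the empty set consists of constants, so a relation is refuted by
  its coefficient at the highest power of t.\<close>

lemma fls_X_transcendental: "\<not> annihilates_over (subfield_generated {}) (fls_X :: 'a::field fls) p"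
proof
  assume "annihilates_over (subfield_generated {}) (fls_X :: 'a fls) p"
  then obtain r where r: "r \<noteq> 0" "\<And>i. coeff r i \<in> subring_generated {}" "poly r (fls_X :: 'a fls) = 0"
    using annihilates_over_clear by blast
  have const: "\<exists>c. u = fls_const c" if "u \<in> subring_generated {}" for u :: "'a fls"
    using that
  proof induction
    case one
    show ?case
      by (metis fls_const_1)
  next
    case (diff u v)
    then show ?case
      by (metis fps_to_fls_const fps_const_sub fps_to_fls_minus)
  next
    case (mult u v)
    then show ?case
      by (metis fls_const_mult_const)
  qed simp
  have "\<forall>i. \<exists>c. coeff r i = fls_const c"
    by (intro allI const r(2))
  then obtain c where c: "\<And>i. coeff r i = fls_const (c i)"
    by metis
  have "fps_to_fls (\<Sum>i\<le>degree r. fps_const (c i) * fps_X ^ i) = poly r (fls_X :: 'a fls)"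
    by (simp add: poly_altdef c ring_morph_sum[OF ring_morph_fps_to_fls] fps_to_fls_simps fps_to_fls_const fps_to_fls_X)
  then have "(\<Sum>i\<le>degree r. fps_const (c i) * fps_X ^ i) = (0 :: 'a fps)"
    by (simp add: r(3))
  from arg_cong[OF this, of "\<lambda>f. fps_nth f (degree r)"] have "c (degree r) = 0"
    by (simp add: fps_sum_nth fps_X_power_nth if_distrib[of "\<lambda>a. _ * a"] cong: if_cong)
  then have "lead_coeff r = 0"
    by (simp add: c)
  with r(1) show False
    by simp
qed

text \<open>x = a / t may fail to be a power series, which is why the field is one of Laurent
  series. The equations themselves are those already known for power series.\<close>

lemma gessel_field_fls:
  fixes a b :: "'a::field_char_0 fps" and x :: "'a fls"
  assumes x: "x * fls_X = fps_to_fls a" and a: "a \<noteq> 0"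
  shows "gessel_field fls_X x (fps_to_fls b) (fps_to_fls (fps_rat gessel_Z)) (fps_to_fls (fps_psub a gessel_U))
    (fps_to_fls (fps_psub b gessel_V)) (fps_to_fls (fps_psub a gessel_S)) (fps_to_fls (fps_psub b gessel_R))
    (fps_to_fls (fps_rat gessel_S0))"
proof
  define T Z :: "'a fps" where "T = fps_rat gessel_T" and "Z = fps_rat gessel_Z"
  have ZT: "Z^2 = T"
    by (simp add: T_def Z_def fps_rat_gessel_Z)
  note D = ring_morph_gessel[OF ring_morph_fps_to_fls]
  show "gessel_curve (fls_X^2) x (fps_to_fls b) (fps_to_fls (fps_rat gessel_Z)) (fps_to_fls (fps_psub a gessel_U))
    (fps_to_fls (fps_psub b gessel_V))"
  proof -
    have "fps_to_fls (256 * T^3 * fps_X^2) = fps_to_fls ((T - 1) * (T + 3)^3)"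
      by (rule arg_cong[of _ _ fps_to_fls]) (simp only: T_def fps_rat_T_eq)
    moreover have "fps_to_fls (16 * T^2 * ((fps_psub a gessel_U)^2 - T)) * fls_X =
        (x * fps_to_fls ((fps_psub a gessel_U + fps_psub a gessel_U * T - 2 * T) * gessel_D T (fps_psub a gessel_U))) * fls_X"
    proof -
      have "fps_to_fls (16 * T^2 * ((fps_psub a gessel_U)^2 - T) * fps_X) =
          fps_to_fls (a * ((fps_psub a gessel_U + fps_psub a gessel_U * T - 2 * T) * gessel_D T (fps_psub a gessel_U)))"
        using psub_U_eq[of a] by (simp only: T_def)
      then show ?thesis
        unfolding fls_times_fps_to_fls fps_to_fls_X x[symmetric] by (simp only: mult_ac)
    qed
    moreover have "fps_to_fls (1 - T + 3 * fps_psub b gessel_V + fps_psub b gessel_V * T) =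
        fps_to_fls (b * ((fps_psub b gessel_V)^2 * (3 + fps_psub b gessel_V + T - fps_psub b gessel_V * T)))"
      using psub_V_eq[of b] by (simp only: T_def)
    ultimately show ?thesis
      unfolding gessel_curve_def Let_def Z_def[symmetric] fps_to_fls_simps(7)[symmetric] ZT
      by (simp only: mult_right_cancel[OF fls_X_nonzero] fps_to_fls_simps fps_to_fls_X D)
  qed
  have S0: "fps_rat gessel_S0 * ((1 + Z) * (Z^2 + 3)^3) = 32 * Z^3 * (3 + 3 * Z - 3 * Z^2 + Z^3)"
    using arg_cong[OF gessel_S0_eq, of fps_rat] unfolding Z_def by (simp add: fps_rat_simps)
  show "gessel_values (fps_to_fls (fps_rat gessel_Z)) (fps_to_fls (fps_psub a gessel_U))
    (fps_to_fls (fps_psub b gessel_V)) (fps_to_fls (fps_psub a gessel_S)) (fps_to_fls (fps_psub b gessel_R))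
    (fps_to_fls (fps_rat gessel_S0))"
    using arg_cong[OF psub_S_eq[of a], of fps_to_fls] arg_cong[OF psub_R_eq[of b], of fps_to_fls] arg_cong[OF S0, of fps_to_fls]
    unfolding gessel_values_def Let_def T_def[symmetric] Z_def[symmetric]
    unfolding ZT[symmetric] fps_to_fls_simps D by blast
  show "gessel_nondegenerate (fps_to_fls (fps_rat gessel_Z)) (fps_to_fls (fps_psub a gessel_U)) (fps_to_fls (fps_psub b gessel_V))"
  proof -
    note nz = psub_gessel_nonzero(1-4)[where 'a = 'a] psub_gessel_nonzero(5-8)[of b] psub_gessel_nonzero(9-11)[of a]
    have "T + 3 \<noteq> 0" "T - 1 \<noteq> 0"
      using nz by (auto simp: T_def)
    then have nzs: "256 * T^3 \<noteq> 0" "(fps_psub a gessel_U + fps_psub a gessel_U * T - 2 * T) * gessel_D T (fps_psub a gessel_U) \<noteq> 0"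
      "(fps_psub b gessel_V)^2 * (3 + fps_psub b gessel_V + T - fps_psub b gessel_V * T) \<noteq> 0"
      "(1 - T) * (T + 3)^3 * (fps_psub a gessel_U + Z) * gessel_D T (fps_psub a gessel_U) \<noteq> 0"
      "(T - 1) * (T + 3)^3 * (1 + fps_psub b gessel_V)^2 * (1 + Z + fps_psub b gessel_V - fps_psub b gessel_V * Z)^2 \<noteq> 0"
      "(1 + Z) * (Z^2 + 3)^3 \<noteq> 0"
      using nz unfolding T_def[symmetric] Z_def[symmetric] ZT by auto
    then have "fps_to_fls (256 * T^3) \<noteq> 0" "fps_to_fls ((fps_psub a gessel_U + fps_psub a gessel_U * T - 2 * T) * gessel_D T (fps_psub a gessel_U)) \<noteq> 0"
      "fps_to_fls ((fps_psub b gessel_V)^2 * (3 + fps_psub b gessel_V + T - fps_psub b gessel_V * T)) \<noteq> 0"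
      "fps_to_fls ((1 - T) * (T + 3)^3 * (fps_psub a gessel_U + Z) * gessel_D T (fps_psub a gessel_U)) \<noteq> 0"
      "fps_to_fls ((T - 1) * (T + 3)^3 * (1 + fps_psub b gessel_V)^2 * (1 + Z + fps_psub b gessel_V - fps_psub b gessel_V * Z)^2) \<noteq> 0"
      "fps_to_fls ((1 + Z) * (Z^2 + 3)^3) \<noteq> 0"
      by (simp_all only: fps_to_fls_eq_0_iff not_False_eq_True)
    then show ?thesis
      unfolding gessel_nondegenerate_def Let_def Z_def[symmetric] ZT[symmetric] fps_to_fls_simps D by blast
  qed
  show "x \<noteq> 0"
    using x a by auto
qed

lemma subring_generated_fps_coeffs:
  fixes A :: "'a::field fls set"
  assumes k: "subring k" and A: "\<And>s. s \<in> A \<Longrightarrow> \<exists>f. s = fps_to_fls f \<and> (\<forall>n. fps_nth f n \<in> k)"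
    and u: "u \<in> subring_generated A"
  shows "\<exists>f. u = fps_to_fls f \<and> (\<forall>n. fps_nth f n \<in> k)"
  using u
proof induction
  case (base s)
  then show ?case
    by (rule A)
next
  case one
  show ?case
    by (intro exI[of _ 1]) (auto simp: fps_one_nth intro: subring_intros[OF k])
next
  case (diff u v)
  then obtain f g where "u = fps_to_fls f" "v = fps_to_fls g" "\<forall>n. fps_nth f n \<in> k" "\<forall>n. fps_nth g n \<in> k"
    by blast
  then show ?case
    by (intro exI[of _ "f - g"]) (auto intro: subring_diff[OF k])
next
  case (mult u v)
  then obtain f g where "u = fps_to_fls f" "v = fps_to_fls g" "\<forall>n. fps_nth f n \<in> k" "\<forall>n. fps_nth g n \<in> k"
    by blast
  then show ?case
    by (intro exI[of _ "f * g"])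
      (auto simp: fls_times_fps_to_fls fps_mult_nth intro!: subring_sum[OF k] subring_mult[OF k])
qed

section \<open>The bivariate function field\<close>

type_synonym biv = "rat poly poly fract"

lemma ring_morph_to_fract_const: "ring_morph (\<lambda>p :: rat poly. to_fract [:p:] :: biv)"
  by (intro ring_morphI) (simp_all flip: to_fract_add to_fract_mult add: one_pCons[symmetric])

lemma ring_morph_of_rat_unique:
  fixes h :: "rat \<Rightarrow> 'a::field_char_0"
  assumes "ring_morph h"
  shows "h c = of_rat c"
proof -
  obtain a b where c: "quotient_of c = (a, b)"
    by force
  have b: "b > 0"
    using c quotient_of_denom_pos by blast
  have "c * of_int b = of_int a"
    using quotient_of_div[OF c] b by simp
  from arg_cong[OF this, of h] arg_cong[OF this, of "of_rat :: rat \<Rightarrow> 'a"]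
  have "h c * of_int b = of_rat c * of_int b"
    by (simp add: ring_morph_simps[OF assms] of_rat_mult)
  then show ?thesis
    using b by simp
qed

lemma of_rat_biv: "(of_rat c :: biv) = to_fract [:[:c:]:]"
proof -
  have "ring_morph (\<lambda>c :: rat. to_fract [:[:c:]:] :: biv)"
    by (intro ring_morphI) (simp_all flip: to_fract_add to_fract_mult add: one_pCons[symmetric])
  from ring_morph_of_rat_unique[OF this, of c] show ?thesis
    by simp
qed

lemma eval_biv_x: "poly (map_poly of_rat p) biv_x = to_fract [:p:]"
proof (induction p)
  case (pCons c p)
  have "[:pCons c p:] = [:[:c:]:] + [:[:0, 1:]:] * [:p:]"
    by simp
  then have "to_fract [:pCons c p:] = to_fract [:[:c:]:] + biv_x * to_fract [:p:]"
    by (metis to_fract_add to_fract_mult biv_x_def)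
  with pCons show ?case
    by (simp add: map_poly_pCons of_rat_biv)
qed simp

lemma eval_biv_y: "poly (map_poly (\<lambda>p. to_fract [:p:]) P) biv_y = to_fract P"
proof (induction P)
  case (pCons c p)
  have "pCons c p = [:c:] + [:0, 1:] * p"
    by simp
  then have "to_fract (pCons c p) = to_fract [:c:] + biv_y * to_fract p"
    by (metis to_fract_add to_fract_mult biv_y_def)
  with pCons show ?case
    by (simp add: map_poly_pCons)
qed simp

lemma poly_coeffs_range:
  fixes h :: "'a::comm_ring_1 \<Rightarrow> 'b::comm_ring_1"
  assumes "\<And>i. coeff q i \<in> range h" "h 0 = 0" "\<And>c. h c = 0 \<Longrightarrow> c = 0"
  shows "\<exists>p. q = map_poly h p"
proof -
  have "\<forall>i. \<exists>c. coeff q i = h c"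
    using assms(1) by (auto simp: image_iff)
  then obtain c where c: "\<And>i. coeff q i = h (c i)"
    by metis
  define p where "p = (\<Sum>i\<le>degree q. monom (c i) i)"
  have "coeff p i = (if i \<le> degree q then c i else 0)" for i
    by (simp add: p_def coeff_sum)
  then have "coeff q i = coeff (map_poly h p) i" for i
    using c[of i] assms(2) coeff_eq_0[of q i] by (cases "i \<le> degree q") (simp_all add: coeff_map_poly)
  then have "q = map_poly h p"
    by (rule poly_eqI)
  then show ?thesis
    by blast
qed

lemma biv_x_transcendental:
  assumes "q \<noteq> 0" "\<And>i. coeff q i \<in> range of_rat"
  shows "poly q biv_x \<noteq> 0"
proof -
  obtain p where p: "q = map_poly of_rat p"
    using poly_coeffs_range[of q of_rat] assms(2) by auto
  then show ?thesis
    using assms(1) by (auto simp: eval_biv_x)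
qed

lemma biv_y_transcendental:
  assumes "q \<noteq> 0" "\<And>i. coeff q i \<in> range (\<lambda>p. to_fract [:p:])"
  shows "poly q biv_y \<noteq> 0"
proof -
  obtain p where p: "q = map_poly (\<lambda>p. to_fract [:p:]) p"
    using poly_coeffs_range[of q "\<lambda>p. to_fract [:p:]"] assms(2) by auto
  then show ?thesis
    using assms(1) by (auto simp: eval_biv_y)
qed

lemma subring_range: "ring_morph h \<Longrightarrow> subring (range h)"
  unfolding subring_def
  by (auto simp: ring_morph_diff[symmetric] ring_morph_mult[symmetric]) (metis rangeI ring_morph_1)

lemma fls_X_coeffs: "subring k \<Longrightarrow> \<exists>f. fls_X = fps_to_fls f \<and> (\<forall>n. fps_nth f n \<in> k)"
  by (intro exI[of _ fps_X] conjI fps_to_fls_X[symmetric] allI)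
    (auto simp: fps_X_def subring_intros)

lemma fls_const_coeffs: "subring k \<Longrightarrow> c \<in> k \<Longrightarrow> \<exists>f. fls_const c = fps_to_fls f \<and> (\<forall>n. fps_nth f n \<in> k)"
  by (intro exI[of _ "fps_const c"]) (auto simp: fps_to_fls_const subring_intros)

lemma x_transcendental_biv: "\<not> annihilates_over (subfield_generated {fls_X}) (fls_const biv_x) p"
proof (rule const_transcendental[where k = "range of_rat"])
  have k: "subring (range (of_rat :: rat \<Rightarrow> biv))"
    by (rule subring_range[OF ring_morph_of_rat])
  show "\<exists>f. u = fps_to_fls f \<and> (\<forall>n. fps_nth f n \<in> range of_rat)" if "u \<in> subring_generated {fls_X}" for u :: "biv fls"
    by (rule subring_generated_fps_coeffs[OF k _ that]) (auto intro!: fls_X_coeffs k)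
qed (rule biv_x_transcendental)

lemma y_transcendental_biv: "\<not> annihilates_over (subfield_generated {fls_X, fls_const biv_x}) (fls_const biv_y) p"
proof (rule const_transcendental[where k = "range (\<lambda>p. to_fract [:p:])"])
  have k: "subring (range (\<lambda>p :: rat poly. to_fract [:p:] :: biv))"
    by (rule subring_range[OF ring_morph_to_fract_const])
  show "\<exists>f. u = fps_to_fls f \<and> (\<forall>n. fps_nth f n \<in> range (\<lambda>p. to_fract [:p:]))"
    if "u \<in> subring_generated {fls_X, fls_const biv_x}" for u :: "biv fls"
    by (rule subring_generated_fps_coeffs[OF k _ that])
      (auto intro!: fls_X_coeffs fls_const_coeffs k simp: biv_x_def)
qed (rule biv_y_transcendental)

text \<open>Over \<rat>(t) the elements x and x / t generate the same field, so the transcendence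
  statements for x / t reduce to those for x.\<close>

lemma gessel_generic_biv:
  assumes x: "x * fls_X = fps_to_fls a" "a \<noteq> 0" and gen: "x = fls_const biv_x \<or> x = fls_const biv_x / fls_X"
  shows "gessel_generic fls_X x (fls_const biv_y) (fps_to_fls (fps_rat gessel_Z)) (fps_to_fls (fps_psub a gessel_U))
    (fps_to_fls (fps_psub (fps_const biv_y) gessel_V)) (fps_to_fls (fps_psub a gessel_S))
    (fps_to_fls (fps_psub (fps_const biv_y) gessel_R)) (fps_to_fls (fps_rat gessel_S0))"
proof -
  have sub: "x \<in> E \<longleftrightarrow> fls_const biv_x \<in> E" if "subfield E" "fls_X \<in> E" for E
  proof -
    have "fls_const biv_x = x * fls_X" if "x = fls_const biv_x / fls_X"
      unfolding that by (metis fls_X_nonzero nonzero_eq_divide_eq)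
    then show ?thesis
      using gen subfield_divide[OF that(1) _ that(2)] subring_mult[OF subfield_imp_subring[OF that(1)] _ that(2)]
      by metis
  qed
  interpret gessel_field fls_X x "fls_const biv_y" "fps_to_fls (fps_rat gessel_Z)" "fps_to_fls (fps_psub a gessel_U)"
    "fps_to_fls (fps_psub (fps_const biv_y) gessel_V)" "fps_to_fls (fps_psub a gessel_S)"
    "fps_to_fls (fps_psub (fps_const biv_y) gessel_R)" "fps_to_fls (fps_rat gessel_S0)"
    using gessel_field_fls[OF x, of "fps_const biv_y"] unfolding fps_to_fls_const .
  show ?thesis
  proof unfold_locales
    show "\<not> annihilates_over (subfield_generated {}) fls_X p" for p :: "biv fls poly"
      by (rule fls_X_transcendental)
    show "\<not> annihilates_over (subfield_generated {fls_X}) x p" for p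
    proof
      let ?F = "subfield_generated {fls_X} :: biv fls set"
      assume "annihilates_over ?F x p"
      then obtain E where E: "fin_ext ?F E (1 * degree p)" "?F \<subseteq> E" "x \<in> E"
        using fin_ext_adjoin[OF fin_ext_refl[OF subfield_subfield_generated]] by blast
      then have "fls_const biv_x \<in> E"
        using sub[OF fin_ext_subfield[OF E(1)]] by (auto intro: subfield_generated.base)
      then show False
        using fin_ext_annihilator[OF E(1)] x_transcendental_biv by blast
    qed
    have "subfield_generated {fls_X, x} \<subseteq> subfield_generated {fls_X, fls_const biv_x}"
      using sub[OF subfield_subfield_generated[of "{fls_X, fls_const biv_x}"]]
      by (intro subfield_generated_subset subfield_subfield_generated) (auto intro: subfield_generated.base)
    then show "\<not> annihilates_over (subfield_generated {fls_X, x}) (fls_const biv_y) p" for p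
      using y_transcendental_biv annihilates_over_mono by blast
  qed
qed

text \<open>The extension of h to the fraction field. The choice runs over all ways to write r as a
  quotient; injectivity of h makes the value independent of it.\<close>

definition fract_ext :: "('a::idom \<Rightarrow> 'b::field) \<Rightarrow> 'a fract \<Rightarrow> 'b" where
  "fract_ext h r = (SOME w. \<exists>a b. b \<noteq> 0 \<and> r = to_fract a / to_fract b \<and> w = h a / h b)"

context
  fixes h :: "'a::idom \<Rightarrow> 'b::field"
  assumes h: "ring_morph h" and inj: "\<forall>a. h a = 0 \<longrightarrow> a = 0"
begin

lemma fract_ext_fract:
  assumes "b \<noteq> 0"
  shows "fract_ext h (to_fract a / to_fract b) = h a / h b"
  unfolding fract_ext_def
proof (rule some_equality)
  fix w assume "\<exists>a' b'. b' \<noteq> 0 \<and> to_fract a / to_fract b = to_fract a' / to_fract b' \<and> w = h a' / h b'"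
  then obtain a' b' where w: "b' \<noteq> 0" "to_fract a / to_fract b = to_fract a' / to_fract b'" "w = h a' / h b'"
    by blast
  then have "to_fract (a * b') = to_fract (a' * b)"
    using assms by (simp add: field_simps)
  then have "a * b' = a' * b"
    by (simp only: to_fract_eq_iff)
  then have "h a * h b' = h a' * h b"
    by (simp flip: ring_morph_mult[OF h])
  moreover have "h b \<noteq> 0" "h b' \<noteq> 0"
    using inj assms w(1) by blast+
  ultimately have "h a' / h b' = h a / h b"
    by (simp add: frac_eq_eq)
  then show "w = h a / h b"
    using w(3) by simp
qed (use assms in blast)

lemma fract_cases: obtains a b where "b \<noteq> 0" "r = to_fract a / to_fract (b :: 'a)"
  by (metis Fract_cases Fract_conv_to_fract)

lemma ring_morph_fract_ext: "ring_morph (fract_ext h)"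
proof (rule ring_morphI)
  show "fract_ext h 1 = 1"
    using fract_ext_fract[of 1 1] by (simp add: ring_morph_1[OF h])
  fix u v :: "'a fract"
  obtain a b where u: "b \<noteq> 0" "u = to_fract a / to_fract b"
    by (rule fract_cases)
  obtain c d where v: "d \<noteq> 0" "v = to_fract c / to_fract d"
    by (rule fract_cases)
  have 0: "h b \<noteq> 0" "h d \<noteq> 0"
    using u v inj by auto
  have "u + v = to_fract (a * d + c * b) / to_fract (b * d)"
    using u v by (simp add: field_simps)
  then have "fract_ext h (u + v) = h (a * d + c * b) / h (b * d)"
    using u v by (simp only:) (intro fract_ext_fract, simp)
  moreover have uv: "fract_ext h u = h a / h b" "fract_ext h v = h c / h d"
    unfolding u(2) v(2) by (intro fract_ext_fract u v)+
  moreover have "h (a * d + c * b) / h (b * d) = h a / h b + h c / h d"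
    using 0 by (simp add: ring_morph_simps[OF h] field_simps)
  ultimately show "fract_ext h (u + v) = fract_ext h u + fract_ext h v"
    by simp
  have "u * v = to_fract (a * c) / to_fract (b * d)"
    using u v by simp
  then have "fract_ext h (u * v) = h (a * c) / h (b * d)"
    using u v by (simp only:) (intro fract_ext_fract, simp)
  then show "fract_ext h (u * v) = fract_ext h u * fract_ext h v"
    by (simp add: uv ring_morph_simps[OF h])
qed

lemma fract_ext_to_fract: "fract_ext h (to_fract a) = h a"
  using fract_ext_fract[of 1 a] by (simp add: ring_morph_1[OF h])

end

lemma ring_morph_field_inj:
  fixes h :: "'a::field \<Rightarrow> 'b::field"
  assumes "ring_morph h" "h a = 0"
  shows "a = 0"
proof (rule ccontr)
  assume "a \<noteq> 0"
  then have "h a * h (inverse a) = 1"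
    by (simp flip: ring_morph_mult[OF assms(1)] add: ring_morph_1[OF assms(1)])
  with assms(2) show False
    by simp
qed

lemma ring_morph_field_of_rat:
  fixes h :: "'a::field_char_0 \<Rightarrow> 'b::field_char_0"
  assumes "ring_morph h"
  shows "h (of_rat c) = of_rat c"
  using ring_morph_of_rat_unique[OF ring_morph_comp[OF ring_morph_of_rat assms]] .

lemma fps_map_inj:
  assumes "ring_morph (h :: 'a::field \<Rightarrow> 'b::field)" "fps_map h f = 0"
  shows "f = 0"
proof (rule fps_ext)
  fix n
  have "h (fps_nth f n) = 0"
    using arg_cong[OF assms(2), of "\<lambda>f. fps_nth f n"] by simp
  then show "fps_nth f n = fps_nth 0 n"
    using ring_morph_field_inj[OF assms(1)] by simp
qed

lemma fps_map_fps_rat: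
  assumes "ring_morph (h :: 'a::field_char_0 \<Rightarrow> 'b::field_char_0)"
  shows "fps_map h (fps_rat f) = fps_rat f"
  by (rule fps_ext) (simp add: ring_morph_field_of_rat[OF assms])

lemma fps_map_psub:
  assumes h: "ring_morph (h :: 'a::field_char_0 \<Rightarrow> 'b::field_char_0)"
  shows "fps_map h (fps_psub a f) = fps_psub (fps_map h a) f"
proof -
  have e: "fps_map h (ratpoly_eval a p) = ratpoly_eval (fps_map h a) p" for p
    by (induction p) (simp_all add: ratpoly_eval_0 ratpoly_eval_pCons ring_morph_simps[OF ring_morph_fps_map[OF h]]
        fps_map_const ring_morph_0[OF h] ring_morph_field_of_rat[OF h])
  show ?thesis
    by (rule fps_ext) (simp add: fps_psub_def fps_collapse_nth ring_morph_sum[OF h] flip: e)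
qed

section \<open>Closed forms and exact degrees\<close>

lemma gessel_series_x: "gessel_series a 0 = fps_psub a gessel_S"
  using fps_psub_gessel_x[of a] by (simp add: gessel_series_eq)

lemma gessel_series_y: "gessel_series 0 b = fps_psub b gessel_R"
  using fps_psub_gessel_y[of b] by (simp add: gessel_series_eq)

lemma gessel_series_0_0: "gessel_series 0 0 = fps_rat gessel_S0"
  using gessel_series_0_0_morph[OF ring_morph_of_rat, symmetric] by (simp only: gessel_series_eq(3))

lemma fps_rat_id: "fps_rat f = f" for f :: "rat fps"
  by (rule fps_ext) simp

lemma biv_x_nonzero: "biv_x \<noteq> 0" and biv_y_nonzero: "biv_y \<noteq> 0" and univ_var_nonzero: "univ_var \<noteq> 0"
  by (simp_all add: biv_x_def biv_y_def univ_var_def)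

text \<open>With x the element S is Q(xt, 0), as in part (3). The second instance, with x / t, has S
  = Q(x, 0), as in the functional equation for Q(x, y).\<close>

interpretation scaled: gessel_generic fls_X "fls_const biv_x" "fls_const biv_y" "fps_to_fls (fps_rat gessel_Z)"
  "fps_to_fls (fps_psub (fps_const biv_x * fps_X) gessel_U)" "fps_to_fls (fps_psub (fps_const biv_y) gessel_V)"
  "fps_to_fls (fps_psub (fps_const biv_x * fps_X) gessel_S)" "fps_to_fls (fps_psub (fps_const biv_y) gessel_R)"
  "fps_to_fls (fps_rat gessel_S0)"
  by (rule gessel_generic_biv) (simp_all add: fls_times_fps_to_fls fps_to_fls_const fps_to_fls_X biv_x_nonzero)

interpretation unscaled: gessel_generic fls_X "fls_const biv_x / fls_X" "fls_const biv_y" "fps_to_fls (fps_rat gessel_Z)"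
  "fps_to_fls (fps_psub (fps_const biv_x) gessel_U)" "fps_to_fls (fps_psub (fps_const biv_y) gessel_V)"
  "fps_to_fls (fps_psub (fps_const biv_x) gessel_S)" "fps_to_fls (fps_psub (fps_const biv_y) gessel_R)"
  "fps_to_fls (fps_rat gessel_S0)"
proof (rule gessel_generic_biv)
  show "fls_const biv_x / fls_X * fls_X = fps_to_fls (fps_const biv_x)"
    unfolding fps_to_fls_const by (metis fls_X_nonzero nonzero_eq_divide_eq)
qed (simp_all add: biv_x_nonzero)

text \<open>By the functional equation the kernel times Q(x, y) is x y - t A, so Q(x, y) and A
  generate the same extension of \<rat>(x, y, t).\<close>

lemma degree_gessel_series:
  "algebraic_of_degree (subfield_generated {fls_const biv_x, fls_const biv_y, fls_X})
     (fps_to_fls (gessel_series (fps_const biv_x) (fps_const biv_y))) 72"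
proof -
  define t x y :: "biv fls" where "t = fls_X" and "x = fls_const biv_x" and "y = fls_const biv_y"
  define Q where "Q = fps_to_fls (gessel_series (fps_const biv_x) (fps_const biv_y))"
  define A where "A = fps_to_fls (fps_psub (fps_const biv_x) gessel_S) - fps_to_fls (fps_rat gessel_S0)
    + (1 + y) * fps_to_fls (fps_psub (fps_const biv_y) gessel_R)"
  define k where "k = x * y - t * (x\<^sup>2 * y + x\<^sup>2 * y\<^sup>2 + y + 1)"
  let ?F = "subfield_generated {x, y, t}"
  have F: "fin_ext ?F ?F 1"
    by (rule fin_ext_refl[OF subfield_subfield_generated])
  have kQ: "k * Q = x * y - t * A"
  proof -
    have "fps_to_fls ((fps_const biv_x * fps_const biv_y - fps_X * ((fps_const biv_x)\<^sup>2 * fps_const biv_y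
        + (fps_const biv_x)\<^sup>2 * (fps_const biv_y)\<^sup>2 + fps_const biv_y + 1)) * gessel_series (fps_const biv_x) (fps_const biv_y)) =
      fps_to_fls (fps_const biv_x * fps_const biv_y - fps_X * fps_psub (fps_const biv_x) gessel_S
        - fps_X * (1 + fps_const biv_y) * fps_psub (fps_const biv_y) gessel_R + fps_X * fps_rat gessel_S0)"
      unfolding gessel_series_functional_eq gessel_series_x[symmetric] gessel_series_y[symmetric] gessel_series_0_0[symmetric] ..
    then show ?thesis
      unfolding fps_to_fls_simps fps_to_fls_const fps_to_fls_X
      unfolding k_def Q_def A_def t_def[symmetric] x_def[symmetric] y_def[symmetric]
      by (simp add: algebra_simps)
  qed
  have "k \<noteq> 0"
  proof -
    define k' where "k' = fps_const biv_x * fps_const biv_y - fps_X * ((fps_const biv_x)\<^sup>2 * fps_const biv_y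
        + (fps_const biv_x)\<^sup>2 * (fps_const biv_y)\<^sup>2 + fps_const biv_y + 1)"
    have "fps_nth k' 0 \<noteq> 0"
      by (simp add: k'_def biv_x_nonzero biv_y_nonzero)
    then have "k' \<noteq> 0"
      by auto
    moreover have "k = fps_to_fls k'"
      unfolding k_def k'_def t_def x_def y_def fps_to_fls_simps fps_to_fls_const fps_to_fls_X ..
    ultimately show ?thesis
      by simp
  qed
  have k_in: "k \<in> E" "x / t \<in> E" "x \<in> E" "y \<in> E" "t \<in> E" if "subfield E" "?F \<subseteq> E" for E
  proof -
    note sub = subring_intros[OF subfield_imp_subring[OF that(1)]]
    show x: "x \<in> E" and y: "y \<in> E" and t: "t \<in> E"
      using that(2) by (auto intro: subfield_generated.base)
    show "k \<in> E"
      unfolding k_def by (intro sub x y t)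
    show "x / t \<in> E"
      by (rule subfield_divide[OF that(1) x t])
  qed
  have gen: "fls_X \<in> E" "fls_const biv_x / fls_X \<in> E" "fls_const biv_y \<in> E" if "subfield E" "?F \<subseteq> E" for E
    using k_in[OF that] by (simp_all only: t_def x_def y_def)
  have FE: "?F \<subseteq> E" if "fin_ext ?F E n" for E n
    using that by (simp add: fin_ext_def)
  have "\<exists>p. annihilates_over ?F Q p \<and> degree p \<le> 72"
  proof -
    obtain E1 where E1: "fin_ext ?F E1 (1 * 8)" "fps_to_fls (fps_rat gessel_Z) \<in> E1"
      using unscaled.adjoin_Z[OF F gen(1)[OF subfield_subfield_generated subset_refl]] by blast
    obtain E2 where E2: "fin_ext ?F E2 (1 * 8 * 3)" "E1 \<subseteq> E2" "fps_to_fls (fps_psub (fps_const biv_x) gessel_U) \<in> E2"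
      using unscaled.adjoin_U[OF E1 gen(2)[OF fin_ext_subfield[OF E1(1)] FE[OF E1(1)]]] by blast
    obtain E3 where E3: "fin_ext ?F E3 (1 * 8 * 3 * 3)" "E2 \<subseteq> E3" "fps_to_fls (fps_psub (fps_const biv_y) gessel_V) \<in> E3"
      using unscaled.adjoin_V[OF E2(1) subsetD[OF E2(2) E1(2)] gen(3)[OF fin_ext_subfield[OF E2(1)] FE[OF E2(1)]]]
      by blast
    have sub: "subfield E3"
      by (rule fin_ext_subfield[OF E3(1)])
    have Z: "fps_to_fls (fps_rat gessel_Z) \<in> E3"
      using E1 E2 E3 by blast
    note [intro] = subring_intros[OF subfield_imp_subring[OF sub]] k_in[OF sub FE[OF E3(1)]]
    have "A \<in> E3"
      unfolding A_def using unscaled.in_subfield(2,4,6)[OF sub Z] E2(3) E3(2,3) by blast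
    then have "(x * y - t * A) / k \<in> E3"
      by (intro subfield_divide[OF sub]) blast+
    moreover have "Q = (x * y - t * A) / k"
      using kQ \<open>k \<noteq> 0\<close> by (simp add: field_simps)
    ultimately show ?thesis
      using fin_ext_annihilator[OF E3(1)] by simp
  qed
  then obtain p where p: "annihilates_over ?F Q p" "degree p \<le> 72"
    by blast
  have "72 \<le> degree r" if r: "annihilates_over ?F Q r" for r
  proof -
    obtain E where E: "fin_ext ?F E (1 * degree r)" "Q \<in> E"
      using fin_ext_adjoin[OF F r] by blast
    have sub: "subfield E"
      by (rule fin_ext_subfield[OF E(1)])
    note [intro] = subring_intros[OF subfield_imp_subring[OF sub]] k_in[OF sub FE[OF E(1)]] E(2)
    have "t \<noteq> 0"
      unfolding t_def by (rule fls_X_nonzero)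
    moreover have "A * t = x * y - k * Q"
      using kQ by (simp add: mult.commute)
    ultimately have "A = (x * y - k * Q) / t"
      using nonzero_eq_divide_eq by blast
    also have "\<dots> \<in> E"
      by (intro subfield_divide[OF sub]) blast+
    finally obtain p where p: "annihilates_over ?F A p" "degree p \<le> degree r"
      using fin_ext_annihilator[OF E(1)] by auto
    \<comment> \<open>The lower bound for A is stated for the generators t, x / t, y of the same
      field.\<close>
    have "?F \<subseteq> subfield_generated {t, x / t, y}"
    proof (rule subfield_generated_subset[OF subfield_subfield_generated])
      have "t \<in> subfield_generated {t, x / t, y}" "x / t \<in> subfield_generated {t, x / t, y}" "y \<in> subfield_generated {t, x / t, y}"
        by (auto intro: subfield_generated.base)
      moreover from this have "t * (x / t) \<in> subfield_generated {t, x / t, y}"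
        by (intro subfield_generated.mult)
      moreover have "t * (x / t) = x"
        unfolding t_def by (metis fls_X_nonzero nonzero_eq_divide_eq mult.commute)
      ultimately show "{x, y, t} \<subseteq> subfield_generated {t, x / t, y}"
        by simp
    qed
    from annihilates_over_mono[OF this p(1)] have "72 \<le> degree p"
      using unscaled.degree_A unfolding A_def t_def x_def y_def by blast
    with p(2) show ?thesis
      by simp
  qed
  with algebraic_of_degreeI[OF subfield_subfield_generated p] show ?thesis
    unfolding Q_def t_def x_def y_def by blast
qed

lemma degree_gessel_series_0_0:
  "algebraic_of_degree (subfield_generated {fls_X}) (fps_to_fls (gessel_series (0 :: rat fps) 0)) 8"
proof -
  \<comment> \<open>x = 1, that is a = t, and y = 0 give an instance over \<rat>((t)), where no
    variable x or y is present.\<close>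
  interpret gessel_field fls_X 1 "fps_to_fls 0" "fps_to_fls (fps_rat gessel_Z)" "fps_to_fls (fps_psub fps_X gessel_U)"
    "fps_to_fls (fps_psub 0 gessel_V)" "fps_to_fls (fps_psub fps_X gessel_S)"
    "fps_to_fls (fps_psub 0 gessel_R)" "fps_to_fls (fps_rat gessel_S0) :: rat fls"
    by (rule gessel_field_fls) (simp_all add: fps_to_fls_X)
  let ?F = "subfield_generated {fls_X} :: rat fls set"
  have F: "fin_ext ?F ?F 1"
    by (rule fin_ext_refl[OF subfield_subfield_generated])
  obtain E where E: "fin_ext ?F E (1 * 8)" "fps_to_fls (fps_rat gessel_Z) \<in> E"
    using adjoin_Z[OF F] by (auto intro: subfield_generated.base)
  have Q: "fps_to_fls (gessel_series (0 :: rat fps) 0) = fps_to_fls (fps_rat gessel_S0)"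
    by (simp only: gessel_series_eq(3) fps_rat_id)
  have "fps_to_fls (fps_rat gessel_S0) \<in> E"
    by (rule in_subfield(2)[OF fin_ext_subfield[OF E(1)] E(2)])
  then obtain p where p: "annihilates_over ?F (fps_to_fls (fps_rat gessel_S0)) p" "degree p \<le> 8"
    using fin_ext_annihilator[OF E(1)] by auto
  have "8 \<le> degree r" if r: "annihilates_over ?F (fps_to_fls (fps_rat gessel_S0)) r" for r
  proof -
    have "annihilates_over (subfield_generated (fps_to_fls ` {fps_X})) (fps_to_fls gessel_S0) r"
      using r by (simp only: fps_to_fls_X fps_rat_id image_insert image_empty)
    from annihilates_over_transfer[OF ring_morph_fps_rat fps_map_inj[OF ring_morph_of_rat] this]
    obtain r' where r': "annihilates_over (subfield_generated {fls_X :: biv fls}) (fps_to_fls (fps_rat gessel_S0)) r'" "degree r' = degree r"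
      by (auto simp: fps_rat_X fps_to_fls_X)
    have "subfield_generated {fls_X} \<subseteq> subfield_generated {fls_X, fls_const biv_x, fls_const biv_y}"
      by (rule subfield_generated_mono) simp
    from scaled.degree_S0[OF annihilates_over_mono[OF this r'(1)]] r'(2) show ?thesis
      by simp
  qed
  then show ?thesis
    unfolding Q by (rule algebraic_of_degreeI[OF subfield_subfield_generated p])
qed

lemma ring_morph_eval_biv: "ring_morph (\<lambda>p. poly (map_poly of_rat p) c)"
  by (rule ring_morph_poly[OF ring_morph_of_rat])

lemma eval_biv_inj: "poly (map_poly of_rat p) biv_x = 0 \<Longrightarrow> p = 0" "poly (map_poly of_rat p) biv_y = 0 \<Longrightarrow> p = 0"
proof -
  show "p = 0" if "poly (map_poly of_rat p) biv_x = 0"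
    using that by (simp add: eval_biv_x)
  show "p = 0" if "poly (map_poly of_rat p) biv_y = 0"
  proof -
    have "map_poly of_rat p = map_poly (\<lambda>p. to_fract [:p:]) (map_poly (\<lambda>c. [:c:]) p :: rat poly poly)"
      by (subst map_poly_map_poly) (simp_all add: o_def of_rat_biv[abs_def])
    with that have "map_poly (\<lambda>c. [:c:]) p = 0"
      by (simp add: eval_biv_y)
    then show ?thesis
      by (simp add: map_poly_eq_0_iff)
  qed
qed

text \<open>\<open>univ_var\<close> plays the role of x in part (3) and of y in part (4), so it has
  to be sent to either of the two variables.\<close>

lemma univ_embedding:
  assumes "c = biv_x \<or> c = biv_y"
  shows "\<exists>h :: rat poly fract \<Rightarrow> biv. ring_morph h \<and> h univ_var = c"
proof -
  define \<phi> where "\<phi> p = poly (map_poly of_rat p) c" for p :: "rat poly"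
  have \<phi>: "ring_morph \<phi>" "\<forall>p. \<phi> p = 0 \<longrightarrow> p = 0"
    using ring_morph_eval_biv[of c] eval_biv_inj assms unfolding \<phi>_def[abs_def] by blast+
  have "fract_ext \<phi> univ_var = c"
    unfolding univ_var_def fract_ext_to_fract[OF \<phi>] by (simp add: \<phi>_def map_poly_pCons)
  then show ?thesis
    using ring_morph_fract_ext[OF \<phi>] by blast
qed

lemma fps_map_X: "ring_morph h \<Longrightarrow> fps_map h fps_X = fps_X"
  by (rule fps_ext) (simp add: fps_X_def ring_morph_simps)

lemma degree_gessel_series_x:
  "algebraic_of_degree (subfield_generated {fps_to_fls (lift_fps gessel_Z), fls_const univ_var})
     (fps_to_fls (gessel_series (fps_const univ_var * fps_X) 0)) 3"
proof -
  define a where "a = fps_const univ_var * (fps_X :: rat poly fract fps)"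
  interpret gessel_field fls_X "fls_const univ_var" "fps_to_fls 0" "fps_to_fls (fps_rat gessel_Z)" "fps_to_fls (fps_psub a gessel_U)"
    "fps_to_fls (fps_psub 0 gessel_V)" "fps_to_fls (fps_psub a gessel_S)"
    "fps_to_fls (fps_psub 0 gessel_R)" "fps_to_fls (fps_rat gessel_S0)"
    by (rule gessel_field_fls) (simp_all add: a_def fps_to_fls_X fls_times_fps_to_fls fps_to_fls_const univ_var_nonzero)
  let ?F = "subfield_generated {fps_to_fls (fps_rat gessel_Z), fls_const univ_var}"
  have F: "fin_ext ?F ?F 1"
    by (rule fin_ext_refl[OF subfield_subfield_generated])
  obtain E where E: "fin_ext ?F E (1 * 3)" "?F \<subseteq> E" "fps_to_fls (fps_psub a gessel_U) \<in> E"
    using adjoin_U[OF F] by (auto intro: subfield_generated.base)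
  have "fps_to_fls (fps_rat gessel_Z) \<in> E"
    using E(2) by (auto intro: subfield_generated.base)
  then have "fps_to_fls (fps_psub a gessel_S) \<in> E"
    by (rule in_subfield(4)[OF fin_ext_subfield[OF E(1)] _ E(3)])
  then obtain p where p: "annihilates_over ?F (fps_to_fls (fps_psub a gessel_S)) p" "degree p \<le> 3"
    using fin_ext_annihilator[OF E(1)] by auto
  obtain h :: "rat poly fract \<Rightarrow> biv" where h: "ring_morph h" "h univ_var = biv_x"
    using univ_embedding by blast
  have "3 \<le> degree r" if r: "annihilates_over ?F (fps_to_fls (fps_psub a gessel_S)) r" for r
  proof -
    have "annihilates_over (subfield_generated (fps_to_fls ` {fps_rat gessel_Z, fps_const univ_var})) (fps_to_fls (fps_psub a gessel_S)) r"
      using r by (simp add: fps_to_fls_const)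
    from annihilates_over_transfer[OF ring_morph_fps_map[OF h(1)] fps_map_inj[OF h(1)] this]
    obtain r' where "annihilates_over (subfield_generated (fps_to_fls ` fps_map h ` {fps_rat gessel_Z, fps_const univ_var}))
        (fps_to_fls (fps_map h (fps_psub a gessel_S))) r'" "degree r' = degree r"
      by blast
    moreover have "fps_map h a = fps_const biv_x * fps_X"
      by (simp add: a_def ring_morph_mult[OF ring_morph_fps_map[OF h(1)]] fps_map_const ring_morph_0[OF h(1)] fps_map_X[OF h(1)] h(2))
    ultimately show ?thesis
      using scaled.degree_S[of r'] by (simp add: fps_map_psub[OF h(1)] fps_map_fps_rat[OF h(1)] fps_map_const
          ring_morph_0[OF h(1)] h(2) fps_to_fls_const)
  qed
  then show ?thesis
    unfolding gessel_series_x lift_fps_eq a_def[symmetric] by (rule algebraic_of_degreeI[OF subfield_subfield_generated p])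
qed

lemma degree_gessel_series_y:
  "algebraic_of_degree (subfield_generated {fps_to_fls (lift_fps gessel_Z), fls_const univ_var})
     (fps_to_fls (gessel_series 0 (fps_const univ_var))) 3"
proof -
  define b :: "rat poly fract fps" where "b = fps_const univ_var"
  interpret gessel_field fls_X 1 "fls_const univ_var" "fps_to_fls (fps_rat gessel_Z)" "fps_to_fls (fps_psub fps_X gessel_U)"
    "fps_to_fls (fps_psub b gessel_V)" "fps_to_fls (fps_psub fps_X gessel_S)"
    "fps_to_fls (fps_psub b gessel_R)" "fps_to_fls (fps_rat gessel_S0)"
    using gessel_field_fls[of 1 fps_X b] by (simp add: fps_to_fls_X b_def fps_to_fls_const)
  let ?F = "subfield_generated {fps_to_fls (fps_rat gessel_Z), fls_const univ_var}"
  have F: "fin_ext ?F ?F 1"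
    by (rule fin_ext_refl[OF subfield_subfield_generated])
  obtain E where E: "fin_ext ?F E (1 * 3)" "?F \<subseteq> E" "fps_to_fls (fps_psub b gessel_V) \<in> E"
    using adjoin_V[OF F] by (auto intro: subfield_generated.base)
  have "fps_to_fls (fps_rat gessel_Z) \<in> E"
    using E(2) by (auto intro: subfield_generated.base)
  then have "fps_to_fls (fps_psub b gessel_R) \<in> E"
    by (rule in_subfield(6)[OF fin_ext_subfield[OF E(1)] _ E(3)])
  then obtain p where p: "annihilates_over ?F (fps_to_fls (fps_psub b gessel_R)) p" "degree p \<le> 3"
    using fin_ext_annihilator[OF E(1)] by auto
  obtain h :: "rat poly fract \<Rightarrow> biv" where h: "ring_morph h" "h univ_var = biv_y"
    using univ_embedding by blast
  have "3 \<le> degree r" if r: "annihilates_over ?F (fps_to_fls (fps_psub b gessel_R)) r" for r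
  proof -
    have "annihilates_over (subfield_generated (fps_to_fls ` {fps_rat gessel_Z, fps_const univ_var})) (fps_to_fls (fps_psub b gessel_R)) r"
      using r by (simp add: fps_to_fls_const)
    from annihilates_over_transfer[OF ring_morph_fps_map[OF h(1)] fps_map_inj[OF h(1)] this]
    obtain r' where "annihilates_over (subfield_generated (fps_to_fls ` fps_map h ` {fps_rat gessel_Z, fps_const univ_var}))
        (fps_to_fls (fps_map h (fps_psub b gessel_R))) r'" "degree r' = degree r"
      by blast
    moreover have "fps_map h b = fps_const biv_y"
      by (simp add: b_def fps_map_const ring_morph_0[OF h(1)] h(2))
    ultimately show ?thesis
      using scaled.degree_R[of r'] by (simp add: fps_map_psub[OF h(1)] fps_map_fps_rat[OF h(1)] fps_map_const
          ring_morph_0[OF h(1)] h(2) fps_to_fls_const)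
  qed
  then show ?thesis
    unfolding gessel_series_y lift_fps_eq b_def[symmetric] by (rule algebraic_of_degreeI[OF subfield_subfield_generated p])
qed

section \<open>Characterizations of T, U, V and the formulas of the theorem\<close>

lemma gessel_T_iff:
  "fps_nth S 0 = 1 \<and> S = 1 + 256 * fps_X^2 * (S^3 / (S + 3)^3) \<longleftrightarrow> S = gessel_T" (is "?A \<longleftrightarrow> _")
proof -
  have "S = 1 + 256 * fps_X^2 * (S^3 / (S + 3)^3) \<longleftrightarrow> (S - 1) * (S + 3) ^ 3 = 256 * fps_X ^ 2 * S ^ 3"
    if S: "fps_nth S 0 = 1"
  proof -
    \<comment> \<open>The denominator is a unit, so the quotient of power series is a true
      quotient.\<close>
    have nz: "fps_nth ((S + 3) ^ 3) 0 \<noteq> 0"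
      using S by (simp add: fps_nth_power_0)
    then have nz': "(S + 3)^3 \<noteq> 0"
      by fastforce
    have "S^3 / (S + 3)^3 * (S + 3)^3 = S^3"
      using nz by (simp add: fps_divide_unit inverse_mult_eq_1 mult.assoc)
    then have "256 * fps_X ^ 2 * S ^ 3 = (256 * fps_X^2 * (S^3 / (S + 3)^3)) * (S + 3)^3"
      by (simp only: mult.assoc)
    then have "(S - 1) * (S + 3) ^ 3 = 256 * fps_X ^ 2 * S ^ 3 \<longleftrightarrow> S - 1 = 256 * fps_X^2 * (S^3 / (S + 3)^3)"
      using nz' by (simp only: mult_cancel_right) simp
    also have "\<dots> \<longleftrightarrow> S = 1 + 256 * fps_X^2 * (S^3 / (S + 3)^3)"
      by (metis add.commute diff_add_cancel add_diff_cancel_left')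
    finally show ?thesis
      by blast
  qed
  then show ?thesis
    using gessel_T gessel_T_unique by blast
qed

text \<open>A walk of length m ending at abscissa i contributes to t^(m + i), and m + i is
  even.\<close>

lemma gessel_series_parity:
  assumes "odd n"
  shows "fps_nth (gessel_series (fps_const x * fps_X) 0) n = 0"
proof -
  have "fps_nth (of_nat (gessel_count i j m) * (fps_const x * fps_X) ^ i * 0 ^ j) (n - m) = 0" if "m \<le> n" for i j m
  proof (cases "i + m = n \<and> j = 0")
    case True
    then have "gessel_count i j m = 0"
      using assms by (intro gessel_count_parity) simp
    then show ?thesis
      by simp
  next
    case False
    have "of_nat (gessel_count i j m) * (fps_const x * fps_X) ^ i * 0 ^ j =
        fps_const (of_nat (gessel_count i j m) * x ^ i * 0 ^ j) * fps_X ^ i"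
      by (simp add: power_mult_distrib fps_of_nat[symmetric] fps_const_power power_0_left mult_ac flip: fps_const_mult)
    then show ?thesis
      using False that by (auto simp: fps_X_power_nth power_0_left)
  qed
  then show ?thesis
    by (simp add: gessel_series_collapse fps_collapse_nth fps_sum_nth)
qed

text \<open>In this form the equation is no longer multiplied by t. At t = 0 and T = S = 1 both
  factors on the right vanish, so the derivative there is 32, from 16 T^2 S^2 alone. Hence the
  solution is unique even among series over \<rat>(x), and it lies in \<rat>[x][[t]].\<close>

lemma gessel_U_iff:
  fixes S :: "rat poly fract fps"
  defines "T \<equiv> fps_rat gessel_T" and "x \<equiv> fps_const univ_var"
  shows "fps_nth S 0 = 1 \<and> 16 * T^2 * (S^2 - T) = x * (S + S * T - 2 * T) * (S^2 - 9 * T + 8 * T * S + T^2 - T * S^2)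
    \<longleftrightarrow> S = fps_psub (x * fps_X) gessel_U"
proof -
  let ?p = "[:2 * T * x * (T^2 - 9 * T) - 16 * T^3, x * (16 * T^2 - (1 + T) * (T^2 - 9 * T)),
     16 * T^2 - x * (8 * T * (1 + T) - 2 * T * (1 - T)), - (x * (1 + T) * (1 - T)):]"
  have p: "poly ?p w = 16 * T^2 * (w^2 - T) - x * ((w + w * T - 2 * T) * gessel_D T w)" for w
    unfolding gessel_D_def by (simp add: power_numeral_reduce algebra_simps)
  have T0: "fps_nth T 0 = 1"
    by (simp add: T_def gessel_T)
  have ex1: "\<exists>!S. fps_nth S 0 = fps_nth 1 0 \<and> poly ?p S = 0"
    using T0 by (intro fps_hensel[where e = "1 / 32"])
      (simp_all add: pderiv_pCons fps_nth_power_0 x_def algebra_simps)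
  have U: "fps_nth (fps_psub (x * fps_X) gessel_U) 0 = 1" "poly ?p (fps_psub (x * fps_X) gessel_U) = 0"
  proof -
    show "fps_nth (fps_psub (x * fps_X) gessel_U) 0 = 1"
      using psub_U_expand[of "x * fps_X"] by auto
    have "fps_X * (16 * T^2 * ((fps_psub (x * fps_X) gessel_U)^2 - T)) =
      fps_X * (x * ((fps_psub (x * fps_X) gessel_U + fps_psub (x * fps_X) gessel_U * T - 2 * T) * gessel_D T (fps_psub (x * fps_X) gessel_U)))"
      using psub_U_eq[of "x * fps_X"] unfolding T_def by (simp add: mult_ac)
    then show "poly ?p (fps_psub (x * fps_X) gessel_U) = 0"
      unfolding p by simp
  qed
  have "(16 * T^2 * (S^2 - T) = x * (S + S * T - 2 * T) * (S^2 - 9 * T + 8 * T * S + T^2 - T * S^2)) \<longleftrightarrow> poly ?p S = 0" for S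
    unfolding p gessel_D_def by (simp add: mult.assoc)
  then show ?thesis
    using ex1 U by auto
qed

lemma gessel_V_iff:
  fixes S :: "rat poly fract fps"
  defines "T \<equiv> fps_rat gessel_T" and "y \<equiv> fps_const univ_var"
  shows "fps_nth S 0 = 0 \<and> 1 - T + 3 * S + S * T = y * S^2 * (3 + S + T - S * T) \<longleftrightarrow> S = fps_psub y gessel_V"
proof -
  let ?p = "[:1 - T, 3 + T, - (y * (3 + T)), - (y * (1 - T)):]"
  have p: "poly ?p w = 1 - T + 3 * w + w * T - y * (w^2 * (3 + w + T - w * T))" for w
    by (simp add: power_numeral_reduce algebra_simps)
  have T0: "fps_nth T 0 = 1"
    by (simp add: T_def gessel_T)
  have ex1: "\<exists>!S. fps_nth S 0 = fps_nth 0 0 \<and> poly ?p S = 0"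
    using T0 by (intro fps_hensel[where e = "1 / 4"]) (simp_all add: pderiv_pCons)
  have V: "fps_nth (fps_psub y gessel_V) 0 = 0" "poly ?p (fps_psub y gessel_V) = 0"
  proof -
    show "fps_nth (fps_psub y gessel_V) 0 = 0"
      using psub_V_expand[of y] by auto
    show "poly ?p (fps_psub y gessel_V) = 0"
      unfolding p unfolding T_def psub_V_eq by simp
  qed
  have "(1 - T + 3 * S + S * T = y * S^2 * (3 + S + T - S * T)) \<longleftrightarrow> poly ?p S = 0" for S
    unfolding p by (simp add: mult.assoc)
  then show ?thesis
    using ex1 V by auto
qed

text \<open>The quotient is formed among Laurent series, because its denominator contains 1 - T and
  is no unit among power series.\<close>

lemma gessel_x_formula:
  fixes a :: "'a::field_char_0 fps"
  assumes "a \<noteq> 0"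
  shows "let T = fps_to_fls (fps_rat gessel_T); Z = fps_to_fls (fps_rat gessel_Z); U = fps_to_fls (fps_psub a gessel_U) in
    fps_to_fls (gessel_series a 0) = 16 * T * (U + U * T - 2 * T) * gessel_M T U Z /
      ((1 - T) * (T + 3)^3 * (U + Z) * (U^2 - 9 * T + 8 * T * U + T^2 - T * U^2))"
proof -
  have "fps_to_fls a / fls_X * fls_X = fps_to_fls a"
    by (metis fls_X_nonzero nonzero_eq_divide_eq)
  from gessel_field_fls[OF this assms, of 0] interpret gessel_field fls_X "fps_to_fls a / fls_X" "fps_to_fls 0"
    "fps_to_fls (fps_rat gessel_Z)" "fps_to_fls (fps_psub a gessel_U)"
    "fps_to_fls (fps_psub 0 gessel_V)" "fps_to_fls (fps_psub a gessel_S)"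
    "fps_to_fls (fps_psub 0 gessel_R)" "fps_to_fls (fps_rat gessel_S0)" .
  have "fps_to_fls (fps_rat gessel_Z) ^ 2 = (fps_to_fls (fps_rat gessel_T) :: 'a fls)"
    by (simp only: fps_rat_gessel_Z flip: fps_to_fls_simps(7))
  with vals nonzero(4) show ?thesis
    unfolding gessel_values_def Let_def gessel_D_def gessel_series_x by (simp add: nonzero_eq_divide_eq)
qed

lemma gessel_y_formula:
  fixes b :: "'a::field_char_0 fps"
  shows "let T = fps_to_fls (fps_rat gessel_T); Z = fps_to_fls (fps_rat gessel_Z); V = fps_to_fls (fps_psub b gessel_V) in
    fps_to_fls (gessel_series 0 b) = 16 * V * Z^3 * (3 + V + T - V * T) * gessel_N T V Z /
      ((T - 1) * (T + 3)^3 * (1 + V)^2 * (1 + Z + V - V * Z)^2)"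
proof -
  interpret gessel_field fls_X 1 "fps_to_fls b" "fps_to_fls (fps_rat gessel_Z)" "fps_to_fls (fps_psub fps_X gessel_U)"
    "fps_to_fls (fps_psub b gessel_V)" "fps_to_fls (fps_psub fps_X gessel_S)"
    "fps_to_fls (fps_psub b gessel_R)" "fps_to_fls (fps_rat gessel_S0) :: 'a fls"
    by (rule gessel_field_fls) (simp_all add: fps_to_fls_X)
  have "fps_to_fls (fps_rat gessel_Z) ^ 2 = (fps_to_fls (fps_rat gessel_T) :: 'a fls)"
    by (simp only: fps_rat_gessel_Z flip: fps_to_fls_simps(7))
  with vals nonzero(5) show ?thesis
    unfolding gessel_values_def Let_def gessel_series_y by (simp add: nonzero_eq_divide_eq)
qed

lemma fps_psub_coeffs:
  "\<forall>n. fps_nth (fps_psub (fps_const univ_var * fps_X) f) n \<in> range to_fract"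
  "\<forall>n. fps_nth (fps_psub (fps_const univ_var) f) n \<in> range to_fract"
proof -
  have "fps_const univ_var * fps_X \<in> (fps_integral_coeffs :: rat poly fract fps set)"
    "fps_const univ_var \<in> (fps_integral_coeffs :: rat poly fract fps set)"
    by (auto simp: fps_integral_coeffs_def univ_var_def fps_X_def intro: range_to_fract_closed)
  then show "\<forall>n. fps_nth (fps_psub (fps_const univ_var * fps_X) f) n \<in> range to_fract"
    "\<forall>n. fps_nth (fps_psub (fps_const univ_var) f) n \<in> range to_fract"
    using fps_psub_integral_coeffs unfolding fps_integral_coeffs_def by blast+
qed

theorem theorem1:
  shows
    "algebraic_of_degree
       (subfield_generated {fls_const biv_x, fls_const biv_y, fls_X})
       (fps_to_fls (gessel_series (fps_const biv_x) (fps_const biv_y))) 72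
     \<and>
     algebraic_of_degree
       (subfield_generated {fls_X})
       (fps_to_fls (gessel_series (0 :: rat fps) 0)) 8
     \<and>
     (\<exists>T Z :: rat fps.
        (\<forall>S. fps_nth S 0 = 1 \<and> S = 1 + 256 * fps_X^2 * (S^3 / (S + 3)^3) \<longleftrightarrow> S = T) \<and>
        (\<forall>S. fps_nth S 0 = 1 \<and> S^2 = T \<longleftrightarrow> S = Z) \<and>
        gessel_series 0 0 =
          32 * Z^3 * (3 + 3 * Z - 3 * Z^2 + Z^3) / ((1 + Z) * (Z^2 + 3)^3)
        \<and>
        (let x = univ_var; Q = gessel_series (fps_const x * fps_X) 0; T' = lift_fps T in
          (\<forall>n. odd n \<longrightarrow> fps_nth Q n = 0) \<and>
          (\<forall>n. fps_nth Q n \<in> range to_fract) \<and>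
          algebraic_of_degree
            (subfield_generated {fps_to_fls (lift_fps Z), fls_const x}) (fps_to_fls Q) 3 \<and>
          (\<exists>U.
            (\<forall>S. fps_nth S 0 = 1 \<and>
                 16 * T'^2 * (S^2 - T') =
                   fps_const x * (S + S * T' - 2 * T') *
                     (S^2 - 9 * T' + 8 * T' * S + T'^2 - T' * S^2)
                 \<longleftrightarrow> S = U) \<and>
            (\<forall>n. fps_nth U n \<in> range to_fract) \<and>
            (let T = fps_to_fls T'; Z = fps_to_fls (lift_fps Z); U = fps_to_fls U in
              fps_to_fls Q =
                16 * T * (U + U * T - 2 * T) * gessel_M T U Z /
                ((1 - T) * (T + 3)^3 * (U + Z) *
                 (U^2 - 9 * T + 8 * T * U + T^2 - T * U^2)))))
        \<and>
        (let y = univ_var; Q = gessel_series 0 (fps_const y); T' = lift_fps T in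
          algebraic_of_degree
            (subfield_generated {fps_to_fls (lift_fps Z), fls_const y}) (fps_to_fls Q) 3 \<and>
          (\<exists>V.
            (\<forall>S. fps_nth S 0 = 0 \<and>
                 1 - T' + 3 * S + S * T' = fps_const y * S^2 * (3 + S + T' - S * T')
                 \<longleftrightarrow> S = V) \<and>
            (\<forall>n. fps_nth V n \<in> range to_fract) \<and>
            (let T = fps_to_fls T'; Z = fps_to_fls (lift_fps Z); V = fps_to_fls V in
              fps_to_fls Q =
                16 * V * Z^3 * (3 + V + T - V * T) * gessel_N T V Z /
                ((T - 1) * (T + 3)^3 * (1 + V)^2 * (1 + Z + V - V * Z)^2)))))"
proof (rule conjI[OF degree_gessel_series conjI[OF degree_gessel_series_0_0]],
    rule exI[of _ gessel_T], rule exI[of _ gessel_Z], intro conjI)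
  show "\<forall>S. fps_nth S 0 = 1 \<and> S = 1 + 256 * fps_X^2 * (S^3 / (S + 3)^3) \<longleftrightarrow> S = gessel_T"
    using gessel_T_iff by blast
  show "\<forall>S. fps_nth S 0 = 1 \<and> S^2 = gessel_T \<longleftrightarrow> S = gessel_Z"
    using gessel_Z gessel_Z_unique by blast
  show "gessel_series 0 0 = 32 * gessel_Z^3 * (3 + 3 * gessel_Z - 3 * gessel_Z^2 + gessel_Z^3)
      / ((1 + gessel_Z) * (gessel_Z^2 + 3)^3)"
    by (simp only: gessel_series_eq gessel_S0_def)
next
  have "fps_const univ_var * fps_X \<noteq> (0 :: rat poly fract fps)"
    by (simp add: univ_var_nonzero)
  note formula = gessel_x_formula[OF this, unfolded Let_def]
  show "let x = univ_var; Q = gessel_series (fps_const x * fps_X) 0; T' = lift_fps gessel_T in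
          (\<forall>n. odd n \<longrightarrow> fps_nth Q n = 0) \<and>
          (\<forall>n. fps_nth Q n \<in> range to_fract) \<and>
          algebraic_of_degree
            (subfield_generated {fps_to_fls (lift_fps gessel_Z), fls_const x}) (fps_to_fls Q) 3 \<and>
          (\<exists>U.
            (\<forall>S. fps_nth S 0 = 1 \<and>
                 16 * T'^2 * (S^2 - T') =
                   fps_const x * (S + S * T' - 2 * T') *
                     (S^2 - 9 * T' + 8 * T' * S + T'^2 - T' * S^2)
                 \<longleftrightarrow> S = U) \<and>
            (\<forall>n. fps_nth U n \<in> range to_fract) \<and>
            (let T = fps_to_fls T'; Z = fps_to_fls (lift_fps gessel_Z); U = fps_to_fls U in
              fps_to_fls Q =
                16 * T * (U + U * T - 2 * T) * gessel_M T U Z /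
                ((1 - T) * (T + 3)^3 * (U + Z) *
                 (U^2 - 9 * T + 8 * T * U + T^2 - T * U^2))))"
    unfolding Let_def
  proof (intro conjI exI[of _ "fps_psub (fps_const univ_var * fps_X) gessel_U"] allI impI, goal_cases)
    case (1 n)
    then show ?case
      by (rule gessel_series_parity)
  next
    case (2 n)
    then show ?case
      using fps_psub_coeffs(1) unfolding gessel_series_x by blast
  next
    case 3
    then show ?case
      by (rule degree_gessel_series_x)
  next
    case (4 S)
    then show ?case
      unfolding lift_fps_eq by (rule gessel_U_iff)
  next
    case (5 n)
    then show ?case
      using fps_psub_coeffs(1) by blast
  next
    case 6
    then show ?case
      unfolding lift_fps_eq by (rule formula)
  qed
next
  show "let y = univ_var; Q = gessel_series 0 (fps_const y); T' = lift_fps gessel_T in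
          algebraic_of_degree
            (subfield_generated {fps_to_fls (lift_fps gessel_Z), fls_const y}) (fps_to_fls Q) 3 \<and>
          (\<exists>V.
            (\<forall>S. fps_nth S 0 = 0 \<and>
                 1 - T' + 3 * S + S * T' = fps_const y * S^2 * (3 + S + T' - S * T')
                 \<longleftrightarrow> S = V) \<and>
            (\<forall>n. fps_nth V n \<in> range to_fract) \<and>
            (let T = fps_to_fls T'; Z = fps_to_fls (lift_fps gessel_Z); V = fps_to_fls V in
              fps_to_fls Q =
                16 * V * Z^3 * (3 + V + T - V * T) * gessel_N T V Z /
                ((T - 1) * (T + 3)^3 * (1 + V)^2 * (1 + Z + V - V * Z)^2)))"
    unfolding Let_def
  proof (intro conjI exI[of _ "fps_psub (fps_const univ_var) gessel_V"] allI, goal_cases)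
    case 1
    then show ?case
      by (rule degree_gessel_series_y)
  next
    case (2 S)
    then show ?case
      unfolding lift_fps_eq by (rule gessel_V_iff)
  next
    case (3 n)
    then show ?case
      using fps_psub_coeffs(2) by blast
  next
    case 4
    then show ?case
      unfolding lift_fps_eq by (rule gessel_y_formula[of "fps_const univ_var", unfolded Let_def])
  qed
qed

end
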